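(* Let $\mathcal{X}$ be a smooth Banach space, let $\mu$ be a probability distribution on $\mathcal{X}$, and let $\mathbf{X}_1,\mathbf{X}_2,\ldots$ be i.i.d. random elements with distribution $\mu$. (1) Suppose that $\mathcal{X}^*$ is separable; that there exists a Borel measurable map $T:\mathcal{X}\setminus\{\mathbf{0}\}\to(0,\infty)$ such that $\|\mathrm{SGN}_{\mathbf{x}+\mathbf{h}}-\mathrm{SGN}_{\mathbf{x}}\|\le T(\mathbf{x})\|\mathbf{h}\|$ for all $\mathbf{x},\mathbf{h}\in\mathcal{X}$ with $\mathbf{x}\ne\mathbf{0}$, $\mathbf{x}\neq-\mathbf{h}$; and that $\sup_{\|\mathbf{x}\|\le C}E_{\mu_1}\{T(\mathbf{x}-\mathbf{X})\}<\infty$ for each $C>0$, where $\mu_1$ is the nonatomic part of $\mu$. Then $\sup_{\mathbf{x}\in K}|\widehat{\mathrm{SD}}(\mathbf{x})-\mathrm{SD}(\mathbf{x})|\to0$ as $n\to\infty$ almost surely for every compact set $K\subseteq\mathcal{X}$. (2) Suppose that the norm function in $\mathcal{X}^*$ is Fréchet differentiable, and $\mathcal{X}^*$ is a separable and type 2 Banach space. Let $\mathbf{x}\in\mathcal{X}$. If $S_{\mathbf{x}}\ne\mathbf{0}$, then $\sqrt{n}(\widehat{\mathrm{SD}}(\mathbf{x})-\mathrm{SD}(\mathbf{x}))$ converges weakly to $\mathrm{SGN}_{S_{\mathbf{x}}}(\mathbf{W})$ as $n\to\infty$. If $S_{\mathbf{x}}=\mathbf{0}$, then $\sqrt{n}(\widehat{\mathrm{SD}}(\mathbf{x})-\mathrm{SD}(\mathbf{x}))$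 converges weakly to $-\|\mathbf{V}\|$ as $n\to\infty$. Here, $\mathbf{W}$ and $\mathbf{V}$ are zero mean Gaussian random elements in $\mathcal{X}^*$.
   Context: A (real) Banach space is smooth if its norm is Gâteaux differentiable at each nonzero $\mathbf{x}$; the derivative is $\mathrm{SGN}_{\mathbf{x}}$, a continuous linear functional with $\mathrm{SGN}_{\mathbf{x}}(\mathbf{h})=\lim_{t\to0}t^{-1}(\|\mathbf{x}+t\mathbf{h}\|-\|\mathbf{x}\|)$, with convention $\mathrm{SGN}_{\mathbf{0}}=\mathbf{0}$. The norm is Fréchet differentiable if this limit is uniform over $\{\mathbf{h}:\|\mathbf{h}\|=1\}$ (at each nonzero $\mathbf{x}$). For $S\in\mathcal{X}^*\setminus\{\mathbf{0}\}$, $\mathrm{SGN}_{S}\in\mathcal{X}^{**}$ denotes the derivative of the norm of $\mathcal{X}^*$ at $S$. The spatial distribution at $\mathbf{x}$ is $S_{\mathbf{x}}=E\{\mathrm{SGN}_{\mathbf{x}-\mathbf{X}}\}\in\mathcal{X}^*$ (Bochner expectation), $\mathbf{X}\sim\mu$, and its empirical version is $\widehat{S}_{\mathbf{x}}=n^{-1}\sum_{i=1}^n\mathrm{SGN}_{\mathbf{x}-\mathbf{X}_i}$. The spatial depth is $\mathrm{SD}(\mathbf{x})=1-\|S_{\mathbf{x}}\|$ and the empirical spatial depth is $\widehat{\mathrm{SD}}(\mathbf{x})=1-\|\widehat{S}_{\mathbf{x}}\|$. Write $\mu=\rho\mu_1+(1-\rho)\mu_2$ with $\rho\in[0,1]$,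 where the probability measures $\mu_1,\mu_2$ are the nonatomic and atomic parts of $\mu$; $E_{\mu_1}$ is expectation when $\mathbf{X}\sim\mu_1$ (condition vacuous if $\rho=0$). A Banach space $\mathcal{Y}$ is of type 2 if there is $\gamma>0$ such that for any $n\ge1$ and independent zero mean random elements $\mathbf{U}_1,\ldots,\mathbf{U}_n$ in $\mathcal{Y}$ with $E\{\|\mathbf{U}_i\|^2\}<\infty$, $E\{\|\sum_{i=1}^n\mathbf{U}_i\|^2\}\le\gamma\sum_{i=1}^nE\{\|\mathbf{U}_i\|^2\}$. A random element of a separable Banach space $\mathcal{Y}$ is Gaussian with mean $\mathbf{m}\in\mathcal{Y}$ and covariance $\mathbf{C}:\mathcal{Y}^*\to\mathcal{Y}^{**}$ (symmetric, nonnegative definite, continuous linear) if for any $\mathbf{l}\in\mathcal{Y}^*$, its image under $\mathbf{l}$ is Gaussian on $\mathbb{R}$ with mean $\mathbf{l}(\mathbf{m})$ and variance $(\mathbf{C}(\mathbf{l}))(\mathbf{l})$. *)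

theory Defs
  imports "HOL-Probability.Probability"
begin

definition norm_gateaux_deriv :: "'b::real_normed_vector \<Rightarrow> ('b \<Rightarrow>\<^sub>L real) \<Rightarrow> bool" where
  "norm_gateaux_deriv x L \<longleftrightarrow>
     (\<forall>h. ((\<lambda>t. (norm (x + t *\<^sub>R h) - norm x) / t) \<longlongrightarrow> blinfun_apply L h) (at (0::real)))"

definition SGN :: "'b::real_normed_vector \<Rightarrow> ('b \<Rightarrow>\<^sub>L real)" where
  "SGN x = (if x = 0 then 0 else (THE L. norm_gateaux_deriv x L))"

definition smooth_space :: "'b::real_normed_vector itself \<Rightarrow> bool" where
  "smooth_space _ \<longleftrightarrow> (\<forall>x::'b. x \<noteq> 0 \<longrightarrow> (\<exists>L. norm_gateaux_deriv x L))"

definition frechet_smooth_space :: "'b::real_normed_vector itself \<Rightarrow> bool" where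
  "frechet_smooth_space _ \<longleftrightarrow>
     smooth_space TYPE('b) \<and>
     (\<forall>x::'b. x \<noteq> 0 \<longrightarrow>
        uniform_limit (sphere 0 1) (\<lambda>t h. (norm (x + t *\<^sub>R h) - norm x) / t)
          (blinfun_apply (SGN x)) (at (0::real)))"

text \<open>
  The library's Bochner integral demands the type class of second countable spaces, which the dual
  type \<open>'a \<Rightarrow>\<^sub>L real\<close> does not have in general (here separability of the dual is a hypothesis on
  the space).  The following is word for word the library's definition without that class.
\<close>

definition has_bochner_expectation ::
    "'m measure \<Rightarrow> ('m \<Rightarrow> 'b::real_normed_vector) \<Rightarrow> 'b \<Rightarrow> bool" where
  "has_bochner_expectation M f z \<longleftrightarrow>
     f \<in> borel_measurable M \<and>
     (\<exists>s. (\<forall>i::nat. Bochner_Integration.simple_bochner_integrable M (s i)) \<and>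
          (\<lambda>i. \<integral>\<^sup>+\<omega>. ennreal (norm (f \<omega> - s i \<omega>)) \<partial>M) \<longlonglongrightarrow> 0 \<and>
          (\<lambda>i. Bochner_Integration.simple_bochner_integral M (s i)) \<longlonglongrightarrow> z)"

definition bochner_expectation :: "'m measure \<Rightarrow> ('m \<Rightarrow> 'b::real_normed_vector) \<Rightarrow> 'b" where
  "bochner_expectation M f =
     (if \<exists>z. has_bochner_expectation M f z then THE z. has_bochner_expectation M f z else 0)"

definition spatial_distribution ::
    "'a::real_normed_vector measure \<Rightarrow> 'a \<Rightarrow> ('a \<Rightarrow>\<^sub>L real)" where
  "spatial_distribution \<mu> x = bochner_expectation \<mu> (\<lambda>y. SGN (x - y))"

definition spatial_depth :: "'a::real_normed_vector measure \<Rightarrow> 'a \<Rightarrow> real" where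
  "spatial_depth \<mu> x = 1 - norm (spatial_distribution \<mu> x)"

text \<open>The sample of size \<open>n\<close> consists of \<open>X 0, \<dots>, X (n - 1)\<close>.\<close>

definition emp_spatial_distribution ::
    "(nat \<Rightarrow> 'w \<Rightarrow> 'a::real_normed_vector) \<Rightarrow> nat \<Rightarrow> 'w \<Rightarrow> 'a \<Rightarrow> ('a \<Rightarrow>\<^sub>L real)" where
  "emp_spatial_distribution X n \<omega> x = (1 / real n) *\<^sub>R (\<Sum>i<n. SGN (x - X i \<omega>))"

definition emp_spatial_depth ::
    "(nat \<Rightarrow> 'w \<Rightarrow> 'a::real_normed_vector) \<Rightarrow> nat \<Rightarrow> 'w \<Rightarrow> 'a \<Rightarrow> real" where
  "emp_spatial_depth X n \<omega> x = 1 - norm (emp_spatial_distribution X n \<omega> x)"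

definition measure_atom :: "'b measure \<Rightarrow> 'b set \<Rightarrow> bool" where
  "measure_atom M A \<longleftrightarrow>
     A \<in> sets M \<and> emeasure M A > 0 \<and>
     (\<forall>B\<in>sets M. B \<subseteq> A \<longrightarrow> emeasure M B = 0 \<or> emeasure M B = emeasure M A)"

definition nonatomic :: "'b measure \<Rightarrow> bool" where
  "nonatomic M \<longleftrightarrow> (\<nexists>A. measure_atom M A)"

definition purely_atomic :: "'b measure \<Rightarrow> bool" where
  "purely_atomic M \<longleftrightarrow>
     (\<forall>A\<in>sets M. emeasure M A > 0 \<longrightarrow> (\<exists>B. B \<subseteq> A \<and> measure_atom M B))"

text \<open>
  A component of weight zero plays no role, so it is only required to be some probability measure
  (on the zero space there is no nonatomic one).
\<close>

definition atomic_decomposition ::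
    "'a::topological_space measure \<Rightarrow> real \<Rightarrow> 'a measure \<Rightarrow> 'a measure \<Rightarrow> bool" where
  "atomic_decomposition \<mu> \<rho> \<mu>1 \<mu>2 \<longleftrightarrow>
     0 \<le> \<rho> \<and> \<rho> \<le> 1 \<and>
     prob_space \<mu>1 \<and> sets \<mu>1 = sets borel \<and>
     prob_space \<mu>2 \<and> sets \<mu>2 = sets borel \<and>
     (\<rho> > 0 \<longrightarrow> nonatomic \<mu>1) \<and> (\<rho> < 1 \<longrightarrow> purely_atomic \<mu>2) \<and>
     (\<forall>A\<in>sets borel. measure \<mu> A = \<rho> * measure \<mu>1 A + (1 - \<rho>) * measure \<mu>2 A)"

text \<open>
  A definition cannot quantify over the type of the sample space.  Taking sample spaces on
  \<open>nat \<Rightarrow> 'b\<close> loses nothing, since every joint law of \<open>U 0, \<dots>, U (n - 1)\<close> is realised there by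
  coordinate maps.
\<close>

definition type_2_space :: "'b::real_normed_vector itself \<Rightarrow> bool" where
  "type_2_space _ \<longleftrightarrow>
     (\<exists>\<gamma>>0. \<forall>n\<ge>1. \<forall>(M :: (nat \<Rightarrow> 'b) measure) (U :: nat \<Rightarrow> (nat \<Rightarrow> 'b) \<Rightarrow> 'b).
        prob_space M \<longrightarrow>
        prob_space.indep_vars M (\<lambda>_. borel) U {..<n} \<longrightarrow>
        (\<forall>i<n. has_bochner_expectation M (U i) 0) \<longrightarrow>
        (\<forall>i<n. integrable M (\<lambda>\<omega>. (norm (U i \<omega>))\<^sup>2)) \<longrightarrow>
        (LINT \<omega>|M. (norm (\<Sum>i<n. U i \<omega>))\<^sup>2) \<le> \<gamma> * (\<Sum>i<n. LINT \<omega>|M. (norm (U i \<omega>))\<^sup>2))"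

text \<open>The library's \<open>normal_density\<close> is not meaningful for variance zero, where the law is a point mass.\<close>

definition real_gaussian :: "real \<Rightarrow> real \<Rightarrow> real measure" where
  "real_gaussian m v =
     (if v = 0 then return borel m else density lborel (\<lambda>y. ennreal (normal_density m (sqrt v) y)))"

definition gaussian_element ::
    "'m measure \<Rightarrow> ('m \<Rightarrow> 'b::real_normed_vector) \<Rightarrow> 'b \<Rightarrow>
     (('b \<Rightarrow>\<^sub>L real) \<Rightarrow>\<^sub>L (('b \<Rightarrow>\<^sub>L real) \<Rightarrow>\<^sub>L real)) \<Rightarrow> bool" where
  "gaussian_element N W m C \<longleftrightarrow>
     prob_space N \<and> W \<in> borel_measurable N \<and>
     (\<forall>k l. blinfun_apply (blinfun_apply C k) l = blinfun_apply (blinfun_apply C l) k) \<and>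
     (\<forall>l. 0 \<le> blinfun_apply (blinfun_apply C l) l) \<and>
     (\<forall>l. distr N borel (\<lambda>\<omega>. blinfun_apply l (W \<omega>)) =
          real_gaussian (blinfun_apply l m) (blinfun_apply (blinfun_apply C l) l))"

end

theory Submission
  imports Defs
begin

text \<open>
  Since the dual is separable, a dual-valued map is measurable as soon as its evaluations are, and its
  Bochner expectation is computed by evaluation.

  For uniform convergence, fix a net point \<open>x\<close>. When \<open>x'\<close> is within \<open>\<eta>\<close> of \<open>x\<close>, the difference
  \<open>SGN (x' - y) - SGN (x - y)\<close> has norm at most \<open>min 2 (\<eta> * T (x - y))\<close> for every
  \<open>y \<noteq> x\<close>; this includes \<open>y = x'\<close>, because the Lipschitz condition between \<open>u\<close> and \<open>- u\<close>
  forces \<open>1 \<le> T u * norm u\<close>. The expectation of this bound vanishes as \<open>\<eta> \<rightarrow> 0\<close>, a possible atom at \<open>x\<close>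
  is controlled by its empirical frequency, and a finite subcover of \<open>K\<close> together with the strong law
  at the net points finishes the argument.

  For weak convergence, type 2 allows the centred variables \<open>SGN (x - X) - S\<close> to be replaced by
  finite-rank simple ones, uniformly in the sample size. For these the central limit theorem reduces to
  one dimension by characteristic functions and trigonometric approximation. All finite-rank limits
  are linear images of one Gaussian sequence, obtained from a Cholesky decomposition of the
  covariances; type 2 bounds the increments of these images, so they converge almost surely to the
  limiting Gaussian element. The depth is then handled by the norm itself if \<open>S = 0\<close>, and by its first
  order expansion at \<open>S\<close> otherwise.
\<close>

section \<open>Separable dual spaces\<close>

text \<open>All summands are bounded, because \<open>norm (SGN u) \<le> 1\<close>. Hoeffding's
  inequality therefore supplies both the strong law (with Borel-Cantelli) and the tightness of
  normalised sums. The obstacle in the limit theorem is that finitely many evaluations do not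
  control the norm. Type 2 closes this gap: it bounds the mean square norm of a normalised sum by
  that of one summand, independently of the sample size. Approximation errors are taken to be
  \<open>(1 / 4) ^ m\<close> in mean square. A first moment is bounded by \<open>2 ^ m\<close> times
  a second moment plus \<open>(1 / 2) ^ m\<close>, so first moments decay like
  \<open>(1 / 2) ^ m\<close>, which is summable. The Gaussian sequence lives on the product of
  countably many standard normal laws. On this one space the limit is an almost sure one, and no
  compactness argument for laws on the dual enters. Depth is one minus a norm, so the first order
  term appears with a minus sign; the symmetry of centred Gaussian laws removes it.\<close>

lemma separable_dense_sequence:
  assumes "separable_space (euclidean :: 'b::metric_space topology)"
  obtains d :: "nat \<Rightarrow> 'b::metric_space" where "\<And>y e. e > 0 \<Longrightarrow> \<exists>k. dist y (d k) < e"
proof -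
  obtain C :: "'b set" where C: "countable C" "closure C = UNIV"
    using assms by (auto simp: separable_space_def)
  then have ne: "C \<noteq> {}" by auto
  show ?thesis
  proof (rule that)
    fix y :: 'b and e :: real assume "e > 0"
    have "y \<in> closure C" using C by simp
    then obtain c where "c \<in> C" "dist c y < e"
      using \<open>e > 0\<close> closure_approachable by blast
    then show "\<exists>k. dist y (from_nat_into C k) < e"
      using C ne by (metis dist_commute from_nat_into_surj)
  qed
qed

text \<open>If every value on the unit ball stayed below \<open>norm L - e\<close>, then testing
  \<open>u\<close> and \<open>- u\<close> would make \<open>norm L - e\<close> an operator bound for
  \<open>L\<close>.\<close>

lemma dual_norm_almost_attained:
  fixes L :: "'a::real_normed_vector \<Rightarrow>\<^sub>L real"
  assumes "e > 0"
  shows "\<exists>h. norm h \<le> 1 \<and> norm L - e \<le> blinfun_apply L h"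
proof (rule ccontr)
  assume "\<not> ?thesis"
  then have *: "blinfun_apply L h < norm L - e" if "norm h \<le> 1" for h
    using that by (meson not_le_imp_less)
  from *[of 0] have pos: "0 < norm L - e" by (simp add: blinfun.zero_right)
  have "norm L \<le> norm L - e"
  proof (rule norm_blinfun_bound)
    fix h
    show "norm (blinfun_apply L h) \<le> (norm L - e) * norm h"
    proof (cases "h = 0")
      case False
      define u where "u = (1 / norm h) *\<^sub>R h"
      have u: "norm u = 1" using False by (simp add: u_def)
      have "\<bar>blinfun_apply L u\<bar> \<le> norm L - e"
        using *[of u] *[of "- u"] u by (simp add: blinfun.minus_right abs_le_iff)
      then have "norm h * \<bar>blinfun_apply L u\<bar> \<le> norm h * (norm L - e)"
        by (rule mult_left_mono) simp
      moreover have "norm h * \<bar>blinfun_apply L u\<bar> = \<bar>blinfun_apply L h\<bar>"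
        using False by (simp add: u_def blinfun.scaleR_right abs_mult)
      ultimately show ?thesis by (simp add: mult.commute)
    qed (simp add: blinfun.zero_right)
  qed (use pos in simp)
  then show False using assms by simp
qed

text \<open>The sequence consists of near-maximisers \<open>g k j\<close> of the dense functionals
  \<open>d k\<close>, with error \<open>1 / Suc j\<close>; a functional close to \<open>d k\<close>
  is nearly normed by the same vectors. The norm becomes a countable supremum of evaluations,
  through which measurability passes from evaluations to norms.\<close>

lemma dual_norming_sequence:
  assumes "separable_space (euclidean :: ('a::real_normed_vector \<Rightarrow>\<^sub>L real) topology)"
  obtains H :: "nat \<Rightarrow> 'a::real_normed_vector" where "\<And>k. norm (H k) \<le> 1"
    and "\<And>(L::'a \<Rightarrow>\<^sub>L real) r. (\<And>k. \<bar>blinfun_apply L (H k)\<bar> \<le> r) \<Longrightarrow> norm L \<le> r"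
proof -
  obtain d :: "nat \<Rightarrow> ('a \<Rightarrow>\<^sub>L real)" where d: "\<And>y e. e > 0 \<Longrightarrow> \<exists>k. dist y (d k) < e"
    using separable_dense_sequence[OF assms] by blast
  have "\<forall>k j. \<exists>h. norm h \<le> 1 \<and> norm (d k) - 1 / real (Suc j) \<le> blinfun_apply (d k) h"
    using dual_norm_almost_attained by (metis of_nat_0_less_iff zero_less_Suc zero_less_divide_1_iff)
  then obtain g where g: "\<And>k j. norm (g k j) \<le> 1"
    "\<And>k j. norm (d k) - 1 / real (Suc j) \<le> blinfun_apply (d k) (g k j)"
    by metis
  define H where "H i = (case prod_decode i of (k, j) \<Rightarrow> g k j)" for i
  have Hg: "H (prod_encode (k, j)) = g k j" for k j by (simp add: H_def)
  show ?thesis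
  proof (rule that)
    show "norm (H k) \<le> 1" for k by (auto simp: H_def g split: prod.split)
  next
    fix L :: "'a \<Rightarrow>\<^sub>L real" and r
    assume r: "\<And>k. \<bar>blinfun_apply L (H k)\<bar> \<le> r"
    show "norm L \<le> r"
    proof (rule field_le_epsilon)
      fix e :: real assume "e > 0"
      \<comment> \<open>The three thirds of \<open>e\<close> pay for moving from \<open>L\<close> to
        \<open>d k\<close>, from the norm of \<open>d k\<close> to its value at
        \<open>g k j\<close>, and back from \<open>d k\<close> to \<open>L\<close> at that
        vector.\<close>
      then obtain k where k: "dist L (d k) < e / 3" using d[of "e / 3" L] by auto
      obtain j where j: "1 / real (Suc j) < e / 3"
        using \<open>e > 0\<close> nat_approx_posE[of "e/3"] by (metis divide_pos_pos zero_less_numeral)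
      have 1: "norm L \<le> norm (d k) + e / 3"
        using k norm_triangle_sub[of L "d k"] by (simp add: dist_norm)
      have 2: "norm (d k) \<le> blinfun_apply (d k) (g k j) + e / 3"
        using g(2)[of k j] j by linarith
      have "\<bar>blinfun_apply (d k - L) (g k j)\<bar> \<le> norm (d k - L) * norm (g k j)"
        using norm_blinfun[of "d k - L" "g k j"] by simp
      also have "\<dots> \<le> norm (d k - L) * 1"
        by (rule mult_left_mono) (use g in auto)
      also have "\<dots> < e / 3" using k by (simp add: dist_norm norm_minus_commute)
      finally have 3: "blinfun_apply (d k) (g k j) \<le> blinfun_apply L (g k j) + e / 3"
        unfolding blinfun.diff_left by linarith
      show "norm L \<le> r + e" using 1 2 3 r[of "prod_encode (k, j)"] unfolding Hg by linarith
    qed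
  qed
qed

text \<open>A closed ball is cut out by countably many evaluations along the norming sequence, and
  separability writes every open set as a countable union of such balls.\<close>

lemma borel_measurable_blinfun_iff:
  fixes f :: "'m \<Rightarrow> 'a::real_normed_vector \<Rightarrow>\<^sub>L real"
  assumes sep: "separable_space (euclidean :: ('a \<Rightarrow>\<^sub>L real) topology)"
  shows "f \<in> borel_measurable M \<longleftrightarrow> (\<forall>h. (\<lambda>\<omega>. blinfun_apply (f \<omega>) h) \<in> borel_measurable M)"
proof (intro iffI allI)
  fix h assume "f \<in> borel_measurable M"
  then show "(\<lambda>\<omega>. blinfun_apply (f \<omega>) h) \<in> borel_measurable M"
    by (rule measurable_compose)
       (auto intro!: borel_measurable_continuous_onI continuous_intros)
next
  assume meas: "\<forall>h. (\<lambda>\<omega>. blinfun_apply (f \<omega>) h) \<in> borel_measurable M"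
  obtain d :: "nat \<Rightarrow> ('a \<Rightarrow>\<^sub>L real)" where d: "\<And>y e. e > 0 \<Longrightarrow> \<exists>k. dist y (d k) < e"
    using separable_dense_sequence[OF sep] by blast
  obtain H :: "nat \<Rightarrow> 'a" where H1: "\<And>k. norm (H k) \<le> 1"
    and H: "\<And>(L::'a \<Rightarrow>\<^sub>L real) r. (\<And>k. \<bar>blinfun_apply L (H k)\<bar> \<le> r) \<Longrightarrow> norm L \<le> r"
    using dual_norming_sequence[OF sep] by blast
  have meas'[measurable]: "(\<lambda>\<omega>. blinfun_apply (f \<omega>) h) \<in> borel_measurable M" for h
    using meas by blast
  have norm_iff: "norm L \<le> r \<longleftrightarrow> (\<forall>j. \<bar>blinfun_apply L (H j)\<bar> \<le> r)" for L :: "'a \<Rightarrow>\<^sub>L real" and r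
  proof
    assume L: "norm L \<le> r"
    show "\<forall>j. \<bar>blinfun_apply L (H j)\<bar> \<le> r"
    proof
      fix j
      have "\<bar>blinfun_apply L (H j)\<bar> \<le> norm L * norm (H j)"
        using norm_blinfun[of L "H j"] by simp
      also have "\<dots> \<le> norm L * 1" by (rule mult_left_mono) (use H1 in auto)
      finally show "\<bar>blinfun_apply L (H j)\<bar> \<le> r" using L by simp
    qed
  qed (use H in blast)
  have ball: "f -` cball (d k) r \<inter> space M \<in> sets M" for k r
  proof -
    have "f -` cball (d k) r \<inter> space M
        = {\<omega> \<in> space M. \<forall>j. \<bar>blinfun_apply (f \<omega>) (H j) - blinfun_apply (d k) (H j)\<bar> \<le> r}"
      using norm_iff[of "f _ - d k" r]
      by (auto simp: dist_norm norm_minus_commute[of "d k"] blinfun.diff_left)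
    also have "\<dots> \<in> sets M" by measurable
    finally show ?thesis .
  qed
  show "f \<in> borel_measurable M"
  proof (rule borel_measurableI)
    fix S :: "('a \<Rightarrow>\<^sub>L real) set" assume "open S"
    define P where "P = {(k, j). cball (d k) (1 / real (Suc j)) \<subseteq> S}"
    have "S = (\<Union>(k, j)\<in>P. cball (d k) (1 / real (Suc j)))"
    proof (intro equalityI subsetI)
      fix y assume "y \<in> S"
      then obtain e where e: "e > 0" "cball y e \<subseteq> S"
        using \<open>open S\<close> open_contains_cball by blast
      \<comment> \<open>Half of \<open>e\<close> suffices because a ball of radius
        \<open>1 / Suc j\<close> that contains \<open>y\<close> has diameter below
        \<open>e\<close>.\<close>
      obtain j where j: "1 / real (Suc j) < e / 2"
        using e nat_approx_posE[of "e/2"] by (metis divide_pos_pos zero_less_numeral)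
      obtain k where k: "dist y (d k) < 1 / real (Suc j)"
        using d[of "1 / real (Suc j)" y] by auto
      have "cball (d k) (1 / real (Suc j)) \<subseteq> cball y e"
      proof
        fix z assume "z \<in> cball (d k) (1 / real (Suc j))"
        then show "z \<in> cball y e" using dist_triangle[of y z "d k"] k j by auto
      qed
      then have "(k, j) \<in> P" using e by (auto simp: P_def)
      then show "y \<in> (\<Union>(k, j)\<in>P. cball (d k) (1 / real (Suc j)))"
        using k by (intro UN_I[of "(k, j)"]) (auto simp: dist_commute)
    qed (auto simp: P_def)
    then have "f -` S \<inter> space M = (\<Union>(k, j)\<in>P. f -` cball (d k) (1 / real (Suc j)) \<inter> space M)"
      by auto
    also have "\<dots> \<in> sets M"
      by (rule sets.countable_UN') (use ball in auto)
    finally show "f -` S \<inter> space M \<in> sets M" .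
  qed
qed

lemma borel_measurable_blinfun_apply:
  fixes f :: "'m \<Rightarrow> 'a::real_normed_vector \<Rightarrow>\<^sub>L real"
  assumes "f \<in> borel_measurable M"
  shows "(\<lambda>\<omega>. blinfun_apply (f \<omega>) h) \<in> borel_measurable M"
  using assms
  by (rule measurable_compose) (auto intro!: borel_measurable_continuous_onI continuous_intros)

lemma abs_blinfun_apply_le:
  fixes L :: "'a::real_normed_vector \<Rightarrow>\<^sub>L real"
  shows "\<bar>blinfun_apply L h\<bar> \<le> norm L * norm h"
  using norm_blinfun[of L h] by simp

lemma norm_integral_le_integral:
  fixes f g :: "'m \<Rightarrow> real"
  assumes "integrable M f" "integrable M g" "\<And>x. x \<in> space M \<Longrightarrow> norm (f x) \<le> g x"
  shows "norm (\<integral>x. f x \<partial>M) \<le> (\<integral>x. g x \<partial>M)"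
  by (rule order_trans[OF integral_norm_bound Bochner_Integration.integral_mono])
     (use assms in auto)

subsection \<open>Approximation by simple functions and expectations\<close>

text \<open>The preimages of the \<open>e\<close>-balls around a dense sequence are made disjoint
  and cut off after finitely many. On the leftover event \<open>bad\<close>, of small probability,
  the simple function is 0 and the error is at most \<open>B\<close>.\<close>

lemma (in prob_space) dual_simple_approximation:
  fixes f :: "'a \<Rightarrow> 'b::real_normed_vector \<Rightarrow>\<^sub>L real"
  assumes sep: "separable_space (euclidean :: ('b \<Rightarrow>\<^sub>L real) topology)"
    and f: "f \<in> borel_measurable M" and B: "\<And>\<omega>. norm (f \<omega>) \<le> B" and e: "e > 0"
  obtains n A y bad where "\<And>k. A k \<in> events" "bad \<in> events" "prob bad \<le> e"
    and "\<And>\<omega>. \<omega> \<in> space M \<Longrightarrow>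
      norm (f \<omega> - (\<Sum>k<n::nat. indicator (A k) \<omega> *\<^sub>R y k)) \<le> e + B * indicator bad \<omega>"
proof -
  obtain d :: "nat \<Rightarrow> ('b \<Rightarrow>\<^sub>L real)" where d: "\<And>y e. e > 0 \<Longrightarrow> \<exists>k. dist y (d k) < e"
    using separable_dense_sequence[OF sep] by blast
  define G where "G k = f -` ball (d k) e \<inter> space M" for k
  define A where "A = disjointed G"
  have G: "G k \<in> events" for k
    unfolding G_def by (rule measurable_sets[OF f]) simp
  then have A: "A k \<in> events" for k
    unfolding A_def using sets.range_disjointed_sets[of G M] by auto
  have disj: "disjoint_family A" unfolding A_def by (rule disjoint_family_disjointed)
  have AG: "A k \<subseteq> G k" for k unfolding A_def by (rule disjointed_subset)
  have UN: "(\<Union>k. A k) = space M"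
  proof -
    have "(\<Union>k. A k) = (\<Union>k. G k)" unfolding A_def by (rule UN_disjointed_eq)
    also have "\<dots> = space M"
      using d[OF e] by (fastforce simp: G_def dist_commute)
    finally show ?thesis .
  qed
  define C where "C n = space M - (\<Union>k<n. A k)" for n :: nat
  have C: "C n \<in> events" for n
    unfolding C_def using A by auto
  have "(\<lambda>n. prob (C n)) \<longlonglongrightarrow> prob (\<Inter>n. C n)"
  proof (rule finite_Lim_measure_decseq)
    show "range C \<subseteq> events" using C by auto
    show "decseq C" by (auto simp: decseq_def C_def)
  qed
  moreover have "(\<Inter>n. C n) = {}"
  proof -
    { fix \<omega> assume *: "\<omega> \<in> (\<Inter>n. C n)"
      then have "\<omega> \<in> space M" by (auto simp: C_def)
      then obtain k where "\<omega> \<in> A k" using UN by auto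
      moreover have "\<omega> \<in> C (Suc k)" using * by auto
      ultimately have False by (auto simp: C_def) }
    then show ?thesis by auto
  qed
  ultimately have "(\<lambda>n. prob (C n)) \<longlonglongrightarrow> 0" by simp
  then have "eventually (\<lambda>n. prob (C n) < e) sequentially"
    using e by (rule order_tendstoD)
  then obtain n where n: "prob (C n) < e" by (meson eventually_sequentially order_refl)
  have B0: "0 \<le> B" using B[of undefined] norm_ge_zero order_trans by blast
  show ?thesis
  proof (rule that[of A "C n" d n])
    show "A k \<in> events" for k by (rule A)
    show "C n \<in> events" by (rule C)
    show "prob (C n) \<le> e" using n by simp
    fix \<omega> assume \<omega>: "\<omega> \<in> space M"
    show "norm (f \<omega> - (\<Sum>k<n. indicator (A k) \<omega> *\<^sub>R d k)) \<le> e + B * indicator (C n) \<omega>"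
    proof (cases "\<omega> \<in> C n")
      case True
      then have "(\<Sum>k<n. indicator (A k) \<omega> *\<^sub>R d k) = 0"
        by (intro sum.neutral) (auto simp: C_def)
      then show ?thesis using True B[of \<omega>] e by simp
    next
      case False
      then obtain k where k: "k < n" "\<omega> \<in> A k" using \<omega> by (auto simp: C_def)
      have "(\<Sum>j<n. indicator (A j) \<omega> *\<^sub>R d j) = (\<Sum>j<n. if j = k then d k else 0)"
        using k disj by (intro sum.cong) (auto simp: disjoint_family_on_def indicator_def)
      also have "\<dots> = d k" using k by simp
      finally have "norm (f \<omega> - (\<Sum>j<n. indicator (A j) \<omega> *\<^sub>R d j)) = dist (f \<omega>) (d k)"
        by (simp add: dist_norm)
      also have "\<dots> \<le> e" using AG[of k] k by (auto simp: G_def dist_commute)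
      finally show ?thesis using False by simp
    qed
  qed
qed

text \<open>Only the evaluations of \<open>z\<close> are integrals here: a difference of
  expectations can be estimated by a pointwise norm without forming the Bochner integral of the
  difference.\<close>

lemma norm_expectation_le:
  assumes z: "\<And>h. blinfun_apply z h = (\<integral>\<omega>. F \<omega> h \<partial>M)"
    and F: "\<And>h. integrable M (\<lambda>\<omega>. F \<omega> h)" and g: "integrable M g"
    and le: "\<And>\<omega> h. \<omega> \<in> space M \<Longrightarrow> \<bar>F \<omega> h\<bar> \<le> g \<omega> * norm h"
    and g0: "\<And>\<omega>. \<omega> \<in> space M \<Longrightarrow> 0 \<le> g \<omega>"
  shows "norm (z :: 'b::real_normed_vector \<Rightarrow>\<^sub>L real) \<le> (\<integral>\<omega>. g \<omega> \<partial>M)"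
proof (rule norm_blinfun_bound)
  show "0 \<le> (\<integral>\<omega>. g \<omega> \<partial>M)" using g0 by (intro Bochner_Integration.integral_nonneg_AE AE_I2)
  fix h
  have "norm (\<integral>\<omega>. F \<omega> h \<partial>M) \<le> (\<integral>\<omega>. g \<omega> * norm h \<partial>M)"
    by (rule norm_integral_le_integral) (use F g le in auto)
  then show "norm (blinfun_apply z h) \<le> (\<integral>\<omega>. g \<omega> \<partial>M) * norm h" by (simp add: z)
qed

lemma (in prob_space) simple_expectation_close:
  fixes f :: "'a \<Rightarrow> 'b::real_normed_vector \<Rightarrow>\<^sub>L real"
  assumes f: "\<And>h. integrable M (\<lambda>\<omega>. blinfun_apply (f \<omega>) h)"
    and S: "\<And>h. blinfun_apply S h = (\<integral>\<omega>. blinfun_apply (f \<omega>) h \<partial>M)"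
    and A: "\<And>k. A k \<in> events" and bad: "bad \<in> events" "prob bad \<le> e" and B0: "0 \<le> B" and e: "0 \<le> e"
    and s: "\<And>\<omega>. \<omega> \<in> space M \<Longrightarrow>
      norm (f \<omega> - (\<Sum>k<n::nat. indicator (A k) \<omega> *\<^sub>R y k)) \<le> e + B * indicator bad \<omega>"
  shows "norm ((\<Sum>k<n. prob (A k) *\<^sub>R y k) - S) \<le> e + B * e"
proof -
  define z where "z = (\<Sum>k<n. prob (A k) *\<^sub>R y k)"
  define s where "s x = (\<Sum>k<n. indicator (A k) x *\<^sub>R y k)" for x
  have int_ind: "integrable M (indicat_real A)" if "A \<in> events" for A
    using that by (intro integrable_real_indicator) (simp_all add: emeasure_eq_measure)
  have int_s: "integrable M (\<lambda>x. blinfun_apply (s x) h)" for h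
    unfolding s_def blinfun.sum_left blinfun.scaleR_left
    by (intro Bochner_Integration.integrable_sum integrable_scaleR_left int_ind A)
  have zs: "blinfun_apply z h = (\<integral>x. blinfun_apply (s x) h \<partial>M)" for h
    unfolding s_def z_def blinfun.sum_left blinfun.scaleR_left
    using A by (subst Bochner_Integration.integral_sum)
      (auto intro!: integrable_mult_left int_ind)
  have "norm (z - S) \<le> (\<integral>x. e + B * indicator bad x \<partial>M)"
  proof (rule norm_expectation_le)
    show "blinfun_apply (z - S) h = (\<integral>x. blinfun_apply (s x) h - blinfun_apply (f x) h \<partial>M)" for h
      using int_s f by (simp add: S zs blinfun.diff_left)
    show "integrable M (\<lambda>x. blinfun_apply (s x) h - blinfun_apply (f x) h)" for h
      using int_s f by simp
    show "integrable M (\<lambda>x. e + B * indicator bad x)"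
      using int_ind[OF bad(1)] by simp
    show "0 \<le> e + B * indicator bad x" for x using e B0 by simp
    fix x and h :: 'b assume "x \<in> space M"
    then have "norm (f x - s x) * norm h \<le> (e + B * indicator bad x) * norm h"
      unfolding s_def by (intro mult_right_mono s) simp_all
    then show "\<bar>blinfun_apply (s x) h - blinfun_apply (f x) h\<bar> \<le> (e + B * indicator bad x) * norm h"
      using abs_blinfun_apply_le[of "s x - f x" h]
      by (simp add: blinfun.diff_left norm_minus_commute)
  qed
  also have "\<dots> = e + B * prob bad"
    using int_ind[OF bad(1)] bad(1) prob_space by (subst Bochner_Integration.integral_add) auto
  also have "\<dots> \<le> e + B * e"
    using bad(2) B0 by (intro add_left_mono mult_left_mono) auto
  finally show ?thesis unfolding z_def .
qed

text \<open>Evaluation at \<open>h\<close> is linear and bounded by \<open>norm h\<close>, so the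
  simple functions behind the Bochner expectation, evaluated at \<open>h\<close>, witness the real
  integral.\<close>

lemma has_bochner_expectation_apply:
  fixes f :: "'m \<Rightarrow> 'a::real_normed_vector \<Rightarrow>\<^sub>L real"
  assumes "has_bochner_expectation M f z"
  shows "has_bochner_integral M (\<lambda>\<omega>. blinfun_apply (f \<omega>) h) (blinfun_apply z h)"
proof -
  from assms obtain s where f: "f \<in> borel_measurable M"
    and s: "\<And>i::nat. Bochner_Integration.simple_bochner_integrable M (s i)"
    and lim: "(\<lambda>i. \<integral>\<^sup>+\<omega>. ennreal (norm (f \<omega> - s i \<omega>)) \<partial>M) \<longlonglongrightarrow> 0"
    and z: "(\<lambda>i. Bochner_Integration.simple_bochner_integral M (s i)) \<longlonglongrightarrow> z"
    unfolding has_bochner_expectation_def by auto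
  have sf: "simple_function M (s i)" for i
    using s[of i] by (auto elim: Bochner_Integration.simple_bochner_integrable.cases)
  have meas: "(\<lambda>\<omega>. ennreal (norm (f \<omega> - s i \<omega>))) \<in> borel_measurable M" for i
  proof -
    have "(\<lambda>\<omega>. norm (f \<omega> - s i \<omega>)) \<in> borel_measurable M"
    \<comment> \<open>\<open>s i\<close> has finitely many values. On each level set the subtracted
      vector is constant, and continuity of the norm settles measurability of the distance
      there.\<close>
    proof (rule measurable_piecewise_restrict[of "(\<lambda>y. s i -` {y} \<inter> space M) ` (s i ` space M)"])
      show "countable ((\<lambda>y. s i -` {y} \<inter> space M) ` (s i ` space M))"
        using sf[of i] by (auto simp: simple_function_def intro: countable_finite)
    next
      fix \<Omega> assume "\<Omega> \<in> (\<lambda>y. s i -` {y} \<inter> space M) ` (s i ` space M)"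
      then obtain x where x: "x \<in> space M" "\<Omega> = s i -` {s i x} \<inter> space M" by auto
      then show "\<Omega> \<inter> space M \<in> sets M"
        using sf[of i] by (auto simp: simple_function_def)
      have "(\<lambda>\<omega>. norm (f \<omega> - s i x)) \<in> borel_measurable M"
        using f by (rule measurable_compose)
          (auto intro!: borel_measurable_continuous_onI continuous_intros)
      then have "(\<lambda>\<omega>. norm (f \<omega> - s i x)) \<in> borel_measurable (restrict_space M \<Omega>)"
        by (rule measurable_restrict_space1)
      then show "(\<lambda>\<omega>. norm (f \<omega> - s i \<omega>)) \<in> borel_measurable (restrict_space M \<Omega>)"
        by (subst measurable_cong[where g="\<lambda>\<omega>. norm (f \<omega> - s i x)"]) (auto simp: x space_restrict_space)
    qed auto
    then show ?thesis by measurable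
  qed
  show ?thesis
  proof (rule has_bochner_integral.intros)
    show "(\<lambda>\<omega>. blinfun_apply (f \<omega>) h) \<in> borel_measurable M"
      using f by (rule borel_measurable_blinfun_apply)
    show "Bochner_Integration.simple_bochner_integrable M (\<lambda>\<omega>. blinfun_apply (s i \<omega>) h)" for i
      using Bochner_Integration.simple_bochner_integrable_compose2
        [OF _ s s, where p="\<lambda>x y. blinfun_apply x h"]
      by (simp add: blinfun.zero_left)
    show "(\<lambda>i. \<integral>\<^sup>+\<omega>. ennreal (norm (blinfun_apply (f \<omega>) h - blinfun_apply (s i \<omega>) h)) \<partial>M) \<longlonglongrightarrow> 0"
    proof (rule tendsto_sandwich[of "\<lambda>_. 0" _ sequentially
          "\<lambda>i. ennreal (norm h) * (\<integral>\<^sup>+\<omega>. ennreal (norm (f \<omega> - s i \<omega>)) \<partial>M)"])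
      show "\<forall>\<^sub>F i in sequentially. (\<integral>\<^sup>+\<omega>. ennreal (norm (blinfun_apply (f \<omega>) h - blinfun_apply (s i \<omega>) h)) \<partial>M)
          \<le> ennreal (norm h) * (\<integral>\<^sup>+\<omega>. ennreal (norm (f \<omega> - s i \<omega>)) \<partial>M)"
        apply (rule always_eventually, rule allI, subst nn_integral_cmult[symmetric], rule meas)
        apply (rule nn_integral_mono)
        using abs_blinfun_apply_le[of "f _ - s _ _" h]
        by (simp add: blinfun.diff_left ennreal_mult[symmetric] mult.commute)
      show "(\<lambda>i. ennreal (norm h) * (\<integral>\<^sup>+\<omega>. ennreal (norm (f \<omega> - s i \<omega>)) \<partial>M)) \<longlonglongrightarrow> 0"
        using ennreal_tendsto_cmult[OF _ lim, of "ennreal (norm h)"] by simp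
    qed auto
    have "Bochner_Integration.simple_bochner_integral M (\<lambda>\<omega>. blinfun_apply (s i \<omega>) h)
        = blinfun_apply (Bochner_Integration.simple_bochner_integral M (s i)) h" for i
      by (rule Bochner_Integration.simple_bochner_integral_linear[OF _ s])
        (rule bounded_linear.linear[OF blinfun.bounded_linear_left])
    then show "(\<lambda>i. Bochner_Integration.simple_bochner_integral M (\<lambda>\<omega>. blinfun_apply (s i \<omega>) h))
        \<longlonglongrightarrow> blinfun_apply z h"
      using z by (auto intro!: tendsto_intros)
  qed
qed

section \<open>Bochner expectations of bounded dual-valued maps\<close>

context prob_space
begin

context
  fixes f :: "'a \<Rightarrow> 'b::real_normed_vector \<Rightarrow>\<^sub>L real" and B :: real
  assumes sep: "separable_space (euclidean :: ('b \<Rightarrow>\<^sub>L real) topology)"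
    and f: "f \<in> borel_measurable M" and B: "\<And>\<omega>. norm (f \<omega>) \<le> B"
begin

lemma integrable_blinfun_apply: "integrable M (\<lambda>\<omega>. blinfun_apply (f \<omega>) h)"
proof (rule integrable_const_bound[of _ "B * norm h"])
  show "AE \<omega> in M. norm (blinfun_apply (f \<omega>) h) \<le> B * norm h"
  proof (rule AE_I2)
    fix \<omega>
    have "norm (f \<omega>) * norm h \<le> B * norm h" by (rule mult_right_mono) (use B in auto)
    then show "norm (blinfun_apply (f \<omega>) h) \<le> B * norm h"
      using abs_blinfun_apply_le[of "f \<omega>" h] by simp
  qed
qed (use f borel_measurable_blinfun_apply in blast)

text \<open>For bounded maps the weak description recovers the strong one: simple approximants
  converge in mean, and the distance of their integrals from \<open>z\<close> is estimated in norm
  through evaluations.\<close>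

lemma has_bochner_expectation_iff:
  "has_bochner_expectation M f z \<longleftrightarrow> (\<forall>h. blinfun_apply z h = (\<integral>\<omega>. blinfun_apply (f \<omega>) h \<partial>M))"
proof
  assume "has_bochner_expectation M f z"
  then show "\<forall>h. blinfun_apply z h = (\<integral>\<omega>. blinfun_apply (f \<omega>) h \<partial>M)"
    using has_bochner_expectation_apply has_bochner_integral_iff by metis
next
  assume z: "\<forall>h. blinfun_apply z h = (\<integral>\<omega>. blinfun_apply (f \<omega>) h \<partial>M)"
  have B0: "0 \<le> B" using B[of undefined] norm_ge_zero order_trans by blast
  define e where "e i = 1 / real (Suc i)" for i
  have e: "e i > 0" for i by (simp add: e_def)
  have elim: "e \<longlonglongrightarrow> 0" unfolding e_def by (rule LIMSEQ_Suc[OF lim_1_over_n])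
  have "\<exists>s bad. bad \<in> events \<and> prob bad \<le> e i \<and> Bochner_Integration.simple_bochner_integrable M s \<and>
      (\<forall>\<omega>\<in>space M. norm (f \<omega> - s \<omega>) \<le> e i + B * indicator bad \<omega>)" for i
  proof -
    obtain n A y bad where A: "\<And>k. A k \<in> events" and bad: "bad \<in> events" "prob bad \<le> e i"
      and s: "\<And>\<omega>. \<omega> \<in> space M \<Longrightarrow>
        norm (f \<omega> - (\<Sum>k<n::nat. indicator (A k) \<omega> *\<^sub>R y k)) \<le> e i + B * indicator bad \<omega>"
      by (rule dual_simple_approximation[OF sep f B e[of i]]) (rule that; assumption)
    have "simple_function M (\<lambda>\<omega>. \<Sum>k<n. indicator (A k) \<omega> *\<^sub>R y k)"
      by (intro simple_function_sum simple_function_compose1[where g="\<lambda>x::real. x *\<^sub>R _"]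
          simple_function_indicator A)
    then have "Bochner_Integration.simple_bochner_integrable M (\<lambda>\<omega>. \<Sum>k<n. indicator (A k) \<omega> *\<^sub>R y k)"
      by (intro Bochner_Integration.simple_bochner_integrable.intros)
         (auto simp: emeasure_eq_measure)
    then show ?thesis using bad s by blast
  qed
  then obtain s bad where bad: "\<And>i. bad i \<in> events" "\<And>i. prob (bad i) \<le> e i"
    and s: "\<And>i. Bochner_Integration.simple_bochner_integrable M (s i)"
    and sf: "\<And>i \<omega>. \<omega> \<in> space M \<Longrightarrow> norm (f \<omega> - s i \<omega>) \<le> e i + B * indicator (bad i) \<omega>"
    by metis
  have int_bad: "integrable M (\<lambda>\<omega>. e i + B * indicator (bad i) \<omega>)" for i
    by (intro Bochner_Integration.integrable_add Bochner_Integration.integrable_mult_right integrable_real_indicator bad)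
      (auto simp: emeasure_eq_measure)
  have int_bad_le: "(\<integral>\<omega>. e i + B * indicator (bad i) \<omega> \<partial>M) \<le> (1 + B) * e i" for i
  proof -
    have "(\<integral>\<omega>. e i + B * indicator (bad i) \<omega> \<partial>M) = e i + B * prob (bad i)"
    proof (subst Bochner_Integration.integral_add)
      show "integrable M (\<lambda>\<omega>. B * indicat_real (bad i) \<omega>)"
        by (intro Bochner_Integration.integrable_mult_right integrable_real_indicator bad)
          (auto simp: emeasure_eq_measure)
      show "(\<integral>\<omega>. e i \<partial>M) + (\<integral>\<omega>. B * indicat_real (bad i) \<omega> \<partial>M) = e i + B * prob (bad i)"
        using bad(1)[of i] by (simp add: prob_space)
    qed simp
    moreover have "B * prob (bad i) \<le> B * e i" by (rule mult_left_mono[OF bad(2) B0])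
    ultimately show ?thesis by (simp add: algebra_simps)
  qed
  have elim': "(\<lambda>i. (1 + B) * e i) \<longlonglongrightarrow> 0" using tendsto_mult_left[OF elim, of "1 + B"] by simp
  show "has_bochner_expectation M f z"
    unfolding has_bochner_expectation_def
  proof (intro conjI exI[of _ s] allI f s)
    have "(\<integral>\<^sup>+\<omega>. ennreal (norm (f \<omega> - s i \<omega>)) \<partial>M) \<le> ennreal ((1 + B) * e i)" for i
    proof -
      have "(\<integral>\<^sup>+\<omega>. ennreal (norm (f \<omega> - s i \<omega>)) \<partial>M) \<le> (\<integral>\<^sup>+\<omega>. ennreal (e i + B * indicator (bad i) \<omega>) \<partial>M)"
        by (rule nn_integral_mono) (auto intro!: ennreal_leI sf)
      also have "\<dots> = ennreal (\<integral>\<omega>. e i + B * indicator (bad i) \<omega> \<partial>M)"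
        by (rule nn_integral_eq_integral[OF int_bad]) (use B0 e[of i] in simp)
      also have "\<dots> \<le> ennreal ((1 + B) * e i)" by (rule ennreal_leI[OF int_bad_le])
      finally show ?thesis .
    qed
    then have le: "\<forall>\<^sub>F i in sequentially. (\<integral>\<^sup>+\<omega>. ennreal (norm (f \<omega> - s i \<omega>)) \<partial>M) \<le> ennreal ((1 + B) * e i)"
      by (simp add: always_eventually)
    have lim0: "(\<lambda>i. ennreal ((1 + B) * e i)) \<longlonglongrightarrow> 0"
      using tendsto_ennrealI[OF elim'] by simp
    show "(\<lambda>i. \<integral>\<^sup>+\<omega>. ennreal (norm (f \<omega> - s i \<omega>)) \<partial>M) \<longlonglongrightarrow> 0"
      by (rule tendsto_sandwich[OF _ le tendsto_const lim0]) simp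
    have "norm (Bochner_Integration.simple_bochner_integral M (s i) - z) \<le> (1 + B) * e i" (is "norm (?I - z) \<le> _") for i
    proof (rule order_trans[OF norm_expectation_le int_bad_le])
      have sh: "has_bochner_integral M (\<lambda>\<omega>. blinfun_apply (s i \<omega>) h)
         (Bochner_Integration.simple_bochner_integral M (\<lambda>\<omega>. blinfun_apply (s i \<omega>) h))" for h
        using Bochner_Integration.simple_bochner_integrable_compose2
          [OF _ s s, where p="\<lambda>x y. blinfun_apply x h"]
        by (intro has_bochner_integral_simple_bochner_integrable) (simp add: blinfun.zero_left)
      have "blinfun_apply ?I h = Bochner_Integration.simple_bochner_integral M (\<lambda>\<omega>. blinfun_apply (s i \<omega>) h)" for h
        by (rule Bochner_Integration.simple_bochner_integral_linear[OF _ s, symmetric])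
          (rule bounded_linear.linear[OF blinfun.bounded_linear_left])
      then have "blinfun_apply ?I h = (\<integral>\<omega>. blinfun_apply (s i \<omega>) h \<partial>M)" for h
        using sh by (simp add: has_bochner_integral_iff)
      then show "blinfun_apply (?I - z) h = (\<integral>\<omega>. blinfun_apply (s i \<omega>) h - blinfun_apply (f \<omega>) h \<partial>M)" for h
        using z sh integrable_blinfun_apply
        by (simp add: blinfun.diff_left has_bochner_integral_iff)
      show "integrable M (\<lambda>\<omega>. blinfun_apply (s i \<omega>) h - blinfun_apply (f \<omega>) h)" for h
        using sh integrable_blinfun_apply by (auto simp: has_bochner_integral_iff)
      show "0 \<le> e i + B * indicator (bad i) \<omega>" for \<omega> using B0 e[of i] by simp
      fix \<omega> and h :: 'b assume "\<omega> \<in> space M"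
      then have "norm (f \<omega> - s i \<omega>) * norm h \<le> (e i + B * indicator (bad i) \<omega>) * norm h"
        by (intro mult_right_mono sf) auto
      then show "\<bar>blinfun_apply (s i \<omega>) h - blinfun_apply (f \<omega>) h\<bar> \<le> (e i + B * indicator (bad i) \<omega>) * norm h"
        using abs_blinfun_apply_le[of "s i \<omega> - f \<omega>" h]
        by (simp add: blinfun.diff_left norm_minus_commute)
    qed (rule int_bad)
    then have "\<forall>\<^sub>F i in sequentially. norm (Bochner_Integration.simple_bochner_integral M (s i) - z) \<le> (1 + B) * e i"
      by (simp add: always_eventually)
    from Lim_null_comparison[OF this elim']
    show "(\<lambda>i. Bochner_Integration.simple_bochner_integral M (s i)) \<longlonglongrightarrow> z"
      by (rule LIM_zero_cancel)
  qed
qed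

text \<open>Integrating the evaluations gives a functional bounded by \<open>B\<close>; it is the
  only Bochner expectation, so the definite description selects it.\<close>

lemma bochner_expectation_apply:
  "blinfun_apply (bochner_expectation M f) h = (\<integral>\<omega>. blinfun_apply (f \<omega>) h \<partial>M)"
proof -
  define z where "z = Blinfun (\<lambda>h. \<integral>\<omega>. blinfun_apply (f \<omega>) h \<partial>M)"
  have "bounded_linear (\<lambda>h. \<integral>\<omega>. blinfun_apply (f \<omega>) h \<partial>M)"
  proof (rule bounded_linear_intro[of _ B])
    fix h k :: 'b and r :: real
    show "(\<integral>\<omega>. blinfun_apply (f \<omega>) (h + k) \<partial>M) =
        (\<integral>\<omega>. blinfun_apply (f \<omega>) h \<partial>M) + (\<integral>\<omega>. blinfun_apply (f \<omega>) k \<partial>M)"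
      using integrable_blinfun_apply by (simp add: blinfun.add_right)
    show "(\<integral>\<omega>. blinfun_apply (f \<omega>) (r *\<^sub>R h) \<partial>M) = r *\<^sub>R (\<integral>\<omega>. blinfun_apply (f \<omega>) h \<partial>M)"
      by (simp add: blinfun.scaleR_right)
    have "norm (\<integral>\<omega>. blinfun_apply (f \<omega>) h \<partial>M) \<le> (\<integral>\<omega>. B * norm h \<partial>M)"
    proof (rule norm_integral_le_integral)
      show "integrable M (\<lambda>\<omega>. blinfun_apply (f \<omega>) h)" by (rule integrable_blinfun_apply)
      fix \<omega>
      have "norm (f \<omega>) * norm h \<le> B * norm h" by (rule mult_right_mono) (use B in auto)
      then show "norm (blinfun_apply (f \<omega>) h) \<le> B * norm h"
        using abs_blinfun_apply_le[of "f \<omega>" h] by simp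
    qed simp
    then show "norm (\<integral>\<omega>. blinfun_apply (f \<omega>) h \<partial>M) \<le> norm h * B"
      by (simp add: prob_space mult.commute)
  qed
  then have z: "blinfun_apply z h = (\<integral>\<omega>. blinfun_apply (f \<omega>) h \<partial>M)" for h
    unfolding z_def by (simp add: bounded_linear_Blinfun_apply)
  have "has_bochner_expectation M f z" using z has_bochner_expectation_iff by blast
  moreover have "z' = z" if "has_bochner_expectation M f z'" for z'
    using that z unfolding has_bochner_expectation_iff by (auto intro!: blinfun_eqI)
  ultimately have "(THE z. has_bochner_expectation M f z) = z" "\<exists>z. has_bochner_expectation M f z"
    by (blast intro: the_equality)+
  then have "bochner_expectation M f = z"
    by (simp add: bochner_expectation_def)
  then show ?thesis using z by simp
qed

end

end

section \<open>The derivative of the norm\<close>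

lemma norm_gateaux_deriv_unique:
  assumes "norm_gateaux_deriv x L" "norm_gateaux_deriv x L'"
  shows "L = L'"
proof (rule blinfun_eqI)
  fix h
  have "((\<lambda>t. (norm (x + t *\<^sub>R h) - norm x) / t) \<longlongrightarrow> blinfun_apply L h) (at (0::real))"
    and "((\<lambda>t. (norm (x + t *\<^sub>R h) - norm x) / t) \<longlongrightarrow> blinfun_apply L' h) (at (0::real))"
    using assms unfolding norm_gateaux_deriv_def by blast+
  then show "blinfun_apply L h = blinfun_apply L' h"
    by (rule tendsto_unique[OF at_neq_bot])
qed

lemma norm_gateaux_deriv_SGN:
  assumes "smooth_space TYPE('b::real_normed_vector)" and "(x::'b) \<noteq> 0"
  shows "norm_gateaux_deriv x (SGN x)"
proof -
  obtain L where L: "norm_gateaux_deriv x L" using assms by (auto simp: smooth_space_def)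
  then have "(THE L. norm_gateaux_deriv x L) = L"
    using norm_gateaux_deriv_unique by blast
  then show ?thesis using L assms by (simp add: SGN_def)
qed

lemma SGN_0 [simp]: "SGN 0 = 0" by (simp add: SGN_def)

text \<open>The norm is 1-Lipschitz, so every difference quotient along \<open>h\<close> is at most
  \<open>norm h\<close> in absolute value, and so is the limit.\<close>

lemma norm_SGN_le:
  assumes "smooth_space TYPE('b::real_normed_vector)"
  shows "norm (SGN (x::'b)) \<le> 1"
proof (cases "x = 0")
  case False
  show ?thesis
  proof (rule norm_blinfun_bound)
    fix h
    have "((\<lambda>t. (norm (x + t *\<^sub>R h) - norm x) / t) \<longlongrightarrow> blinfun_apply (SGN x) h) (at (0::real))"
      using norm_gateaux_deriv_SGN[OF assms False] by (simp add: norm_gateaux_deriv_def)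
    then have "((\<lambda>t. \<bar>(norm (x + t *\<^sub>R h) - norm x) / t\<bar>) \<longlongrightarrow> \<bar>blinfun_apply (SGN x) h\<bar>) (at (0::real))"
      by (rule tendsto_rabs)
    then have "\<bar>blinfun_apply (SGN x) h\<bar> \<le> norm h"
    proof (rule tendsto_upperbound)
      have "\<bar>(norm (x + t *\<^sub>R h) - norm x) / t\<bar> \<le> norm h" if "t \<noteq> 0" for t
      proof -
        have "\<bar>norm (x + t *\<^sub>R h) - norm x\<bar> \<le> norm (t *\<^sub>R h)"
          using norm_triangle_ineq3[of "x + t *\<^sub>R h" x] by simp
        then show ?thesis using that by (simp add: field_simps)
      qed
      then show "\<forall>\<^sub>F t in at 0. \<bar>(norm (x + t *\<^sub>R h) - norm x) / t\<bar> \<le> norm h"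
        by (auto simp: eventually_at_filter)
    qed simp
    then show "norm (blinfun_apply (SGN x) h) \<le> 1 * norm h" by simp
  qed simp
qed simp

text \<open>Along \<open>x\<close> itself the difference quotient equals \<open>norm x\<close> as
  soon as \<open>\<bar>t\<bar> < 1\<close>, by positive homogeneity of the norm.\<close>

lemma SGN_self:
  assumes "smooth_space TYPE('b::real_normed_vector)"
  shows "blinfun_apply (SGN x) (x::'b) = norm x"
proof (cases "x = 0")
  case False
  have "((\<lambda>t. (norm (x + t *\<^sub>R x) - norm x) / t) \<longlongrightarrow> blinfun_apply (SGN x) x) (at (0::real))"
    using norm_gateaux_deriv_SGN[OF assms False] by (simp add: norm_gateaux_deriv_def)
  moreover have "((\<lambda>t. (norm (x + t *\<^sub>R x) - norm x) / t) \<longlongrightarrow> norm x) (at (0::real))"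
  proof (rule tendsto_eventually)
    have "\<forall>\<^sub>F t in at (0::real). dist t 0 < 1 \<and> t \<noteq> 0"
      by (intro eventually_conj) (auto simp: eventually_at intro: exI[of _ 1])
    then show "\<forall>\<^sub>F t in at (0::real). (norm (x + t *\<^sub>R x) - norm x) / t = norm x"
    proof eventually_elim
      case (elim t)
      have "x + t *\<^sub>R x = (1 + t) *\<^sub>R x" by (simp add: algebra_simps)
      then have "norm (x + t *\<^sub>R x) = (1 + t) * norm x"
        using elim by (simp only: norm_scaleR) (auto simp: dist_real_def)
      then show ?case using elim by (simp add: field_simps)
    qed
  qed
  ultimately show ?thesis by (rule tendsto_unique[OF at_neq_bot])
qed simp

text \<open>Each evaluation is a pointwise limit of difference quotients with increment
  \<open>1 / Suc i\<close>, which are continuous in \<open>x\<close>. The origin, where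
  \<open>SGN\<close> is 0 by convention, is treated apart.\<close>

lemma SGN_borel_measurable:
  assumes smooth: "smooth_space TYPE('b::real_normed_vector)"
    and sep: "separable_space (euclidean :: ('b \<Rightarrow>\<^sub>L real) topology)"
  shows "(SGN :: 'b \<Rightarrow> _) \<in> borel_measurable borel"
  unfolding borel_measurable_blinfun_iff[OF sep]
proof
  fix h :: 'b
  show "(\<lambda>x. blinfun_apply (SGN x) h) \<in> borel_measurable borel"
  proof (rule borel_measurable_LIMSEQ_real)
    fix i :: nat
    have "(\<lambda>x::'b. (norm (x + (1 / real (Suc i)) *\<^sub>R h) - norm x) / (1 / real (Suc i))) \<in> borel_measurable borel"
      by (intro borel_measurable_continuous_onI continuous_intros) auto
    then show "(\<lambda>x::'b. if x = 0 then 0 else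
        (norm (x + (1 / real (Suc i)) *\<^sub>R h) - norm x) / (1 / real (Suc i))) \<in> borel_measurable borel"
      by (intro measurable_If) auto
  next
    fix x :: 'b
    show "(\<lambda>i. if x = 0 then 0 else (norm (x + (1 / real (Suc i)) *\<^sub>R h) - norm x) / (1 / real (Suc i)))
        \<longlonglongrightarrow> blinfun_apply (SGN x) h"
    proof (cases "x = 0")
      case False
      have "((\<lambda>t. (norm (x + t *\<^sub>R h) - norm x) / t) \<longlongrightarrow> blinfun_apply (SGN x) h) (at (0::real))"
        using norm_gateaux_deriv_SGN[OF smooth False] by (simp add: norm_gateaux_deriv_def)
      moreover have "filterlim (\<lambda>i. 1 / real (Suc i)) (at 0) sequentially"
        by (rule filterlim_atI[OF LIMSEQ_Suc[OF lim_1_over_n]]) auto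
      ultimately have "(\<lambda>i. (norm (x + (1 / real (Suc i)) *\<^sub>R h) - norm x) / (1 / real (Suc i)))
          \<longlonglongrightarrow> blinfun_apply (SGN x) h"
        by (rule filterlim_compose)
      then show ?thesis using False by (simp only: if_False)
    qed simp
  qed
qed

lemma SGN_diff_borel_measurable:
  assumes "smooth_space TYPE('b::real_normed_vector)"
    and "separable_space (euclidean :: ('b \<Rightarrow>\<^sub>L real) topology)"
  shows "(\<lambda>y. SGN (x - y :: 'b)) \<in> borel_measurable borel"
  by (rule measurable_compose[OF _ SGN_borel_measurable[OF assms]])
     (auto intro!: borel_measurable_continuous_onI continuous_intros)

section \<open>Laws of large numbers\<close>

locale iid_sample = prob_space M for M :: "'w measure" +
  fixes X :: "nat \<Rightarrow> 'w \<Rightarrow> 'a::topological_space" and \<mu> :: "'a measure"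
  assumes indep: "indep_vars (\<lambda>_. borel) X UNIV"
    and distr_X: "\<And>i. distr M borel (X i) = \<mu>"
begin

lemma X_measurable [measurable]: "X i \<in> measurable M borel"
  using indep by (simp add: indep_vars_def)

lemma sets_law [simp, measurable_cong]: "sets \<mu> = sets borel"
  using distr_X[of 0] by auto

lemma space_law [simp]: "space \<mu> = UNIV"
  using distr_X[of 0] by auto

sublocale law: prob_space \<mu>
  using prob_space_distr[OF X_measurable[of 0]] by (simp add: distr_X)

lemma integral_X:
  fixes g :: "'a \<Rightarrow> real"
  assumes "g \<in> borel_measurable borel"
  shows "(\<integral>\<omega>. g (X i \<omega>) \<partial>M) = (\<integral>y. g y \<partial>\<mu>)"
  using integral_distr[OF X_measurable[of i] assms] by (simp add: distr_X)

lemma indep_vars_comp: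
  assumes "g \<in> measurable borel N"
  shows "indep_vars (\<lambda>_. N) (\<lambda>i \<omega>. g (X i \<omega>)) I"
proof -
  have "indep_vars (\<lambda>_. borel) X I" by (rule indep_vars_subset[OF indep]) simp
  then show ?thesis
    by (rule indep_vars_compose2) (use assms in simp)
qed

text \<open>The exponent reflects values in an interval of length \<open>2 * C\<close>. The estimate
  serves twice: at deviations linear in \<open>n\<close> its decay feeds the Borel-Cantelli lemma,
  and at deviations of order \<open>sqrt n\<close> it is free of \<open>n\<close> and yields
  tightness.\<close>

lemma sample_Hoeffding:
  fixes g :: "'a \<Rightarrow> real"
  assumes g[measurable]: "g \<in> borel_measurable borel" and C: "0 < C" "\<And>y. \<bar>g y\<bar> \<le> C"
    and n: "n > 0" and \<epsilon>: "0 \<le> \<epsilon>"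
  shows "prob {\<omega> \<in> space M. \<epsilon> \<le> \<bar>(\<Sum>i<n. g (X i \<omega>)) - n * (\<integral>y. g y \<partial>\<mu>)\<bar>}
    \<le> 2 * exp (- (\<epsilon>\<^sup>2 / (2 * n * C\<^sup>2)))"
proof -
  interpret Hoeffding_ineq_iid M "{..<n}" "\<lambda>i \<omega>. g (X i \<omega>)" "\<lambda>\<omega>. g (X 0 \<omega>)" "- C" C "\<integral>y. g y \<partial>\<mu>"
  proof unfold_locales
    show "indep_vars (\<lambda>_. borel) (\<lambda>i \<omega>. g (X i \<omega>)) {..<n}"
      by (rule indep_vars_comp[OF g])
    have "distr M borel (\<lambda>\<omega>. g (X i \<omega>)) = distr \<mu> borel g" for i
      unfolding distr_X[of i, symmetric] by (subst distr_distr) (auto simp: comp_def)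
    then show "distr M borel (\<lambda>\<omega>. g (X i \<omega>)) = distr M borel (\<lambda>\<omega>. g (X 0 \<omega>))" for i
      by simp
    show "AE x in M. g (X 0 x) \<in> {- C..C}"
      using C(2) by (intro AE_I2) (simp add: abs_le_iff minus_le_iff)
    show "(\<integral>y. g y \<partial>\<mu>) \<equiv> expectation (\<lambda>\<omega>. g (X 0 \<omega>))"
      unfolding integral_X[OF g] by simp
  qed auto
  have "prob {\<omega> \<in> space M. \<epsilon> \<le> \<bar>(\<Sum>i<n. g (X i \<omega>)) - n * (\<integral>y. g y \<partial>\<mu>)\<bar>}
    \<le> 2 * exp (- 2 * \<epsilon>\<^sup>2 / (real n * (C - (- C))\<^sup>2))"
    using Hoeffding_ineq_abs_ge[OF \<epsilon>] C(1) n by (simp add: lessThan_empty_iff)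
  also have "- 2 * \<epsilon>\<^sup>2 / (real n * (C - (- C))\<^sup>2) = - (\<epsilon>\<^sup>2 / (2 * real n * C\<^sup>2))"
    using C(1) n by (simp add: field_simps power2_eq_square)
  finally show ?thesis .
qed

text \<open>Deviations from the mean have geometrically small probabilities, so for each level
  almost surely only finitely many occur; countably many levels then give convergence.\<close>

lemma bounded_strong_law:
  fixes g :: "'a \<Rightarrow> real"
  assumes g[measurable]: "g \<in> borel_measurable borel" and B: "\<And>y. \<bar>g y\<bar> \<le> B"
  shows "AE \<omega> in M. (\<lambda>n. (\<Sum>i<n. g (X i \<omega>)) / n) \<longlonglongrightarrow> (\<integral>y. g y \<partial>\<mu>)"
proof -
  define C where "C = B + 1"
  have "0 \<le> B" using B[of undefined] abs_ge_zero order_trans by blast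
  then have C: "0 < C" by (simp add: C_def)
  have gC: "\<bar>g y\<bar> \<le> C" for y using B[of y] by (simp add: C_def)
  define m where "m = (\<integral>y. g y \<partial>\<mu>)"
  have ev: "AE \<omega> in M. \<forall>\<^sub>F n in sequentially.
      \<bar>(\<Sum>i<Suc n. g (X i \<omega>)) / real (Suc n) - m\<bar> < \<epsilon>" if \<epsilon>: "\<epsilon> > 0" for \<epsilon> :: real
  proof -
    \<comment> \<open>The deviation is linear in the sample size, which makes the exponent linear
      too and the bound geometric with ratio \<open>q\<close>. Sizes \<open>Suc n\<close> avoid the
      empty sample.\<close>
    define A where "A n = {\<omega> \<in> space M. \<epsilon> * real (Suc n) \<le> \<bar>(\<Sum>i<Suc n. g (X i \<omega>)) - real (Suc n) * m\<bar>}" for n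
    have A: "A n \<in> events" for n unfolding A_def by measurable
    define q where "q = exp (- (\<epsilon>\<^sup>2 / (2 * C\<^sup>2)))"
    have bound: "prob (A n) \<le> 2 * q ^ Suc n" for n
    proof -
      have "prob (A n) \<le> 2 * exp (- ((\<epsilon> * real (Suc n))\<^sup>2 / (2 * real (Suc n) * C\<^sup>2)))"
        unfolding A_def m_def by (rule sample_Hoeffding[OF g C gC]) (use \<epsilon> in auto)
      also have "exp (- ((\<epsilon> * real (Suc n))\<^sup>2 / (2 * real (Suc n) * C\<^sup>2))) = q ^ Suc n"
        unfolding q_def exp_of_nat_mult[symmetric]
        by (rule arg_cong[where f=exp])
          (use C in \<open>simp del: of_nat_Suc add: field_simps power2_eq_square\<close>)
      finally show ?thesis .
    qed
    have q: "0 \<le> q" "q < 1" using \<epsilon> C by (auto simp: q_def)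
    have "AE \<omega> in M. \<forall>\<^sub>F n in sequentially. \<omega> \<in> space M - A n"
    proof (rule borel_cantelli_AE1[OF A])
      show "emeasure M (A n) < \<infinity>" for n by (simp add: emeasure_eq_measure)
      have "summable (\<lambda>n. 2 * q ^ Suc n)"
        using q by (intro summable_mult) (simp add: summable_geometric)
      then show "summable (\<lambda>n. prob (A n))"
        by (rule summable_comparison_test'[of _ 0]) (use bound in auto)
    qed
    then show ?thesis
    proof (eventually_elim)
      case (elim \<omega>)
      then show ?case
      proof eventually_elim
        case (elim n)
        have "\<bar>(\<Sum>i<Suc n. g (X i \<omega>)) / real (Suc n) - m\<bar>
            = \<bar>(\<Sum>i<Suc n. g (X i \<omega>)) - real (Suc n) * m\<bar> / real (Suc n)"
        proof -
          have "\<bar>a / N - m\<bar> = \<bar>a - N * m\<bar> / N" if "N > 0" for a N :: real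
          proof -
            have "a / N - m = (a - N * m) / N" using that by (simp add: field_simps)
            then show ?thesis using that by (simp only: abs_divide abs_of_pos)
          qed
          then show ?thesis by (simp only: of_nat_0_less_iff zero_less_Suc)
        qed
        also have "\<dots> < \<epsilon>" using elim by (simp add: A_def pos_divide_less_eq not_le del: of_nat_Suc sum.lessThan_Suc)
        finally show ?case .
      qed
    qed
  qed
  have "AE \<omega> in M. \<forall>j. \<forall>\<^sub>F n in sequentially.
      \<bar>(\<Sum>i<Suc n. g (X i \<omega>)) / real (Suc n) - m\<bar> < 1 / real (Suc j)"
    unfolding AE_all_countable using ev by simp
  then show ?thesis
  proof eventually_elim
    case (elim \<omega>)
    have "(\<lambda>n. (\<Sum>i<Suc n. g (X i \<omega>)) / real (Suc n)) \<longlonglongrightarrow> m"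
    proof (rule tendstoI)
      fix e :: real assume "e > 0"
      then obtain j where j: "1 / real (Suc j) < e" using nat_approx_posE by blast
      from elim have "\<forall>\<^sub>F n in sequentially.
        \<bar>(\<Sum>i<Suc n. g (X i \<omega>)) / real (Suc n) - m\<bar> < 1 / real (Suc j)" by blast
      then show "\<forall>\<^sub>F n in sequentially. dist ((\<Sum>i<Suc n. g (X i \<omega>)) / real (Suc n)) m < e"
      proof eventually_elim
        case (elim n)
        then show ?case using j unfolding dist_real_def by linarith
      qed
    qed
    then show ?case unfolding m_def by (rule LIMSEQ_imp_Suc)
  qed
qed

text \<open>Real strong laws for finitely many indicators handle a simple approximant of
  \<open>f\<close>. The replacement error within the sample is at most \<open>e\<close> plus
  \<open>B\<close> times the empirical frequency of the event \<open>bad\<close>.\<close>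

lemma bounded_strong_law_dual:
  fixes f :: "'a \<Rightarrow> 'b::real_normed_vector \<Rightarrow>\<^sub>L real"
  assumes sep: "separable_space (euclidean :: ('b \<Rightarrow>\<^sub>L real) topology)"
    and f: "f \<in> borel_measurable borel" and B: "\<And>y. norm (f y) \<le> B"
  shows "AE \<omega> in M. (\<lambda>n. (1 / real n) *\<^sub>R (\<Sum>i<n. f (X i \<omega>))) \<longlonglongrightarrow> bochner_expectation \<mu> f"
proof -
  define S where "S = bochner_expectation \<mu> f"
  have f': "f \<in> borel_measurable \<mu>" using f by (simp cong: measurable_cong_sets)
  have S: "blinfun_apply S h = (\<integral>y. blinfun_apply (f y) h \<partial>\<mu>)" for h
    unfolding S_def by (rule law.bochner_expectation_apply[OF sep f' B])
  have B0: "0 \<le> B" using B[of undefined] norm_ge_zero order_trans by blast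
  \<comment> \<open>The constant collects \<open>e + 2 * B * e\<close> for replacing
    \<open>f\<close> by \<open>s\<close> in the sample, \<open>e\<close> for the empirical
    frequencies, and \<open>e + B * e\<close> for replacing \<open>f\<close> in the
    expectation.\<close>
  have ev: "AE \<omega> in M. \<forall>\<^sub>F n in sequentially.
      norm ((1 / real n) *\<^sub>R (\<Sum>i<n. f (X i \<omega>)) - S) \<le> (3 + 3 * B) * e" if e: "e > 0" for e
  proof -
    obtain n A y bad where A: "\<And>k. A k \<in> law.events" and bad: "bad \<in> law.events" "law.prob bad \<le> e"
      and s_le: "\<And>x. x \<in> space \<mu> \<Longrightarrow>
        norm (f x - (\<Sum>k<n::nat. indicator (A k) x *\<^sub>R y k)) \<le> e + B * indicator bad x"
      by (rule law.dual_simple_approximation[OF sep f' B e]) (rule that; assumption)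
    have A'[measurable]: "A k \<in> sets borel" for k using A by simp
    have bad'[measurable]: "bad \<in> sets borel" using bad by simp
    define s where "s x = (\<Sum>k<n. indicator (A k) x *\<^sub>R y k)" for x
    have sf: "norm (f x - s x) \<le> e + B * indicator bad x" for x using s_le[of x] by (simp add: s_def)
    define z where "z = (\<Sum>k<n. law.prob (A k) *\<^sub>R y k)"
    have zS: "norm (z - S) \<le> e + B * e"
      unfolding z_def
      by (rule law.simple_expectation_close[OF law.integrable_blinfun_apply[OF sep f' B] S A bad B0 less_imp_le[OF e] s_le])
    have "AE \<omega> in M. (\<lambda>m. (\<Sum>i<m. indicator bad (X i \<omega>)) / m) \<longlonglongrightarrow> (\<integral>x. indicat_real bad x \<partial>\<mu>)"
      by (rule bounded_strong_law[of _ 1]) (auto simp: indicator_def)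
    moreover have "AE \<omega> in M. \<forall>k\<in>{..<n}. (\<lambda>m. (\<Sum>i<m. indicator (A k) (X i \<omega>)) / m)
        \<longlonglongrightarrow> (\<integral>x. indicat_real (A k) x \<partial>\<mu>)"
    proof (rule AE_finite_allI)
      show "AE \<omega> in M. (\<lambda>m. (\<Sum>i<m. indicator (A k) (X i \<omega>)) / m)
        \<longlonglongrightarrow> (\<integral>x. indicat_real (A k) x \<partial>\<mu>)" for k
        by (rule bounded_strong_law[of _ 1]) (auto simp: indicator_def)
    qed simp
    ultimately show ?thesis
    proof eventually_elim
      case (elim \<omega>)
      define b where "b m = (\<Sum>i<m. indicat_real bad (X i \<omega>)) / m" for m :: nat
      define a where "a k m = (\<Sum>i<m. indicat_real (A k) (X i \<omega>)) / m" for k and m :: nat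
      have b: "b \<longlonglongrightarrow> law.prob bad" using elim(1) bad unfolding b_def by simp
      have a: "a k \<longlonglongrightarrow> law.prob (A k)" if "k < n" for k using elim(2) A that unfolding a_def by simp
      have "(\<lambda>m. \<Sum>k<n. a k m *\<^sub>R y k) \<longlonglongrightarrow> z"
        unfolding z_def by (intro tendsto_sum tendsto_scaleR a tendsto_const) simp
      from tendstoD[OF this e]
      have ev1: "\<forall>\<^sub>F m in sequentially. norm ((\<Sum>k<n. a k m *\<^sub>R y k) - z) < e"
        by (simp add: dist_norm)
      \<comment> \<open>The frequency tends to a probability of at most \<open>e\<close>; the
        doubled bound provides the strict inequality.\<close>
      have ev2: "\<forall>\<^sub>F m in sequentially. b m < 2 * e"
        by (rule order_tendstoD[OF b]) (use bad(2) e in linarith)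
      show ?case using ev1 ev2 eventually_gt_at_top[of 0]
      proof eventually_elim
        case (elim m)
        have "(1 / real m) *\<^sub>R (\<Sum>i<m. s (X i \<omega>)) = (\<Sum>k<n. a k m *\<^sub>R y k)"
          unfolding s_def a_def
          by (subst sum.swap)
            (simp add: scaleR_sum_right scaleR_left.sum sum_divide_distrib del: sum_indicator_scaleR sum_mult_indicator sum_indicator_mult)
        moreover have "norm ((1 / real m) *\<^sub>R (\<Sum>i<m. f (X i \<omega>) - s (X i \<omega>))) \<le> e + B * b m"
        proof -
          have "norm (\<Sum>i<m. f (X i \<omega>) - s (X i \<omega>)) \<le> (\<Sum>i<m. e + B * indicator bad (X i \<omega>))"
            by (rule sum_norm_le[OF sf])
          also have "\<dots> = real m * (e + B * b m)"
            using elim by (simp add: b_def sum.distrib sum_distrib_left[symmetric] distrib_left)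
          finally show ?thesis using elim by (simp add: divide_simps mult.commute)
        qed
        moreover have "B * b m \<le> B * (2 * e)" using elim B0 by (intro mult_left_mono) auto
        ultimately have "norm ((1 / real m) *\<^sub>R (\<Sum>i<m. f (X i \<omega>)) - (\<Sum>k<n. a k m *\<^sub>R y k)) \<le> e + B * (2 * e)"
          by (simp add: sum_subtractf scaleR_diff_right)
        moreover have "norm (((1 / real m) *\<^sub>R (\<Sum>i<m. f (X i \<omega>)) - (\<Sum>k<n. a k m *\<^sub>R y k))
             + (((\<Sum>k<n. a k m *\<^sub>R y k) - z) + (z - S)))
           \<le> norm ((1 / real m) *\<^sub>R (\<Sum>i<m. f (X i \<omega>)) - (\<Sum>k<n. a k m *\<^sub>R y k))
             + (norm ((\<Sum>k<n. a k m *\<^sub>R y k) - z) + norm (z - S))"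
          using norm_triangle_ineq order_trans add_left_mono by (smt (verit))
        ultimately show ?case using zS elim(1) by (simp add: algebra_simps)
      qed
    qed
  qed
  have "AE \<omega> in M. \<forall>j. \<forall>\<^sub>F n in sequentially.
      norm ((1 / real n) *\<^sub>R (\<Sum>i<n. f (X i \<omega>)) - S) \<le> (3 + 3 * B) * (1 / real (Suc j))"
    unfolding AE_all_countable by (intro allI ev) simp
  then show ?thesis
  proof eventually_elim
    case (elim \<omega>)
    show ?case unfolding S_def[symmetric]
    proof (rule tendstoI)
      fix e :: real assume "e > 0"
      have C: "0 < 3 + 3 * B" using B0 by simp
      with \<open>e > 0\<close> obtain j where j: "1 / real (Suc j) < e / (3 + 3 * B)"
        using nat_approx_posE[of "e / (3 + 3 * B)"] by (metis divide_pos_pos)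
      then have j': "(3 + 3 * B) * (1 / real (Suc j)) < e" using C by (simp add: field_simps)
      from elim have "\<forall>\<^sub>F n in sequentially.
        norm ((1 / real n) *\<^sub>R (\<Sum>i<n. f (X i \<omega>)) - S) \<le> (3 + 3 * B) * (1 / real (Suc j))" by blast
      then show "\<forall>\<^sub>F n in sequentially. dist ((1 / real n) *\<^sub>R (\<Sum>i<n. f (X i \<omega>))) S < e"
        by eventually_elim (use j' in \<open>simp only: dist_norm\<close>)
    qed
  qed
qed

end

section \<open>Uniform convergence of the spatial depth on compact sets\<close>

text \<open>The functionals at \<open>u\<close> and \<open>- u\<close> differ by
  \<open>2 * norm u\<close> when evaluated at \<open>u\<close>, hence by at least 2 in norm, while
  the points are \<open>2 * norm u\<close> apart. The bound replaces the Lipschitz condition where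
  the second argument of \<open>SGN\<close> is 0.\<close>

lemma SGN_lipschitz_modulus_ge:
  fixes u :: "'a::real_normed_vector"
  assumes smooth: "smooth_space TYPE('a)"
    and T: "\<And>x h::'a. x \<noteq> 0 \<Longrightarrow> x \<noteq> - h \<Longrightarrow> norm (SGN (x + h) - SGN x) \<le> T x * norm h"
    and u: "u \<noteq> 0"
  shows "1 \<le> T u * norm u"
proof -
  have "u \<noteq> - (- 2 *\<^sub>R u)"
  proof
    assume "u = - (- 2 *\<^sub>R u)"
    then have "u - 2 *\<^sub>R u = 0" by simp
    then show False using u by (simp add: scaleR_2)
  qed
  from T[OF u this] have "norm (SGN (u + - 2 *\<^sub>R u) - SGN u) \<le> T u * norm (- 2 *\<^sub>R u)" .
  moreover have "u + - 2 *\<^sub>R u = - u" by (simp add: scaleR_2)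
  ultimately have 1: "norm (SGN (- u) - SGN u) \<le> T u * (2 * norm u)" by simp
  have "blinfun_apply (SGN (- u)) u = - norm u"
    using SGN_self[OF smooth, of "- u"] by (simp add: blinfun.minus_right)
  then have "\<bar>blinfun_apply (SGN (- u) - SGN u) u\<bar> = 2 * norm u"
    using SGN_self[OF smooth, of u] by (simp add: blinfun.diff_left)
  then have "2 * norm u \<le> norm (SGN (- u) - SGN u) * norm u"
    using abs_blinfun_apply_le[of "SGN (- u) - SGN u" u] by simp
  then have "2 \<le> norm (SGN (- u) - SGN u)" using u by simp
  then show ?thesis using 1 by simp
qed

text \<open>
  Two values of \<open>SGN\<close> differ by at most 2, so the modulus may be truncated there; then
  pointwise finiteness and dominated convergence suffice.
\<close>

lemma truncated_modulus_small:
  fixes \<mu> :: "'a::real_normed_vector measure" and T :: "'a \<Rightarrow> real"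
  assumes \<mu>: "prob_space \<mu>" "sets \<mu> = sets borel"
    and T: "T \<in> borel_measurable borel" "\<And>x. 0 \<le> T x" and e: "e > 0"
  shows "\<exists>\<eta>>0. (\<integral>y. min 2 (\<eta> * T (x - y)) \<partial>\<mu>) < e"
proof -
  interpret prob_space \<mu> by (rule \<mu>)
  have Tx: "(\<lambda>y. T (x - y)) \<in> borel_measurable borel"
    by (rule measurable_compose[OF _ T(1)])
       (auto intro!: borel_measurable_continuous_onI continuous_intros)
  have m: "(\<lambda>y. min 2 (c * T (x - y))) \<in> borel_measurable \<mu>" for c :: real
    using Tx \<mu>(2) by (simp cong: measurable_cong_sets)
  have "(\<lambda>k. \<integral>y. min 2 (1 / real (Suc k) * T (x - y)) \<partial>\<mu>) \<longlonglongrightarrow> (\<integral>y. 0 \<partial>\<mu>)"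
  proof (rule integral_dominated_convergence[where w="\<lambda>_. 2"])
    show "AE y in \<mu>. (\<lambda>k. min 2 (1 / real (Suc k) * T (x - y))) \<longlonglongrightarrow> 0"
    proof (rule AE_I2)
      fix y
      have "(\<lambda>k. 1 / real (Suc k) * T (x - y)) \<longlonglongrightarrow> 0 * T (x - y)"
        by (intro tendsto_mult LIMSEQ_Suc[OF lim_1_over_n] tendsto_const)
      then have "(\<lambda>k. min 2 (1 / real (Suc k) * T (x - y))) \<longlonglongrightarrow> min 2 (0 * T (x - y))"
        by (intro tendsto_min tendsto_const)
      then show "(\<lambda>k. min 2 (1 / real (Suc k) * T (x - y))) \<longlonglongrightarrow> 0" by simp
    qed
    have "0 \<le> min 2 (1 / real (Suc k) * T (x - y))" for k y
      using T(2)[of "x - y"] by simp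
    then have "norm (min 2 (1 / real (Suc k) * T (x - y))) \<le> 2" for k y
      by (simp only: real_norm_def abs_of_nonneg min.cobounded1)
    then show "AE y in \<mu>. norm (min 2 (1 / real (Suc k) * T (x - y))) \<le> 2" for k
      by blast
    show "(\<lambda>y. min 2 (1 / real (Suc k) * T (x - y))) \<in> borel_measurable \<mu>" for k by (rule m)
  qed simp_all
  then have "(\<lambda>k. \<integral>y. min 2 (1 / real (Suc k) * T (x - y)) \<partial>\<mu>) \<longlonglongrightarrow> 0" by simp
  then have "\<forall>\<^sub>F k in sequentially. (\<integral>y. min 2 (1 / real (Suc k) * T (x - y)) \<partial>\<mu>) < e"
    using e by (rule order_tendstoD)
  then obtain k where "(\<integral>y. min 2 (1 / real (Suc k) * T (x - y)) \<partial>\<mu>) < e"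
    by (meson eventually_sequentially order_refl)
  then show ?thesis by (intro exI[of _ "1 / real (Suc k)"]) simp
qed

text \<open>In the extended nonnegative reals the supremum always exists and is 0 for empty
  \<open>K\<close>, so an eventual bound that is uniform over \<open>K\<close> is all that has to be
  supplied.\<close>

lemma tendsto_0_SUP_ennreal:
  fixes g :: "nat \<Rightarrow> 'a \<Rightarrow> real"
  assumes "\<And>e. e > 0 \<Longrightarrow> \<forall>\<^sub>F n in sequentially. \<forall>x\<in>K. g n x \<le> e"
  shows "(\<lambda>n. SUP x\<in>K. ennreal (g n x)) \<longlonglongrightarrow> 0"
proof (rule order_tendstoI)
  fix a :: ennreal assume "a < 0" then show "\<forall>\<^sub>F n in sequentially. a < (SUP x\<in>K. ennreal (g n x))"
    by simp
next
  fix a :: ennreal assume "0 < a"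
  then obtain r where r: "0 < r" "r < a" using dense by blast
  then obtain e where e: "0 \<le> e" "r = ennreal e" by (cases r) auto
  with r have "e > 0" by (simp add: ennreal_less_zero_iff)
  from assms[OF this] show "\<forall>\<^sub>F n in sequentially. (SUP x\<in>K. ennreal (g n x)) < a"
  proof eventually_elim
    case (elim n)
    then have "(SUP x\<in>K. ennreal (g n x)) \<le> r"
      unfolding e by (intro SUP_least ennreal_leI) auto
    then show ?case using r(2) by (rule le_less_trans)
  qed
qed

text \<open>At \<open>y = x\<close> the jump is exactly \<open>SGN (x' - x)\<close>, since
  \<open>SGN 0 = 0\<close>; the indicator term removes it and the left side vanishes. Elsewhere the
  trivial bound 2 and the Lipschitz bound are combined.\<close>

lemma SGN_diff_perturbation:
  fixes x x' y :: "'a::real_normed_vector"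
  assumes smooth: "smooth_space TYPE('a)"
    and T: "\<And>x h::'a. x \<noteq> 0 \<Longrightarrow> x \<noteq> - h \<Longrightarrow> norm (SGN (x + h) - SGN x) \<le> T x * norm h"
    and pos: "\<And>x::'a. x \<noteq> 0 \<Longrightarrow> 0 < T x"
    and \<eta>: "norm (x' - x) \<le> \<eta>"
  shows "norm (SGN (x' - y) - SGN (x - y) - indicator {x} y *\<^sub>R SGN (x' - x))
    \<le> min 2 (\<eta> * (if x - y = 0 then 0 else T (x - y)))"
proof (cases "y = x")
  case False
  then have xy: "x - y \<noteq> 0" by simp
  have "norm (SGN (x' - y) - SGN (x - y)) \<le> norm (SGN (x' - y)) + norm (SGN (x - y))"
    by (rule norm_triangle_ineq4)
  also have "\<dots> \<le> 2" using norm_SGN_le[OF smooth, of "x' - y"] norm_SGN_le[OF smooth, of "x - y"] by simp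
  finally have 1: "norm (SGN (x' - y) - SGN (x - y)) \<le> 2" .
  have "norm (SGN (x' - y) - SGN (x - y)) \<le> T (x - y) * norm (x' - x)"
  proof (cases "x' = y")
    case True
    have "norm (SGN (x' - y) - SGN (x - y)) \<le> 1" using True norm_SGN_le[OF smooth, of "x - y"] by simp
    also have "\<dots> \<le> T (x - y) * norm (x - y)"
      using smooth T xy by (rule SGN_lipschitz_modulus_ge)
    finally show ?thesis using True by (simp add: norm_minus_commute)
  next
    case False
    have "x - y \<noteq> - (x' - x)"
    proof
      assume "x - y = - (x' - x)"
      then show False using False by (simp add: algebra_simps)
    qed
    from T[OF xy this] show ?thesis by simp
  qed
  also have "\<dots> \<le> T (x - y) * \<eta>"
    using pos[OF xy] \<eta> by (intro mult_left_mono) auto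
  finally show ?thesis using 1 False by (simp add: mult.commute)
qed simp

lemma emp_spatial_depth_uniform_convergence:
  fixes X :: "nat \<Rightarrow> 'w \<Rightarrow> 'a::real_normed_vector" and T :: "'a \<Rightarrow> real"
  assumes iid: "iid_sample M X \<mu>"
    and smooth: "smooth_space TYPE('a)"
    and sep: "separable_space (euclidean :: ('a \<Rightarrow>\<^sub>L real) topology)"
    and Tm: "T \<in> borel_measurable (restrict_space borel (- {0}))"
    and T0: "\<And>x. x \<noteq> 0 \<Longrightarrow> 0 < T x"
    and T: "\<And>x h. x \<noteq> 0 \<Longrightarrow> x \<noteq> - h \<Longrightarrow> norm (SGN (x + h) - SGN x) \<le> T x * norm h"
    and K: "compact K"
  shows "AE \<omega> in M. (\<lambda>n. SUP x\<in>K. ennreal \<bar>emp_spatial_depth X n \<omega> x - spatial_depth \<mu> x\<bar>) \<longlonglongrightarrow> 0"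
proof -
  interpret iid_sample M X \<mu> by (rule iid)
  \<comment> \<open>The value 0 at the origin makes the modulus Borel on the whole space; what
    happens at that point is carried by the indicator term.\<close>
  define R where "R u = (if u = 0 then 0 else T u)" for u :: 'a
  have R: "R \<in> borel_measurable borel" "\<And>u. 0 \<le> R u"
  proof -
    have "(\<lambda>x. if x \<in> - {0} then T x else 0) \<in> borel_measurable borel"
      by (subst measurable_restrict_space_iff[symmetric]) (use Tm in auto)
    also have "(\<lambda>x. if x \<in> - {0} then T x else 0) = R" by (auto simp: R_def)
    finally show "R \<in> borel_measurable borel" .
    show "0 \<le> R u" for u using T0[of u] by (auto simp: R_def)
  qed
  have fm: "(\<lambda>y. SGN (x - y)) \<in> borel_measurable borel" for x :: 'a
    by (rule SGN_diff_borel_measurable[OF smooth sep])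
  have fm': "(\<lambda>y. SGN (x - y)) \<in> borel_measurable \<mu>" for x :: 'a
    using fm by (simp cong: measurable_cong_sets)
  have S: "blinfun_apply (spatial_distribution \<mu> x) h = (\<integral>y. blinfun_apply (SGN (x - y)) h \<partial>\<mu>)" for x h
    unfolding spatial_distribution_def
    by (rule law.bochner_expectation_apply[OF sep fm' norm_SGN_le[OF smooth]])
  define g where "g x \<eta> y = min 2 (\<eta> * R (x - y))" for x :: 'a and \<eta> :: real and y
  have gm: "g x \<eta> \<in> borel_measurable borel" for x \<eta>
  proof -
    have "(\<lambda>y. R (x - y)) \<in> borel_measurable borel"
      by (rule measurable_compose[OF _ R(1)])
         (auto intro!: borel_measurable_continuous_onI continuous_intros)
    then show ?thesis unfolding g_def by simp
  qed
  have gb: "\<bar>g x \<eta> y\<bar> \<le> 2" if "\<eta> > 0" for x \<eta> y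
  proof -
    have "0 \<le> g x \<eta> y" using that R(2)[of "x - y"] by (simp add: g_def)
    then show ?thesis by (simp add: g_def)
  qed
  have pert: "norm (SGN (x' - y) - SGN (x - y) - indicator {x} y *\<^sub>R SGN (x' - x)) \<le> g x \<eta> y"
    if "norm (x' - x) \<le> \<eta>" for x x' y \<eta>
    unfolding g_def R_def by (rule SGN_diff_perturbation[OF smooth T T0 that])
  \<comment> \<open>Four errors of at most \<open>e\<close> occur: the empirical modulus, the
    expected modulus, the frequency of the net point, and the strong law at the net point. The
    factor 5 leaves slack.\<close>
  have ev: "AE \<omega> in M. \<forall>\<^sub>F n in sequentially. \<forall>x\<in>K.
      \<bar>emp_spatial_depth X n \<omega> x - spatial_depth \<mu> x\<bar> \<le> 5 * e" if e: "e > 0" for e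
  proof -
    have "\<forall>x. \<exists>\<eta>>0. (\<integral>y. g x \<eta> y \<partial>\<mu>) < e"
      unfolding g_def using truncated_modulus_small[OF law.prob_space_axioms sets_law R e] by blast
    then obtain \<eta> where \<eta>: "\<And>x. \<eta> x > 0" "\<And>x. (\<integral>y. g x (\<eta> x) y \<partial>\<mu>) < e"
      by metis
    \<comment> \<open>The radius of each ball is adapted to its centre so that the expected modulus
      there is below \<open>e\<close>. Compactness leaves finitely many centres, hence finitely many
      almost sure statements.\<close>
    obtain F where F: "F \<subseteq> K" "finite F" "K \<subseteq> (\<Union>x\<in>F. ball x (\<eta> x))"
    proof (rule compactE_image[OF K, of K "\<lambda>x. ball x (\<eta> x)"])
      show "K \<subseteq> (\<Union>x\<in>K. ball x (\<eta> x))" using \<eta>(1) by force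
    qed auto
    have "AE \<omega> in M. \<forall>x\<in>F.
       (\<lambda>n. emp_spatial_distribution X n \<omega> x) \<longlonglongrightarrow> spatial_distribution \<mu> x"
      using F(2) unfolding emp_spatial_distribution_def spatial_distribution_def
      by (intro AE_finite_allI bounded_strong_law_dual[OF sep fm norm_SGN_le[OF smooth]])
    moreover have "AE \<omega> in M. \<forall>x\<in>F. (\<lambda>n. (\<Sum>i<n. g x (\<eta> x) (X i \<omega>)) / n) \<longlonglongrightarrow> (\<integral>y. g x (\<eta> x) y \<partial>\<mu>)"
      using F(2) by (intro AE_finite_allI bounded_strong_law[OF gm gb] \<eta>)
    moreover have "AE \<omega> in M. \<forall>x\<in>F. (\<lambda>n. (\<Sum>i<n. indicator {x} (X i \<omega>)) / n) \<longlonglongrightarrow> (\<integral>y. indicat_real {x} y \<partial>\<mu>)"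
      using F(2) by (intro AE_finite_allI bounded_strong_law[of _ 1]) (auto simp: indicator_def)
    ultimately show ?thesis
    proof eventually_elim
      case (elim \<omega>)
      have "\<forall>\<^sub>F n in sequentially. \<forall>x\<in>F.
          norm (emp_spatial_distribution X n \<omega> x - spatial_distribution \<mu> x) < e
        \<and> (\<Sum>i<n. g x (\<eta> x) (X i \<omega>)) / n < e
        \<and> \<bar>(\<Sum>i<n. indicator {x} (X i \<omega>)) / n - (\<integral>y. indicat_real {x} y \<partial>\<mu>)\<bar> < e"
      proof (intro eventually_ball_finite F(2) ballI eventually_conj)
        fix x assume x: "x \<in> F"
        show "\<forall>\<^sub>F n in sequentially. norm (emp_spatial_distribution X n \<omega> x - spatial_distribution \<mu> x) < e"
          using tendstoD[OF elim(1)[rule_format, OF x] e] by (simp add: dist_norm)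
        show "\<forall>\<^sub>F n in sequentially. (\<Sum>i<n. g x (\<eta> x) (X i \<omega>)) / n < e"
          by (rule order_tendstoD(2)[OF elim(2)[rule_format, OF x] \<eta>(2)])
        show "\<forall>\<^sub>F n in sequentially. \<bar>(\<Sum>i<n. indicator {x} (X i \<omega>)) / n - (\<integral>y. indicat_real {x} y \<partial>\<mu>)\<bar> < e"
          using tendstoD[OF elim(3)[rule_format, OF x] e] by (simp add: dist_real_def)
      qed
      then show ?case using eventually_gt_at_top[of 0]
      proof eventually_elim
        case (elim n)
        show ?case
        proof
          fix x' assume "x' \<in> K"
          then obtain x where x: "x \<in> F" "x' \<in> ball x (\<eta> x)" using F(3) by blast
          then have \<eta>x: "norm (x' - x) \<le> \<eta> x" by (simp add: dist_norm norm_minus_commute)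
          define p where "p = (\<Sum>i<n. indicat_real {x} (X i \<omega>)) / n"
          define q where "q = (\<integral>y. indicat_real {x} y \<partial>\<mu>)"
          define V where "V = SGN (x' - x)"
          define E' E where "E' = emp_spatial_distribution X n \<omega> x'" and "E = emp_spatial_distribution X n \<omega> x"
          define S' S where "S' = spatial_distribution \<mu> x'" and "S = spatial_distribution \<mu> x"
          have E_eq: "E' - E - p *\<^sub>R V = (1 / real n) *\<^sub>R
              (\<Sum>i<n. SGN (x' - X i \<omega>) - SGN (x - X i \<omega>) - indicator {x} (X i \<omega>) *\<^sub>R V)"
            unfolding E'_def E_def p_def emp_spatial_distribution_def
            by (simp add: sum_subtractf scaleR_diff_right scaleR_left.sum sum_divide_distrib scaleR_sum_right
              del: sum_indicator_scaleR sum_mult_indicator sum_indicator_mult)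
          have "norm (\<Sum>i<n. SGN (x' - X i \<omega>) - SGN (x - X i \<omega>) - indicator {x} (X i \<omega>) *\<^sub>R V)
              \<le> (\<Sum>i<n. g x (\<eta> x) (X i \<omega>))"
            unfolding V_def by (rule sum_norm_le) (rule pert[OF \<eta>x])
          then have 1: "norm (E' - E - p *\<^sub>R V) \<le> (\<Sum>i<n. g x (\<eta> x) (X i \<omega>)) / n"
            unfolding E_eq using elim(2) by (simp add: divide_right_mono)
          have "norm (S' - S - q *\<^sub>R V) \<le> (\<integral>y. g x (\<eta> x) y \<partial>\<mu>)"
          proof (rule norm_expectation_le)
            have intf: "integrable \<mu> (\<lambda>y. blinfun_apply (SGN (x - y)) h)" for x h :: 'a
              by (rule law.integrable_blinfun_apply[OF sep fm' norm_SGN_le[OF smooth]])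
            have inti: "integrable \<mu> (indicat_real {x})"
              by (rule integrable_real_indicator) (auto simp: law.emeasure_eq_measure)
            show "blinfun_apply (S' - S - q *\<^sub>R V) h = (\<integral>y. blinfun_apply (SGN (x' - y)) h
               - blinfun_apply (SGN (x - y)) h - indicator {x} y * blinfun_apply V h \<partial>\<mu>)" for h
              using intf inti by (simp add: S'_def S_def q_def S blinfun.diff_left blinfun.scaleR_left)
            show "integrable \<mu> (\<lambda>y. blinfun_apply (SGN (x' - y)) h
               - blinfun_apply (SGN (x - y)) h - indicator {x} y * blinfun_apply V h)" for h
              using intf inti by (intro Bochner_Integration.integrable_diff integrable_mult_left)
            have "g x (\<eta> x) \<in> borel_measurable \<mu>" using gm by (simp cong: measurable_cong_sets)
            then show "integrable \<mu> (g x (\<eta> x))"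
              by (rule law.integrable_const_bound[of _ 2, rotated]) (use gb \<eta> in auto)
            show "0 \<le> g x (\<eta> x) y" for y using R(2)[of "x - y"] \<eta>(1)[of x] by (simp add: g_def)
            fix y and h :: 'a
            have "norm (SGN (x' - y) - SGN (x - y) - indicator {x} y *\<^sub>R V) * norm h \<le> g x (\<eta> x) y * norm h"
              unfolding V_def by (rule mult_right_mono[OF pert[OF \<eta>x]]) simp
            then show "\<bar>blinfun_apply (SGN (x' - y)) h
               - blinfun_apply (SGN (x - y)) h - indicator {x} y * blinfun_apply V h\<bar> \<le> g x (\<eta> x) y * norm h"
              using abs_blinfun_apply_le[of "SGN (x' - y) - SGN (x - y) - indicator {x} y *\<^sub>R V" h]
              by (simp add: blinfun.diff_left blinfun.scaleR_left)
          qed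
          then have 2: "norm (S' - S - q *\<^sub>R V) \<le> e" using \<eta>(2)[of x] by simp
          have 3: "norm ((p - q) *\<^sub>R V) \<le> e"
          proof -
            have "norm ((p - q) *\<^sub>R V) = \<bar>p - q\<bar> * norm V" by simp
            also have "\<dots> \<le> e * 1"
              using elim(1) x(1) norm_SGN_le[OF smooth, of "x' - x"]
              by (intro mult_mono) (auto simp: p_def q_def V_def less_imp_le)
            finally show ?thesis by simp
          qed
          have 4: "norm (E - S) \<le> e" "(\<Sum>i<n. g x (\<eta> x) (X i \<omega>)) / n \<le> e"
            using elim(1) x(1) by (auto simp: E_def S_def less_imp_le)
          \<comment> \<open>An atom at \<open>x\<close> shifts the empirical mean by
            \<open>p *\<^sub>R V\<close> and the expectation by \<open>q *\<^sub>R V\<close>; only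
            the small difference of these weights survives.\<close>
          have "E' - S' = (E' - E - p *\<^sub>R V) - (S' - S - q *\<^sub>R V) + (p - q) *\<^sub>R V + (E - S)"
            by (simp add: algebra_simps)
          then have "norm (E' - S') \<le> norm (E' - E - p *\<^sub>R V) + norm (S' - S - q *\<^sub>R V) + norm ((p - q) *\<^sub>R V) + norm (E - S)"
            by (metis (no_types, lifting) add_mono norm_triangle_ineq4 norm_triangle_le order_refl)
          then have "norm (E' - S') \<le> 5 * e" using 1 2 3 4 e by linarith
          moreover have "\<bar>norm E' - norm S'\<bar> \<le> norm (E' - S')" by (rule norm_triangle_ineq3)
          ultimately show "\<bar>emp_spatial_depth X n \<omega> x' - spatial_depth \<mu> x'\<bar> \<le> 5 * e"
            unfolding emp_spatial_depth_def spatial_depth_def E'_def[symmetric] S'_def[symmetric]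
            by linarith
        qed
      qed
    qed
  qed
  have "AE \<omega> in M. \<forall>j. \<forall>\<^sub>F n in sequentially. \<forall>x\<in>K.
      \<bar>emp_spatial_depth X n \<omega> x - spatial_depth \<mu> x\<bar> \<le> 5 * (1 / real (Suc j))"
    unfolding AE_all_countable by (intro allI ev) simp
  then show ?thesis
  proof eventually_elim
    case (elim \<omega>)
    show ?case
    proof (rule tendsto_0_SUP_ennreal)
      fix e :: real assume "e > 0"
      then obtain j where j: "1 / real (Suc j) < e / 5"
        using nat_approx_posE[of "e / 5"] by (metis divide_pos_pos zero_less_numeral)
      from elim have "\<forall>\<^sub>F n in sequentially. \<forall>x\<in>K.
        \<bar>emp_spatial_depth X n \<omega> x - spatial_depth \<mu> x\<bar> \<le> 5 * (1 / real (Suc j))" by blast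
      then show "\<forall>\<^sub>F n in sequentially. \<forall>x\<in>K. \<bar>emp_spatial_depth X n \<omega> x - spatial_depth \<mu> x\<bar> \<le> e"
      proof eventually_elim
        case (elim n)
        show ?case
        proof
          fix x assume "x \<in> K"
          then have "\<bar>emp_spatial_depth X n \<omega> x - spatial_depth \<mu> x\<bar> \<le> 5 * (1 / real (Suc j))" using elim by blast
          then show "\<bar>emp_spatial_depth X n \<omega> x - spatial_depth \<mu> x\<bar> \<le> e" using j by linarith
        qed
      qed
    qed
  qed
qed

section \<open>Gaussian sequences\<close>

definition psd_kernel :: "(nat \<Rightarrow> nat \<Rightarrow> real) \<Rightarrow> bool" where
  "psd_kernel R \<longleftrightarrow> (\<forall>i j. R i j = R j i) \<and>
     (\<forall>I t. finite I \<longrightarrow> 0 \<le> (\<Sum>i\<in>I. \<Sum>j\<in>I. t i * t j * R i j))"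

lemma psd_kernel_sym: "psd_kernel R \<Longrightarrow> R i j = R j i"
  by (simp add: psd_kernel_def)

lemma psd_kernel_nonneg: "psd_kernel R \<Longrightarrow> finite I \<Longrightarrow> 0 \<le> (\<Sum>i\<in>I. \<Sum>j\<in>I. t i * t j * R i j)"
  by (simp add: psd_kernel_def)

lemma psd_kernel_diag: "psd_kernel R \<Longrightarrow> 0 \<le> R k k"
  using psd_kernel_nonneg[of R "{k}" "\<lambda>_. 1"] by simp

text \<open>On the indices \<open>i\<close> and \<open>k\<close> the quadratic form reduces to
  \<open>c * c * R i i + 2 * c * R i k\<close>. A nonzero linear term would dominate for small
  \<open>c\<close> and make the form negative for one sign of \<open>c\<close>.\<close>

lemma psd_kernel_zero:
  assumes R: "psd_kernel R" and k: "R k k = 0"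
  shows "R i k = 0"
proof (cases "i = k")
  case False
  have q: "0 \<le> c * c * R i i + 2 * c * R i k" for c
    using psd_kernel_nonneg[OF R, of "{i, k}" "\<lambda>j. if j = i then c else 1"] False k
      psd_kernel_sym[OF R, of i k] by (simp add: algebra_simps)
  show ?thesis
  proof (rule ccontr)
    assume nz: "R i k \<noteq> 0"
    \<comment> \<open>Adding 1 keeps the denominator positive even if \<open>R i i = 0\<close>, and
      makes \<open>c\<close> small enough for the linear term to win.\<close>
    define d where "d = 1 + R i i"
    have d: "0 < d" using psd_kernel_diag[OF R, of i] by (simp add: d_def)
    define c where "c = - R i k / d"
    have cd: "c * d = - R i k" using d by (simp add: c_def)
    have "d * d * (c * c * R i i + 2 * c * R i k) = (c * d) * (c * d) * R i i + 2 * d * (c * d) * R i k"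
      by (simp add: algebra_simps)
    also have "\<dots> = - ((R i k)\<^sup>2 * (2 + R i i))"
      unfolding cd by (simp add: d_def power2_eq_square algebra_simps)
    also have "\<dots> < 0" using nz psd_kernel_diag[OF R, of i] by simp
    finally have "d * d * (c * c * R i i + 2 * c * R i k) < 0" .
    moreover have "0 \<le> d * d * (c * c * R i i + 2 * c * R i k)"
      using q[of c] d by (intro mult_nonneg_nonneg) auto
    ultimately show False by simp
  qed
qed (use k in simp)

text \<open>The Schur complement at the pivot \<open>k\<close>: the covariance that remains after
  regression on the variable \<open>k\<close>. A zero pivot leaves \<open>R\<close> unchanged, since
  division by zero yields 0.\<close>

definition schur_step :: "nat \<Rightarrow> (nat \<Rightarrow> nat \<Rightarrow> real) \<Rightarrow> nat \<Rightarrow> nat \<Rightarrow> real" where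
  "schur_step k R i j = R i j - R i k * R j k / R k k"

text \<open>A value of the form of the Schur complement is a value of the form of \<open>R\<close>
  in which the coefficient of \<open>k\<close> has been moved to its minimising position.\<close>

lemma psd_kernel_schur_step:
  assumes R: "psd_kernel R"
  shows "psd_kernel (schur_step k R)"
proof (cases "R k k = 0")
  case True
  then have "schur_step k R = R" by (intro ext) (simp add: schur_step_def)
  then show ?thesis using R by simp
next
  case False
  have Rs: "R i j = R j i" for i j by (rule psd_kernel_sym[OF R])
  have "0 \<le> (\<Sum>i\<in>I. \<Sum>j\<in>I. t i * t j * schur_step k R i j)" if I: "finite I" for I :: "nat set" and t
  proof -
    define J where "J = insert k I"
    define s where "s i = (if i \<in> I then t i else 0)" for i
    have J: "finite J" "k \<in> J" using I by (auto simp: J_def)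
    have sub: "(\<Sum>i\<in>I. t i * g i) = (\<Sum>i\<in>J. s i * g i)" for g :: "nat \<Rightarrow> real"
      by (rule sum.mono_neutral_cong_left) (use I in \<open>auto simp: J_def s_def\<close>)
    have sub2: "(\<Sum>i\<in>I. \<Sum>j\<in>I. t i * t j * H i j) = (\<Sum>i\<in>J. \<Sum>j\<in>J. s i * s j * H i j)" for H :: "nat \<Rightarrow> nat \<Rightarrow> real"
      using sub sub[of "\<lambda>i. \<Sum>j\<in>J. s j * H i j"] by (simp add: mult.assoc sum_distrib_left[symmetric])
    define b where "b = (\<Sum>i\<in>J. s i * R i k)"
    \<comment> \<open>Adding \<open>c\<close> at index \<open>k\<close> changes the form by
      \<open>2 * c * b + c * c * R k k\<close>; this choice minimises the change, with minimum
      \<open>- (b * b / R k k)\<close>.\<close>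
    define c where "c = - b / R k k"
    have b': "(\<Sum>j\<in>J. s j * R k j) = b" unfolding b_def using Rs by simp
    have inner: "(\<Sum>j\<in>J. (s j + (if j = k then c else 0)) * R i j) = (\<Sum>j\<in>J. s j * R i j) + c * R i k" for i
    proof -
      have "(\<Sum>j\<in>J. (s j + (if j = k then c else 0)) * R i j)
          = (\<Sum>j\<in>J. s j * R i j) + (\<Sum>j\<in>J. if j = k then c * R i k else 0)"
        by (subst sum.distrib[symmetric], rule sum.cong) (auto simp: distrib_right)
      then show ?thesis using J by simp
    qed
    have "0 \<le> (\<Sum>i\<in>J. \<Sum>j\<in>J. (s i + (if i = k then c else 0)) * (s j + (if j = k then c else 0)) * R i j)"
      by (rule psd_kernel_nonneg[OF R J(1)])
    also have "\<dots> = (\<Sum>i\<in>J. (s i + (if i = k then c else 0)) * ((\<Sum>j\<in>J. s j * R i j) + c * R i k))"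
      by (simp add: mult.assoc sum_distrib_left[symmetric] inner)
    also have "\<dots> = (\<Sum>i\<in>J. s i * ((\<Sum>j\<in>J. s j * R i j) + c * R i k)
         + (if i = k then c * (b + c * R k k) else 0))"
      by (rule sum.cong) (auto simp: distrib_right b')
    also have "\<dots> = (\<Sum>i\<in>J. s i * ((\<Sum>j\<in>J. s j * R i j) + c * R i k)) + c * (b + c * R k k)"
      using J by (simp add: sum.distrib)
    also have "(\<Sum>i\<in>J. s i * ((\<Sum>j\<in>J. s j * R i j) + c * R i k))
        = (\<Sum>i\<in>J. \<Sum>j\<in>J. s i * s j * R i j) + c * b"
      unfolding b_def by (simp add: distrib_left sum.distrib sum_distrib_left mult_ac)
    also have "(\<Sum>i\<in>J. \<Sum>j\<in>J. s i * s j * R i j) + c * b + c * (b + c * R k k)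
        = (\<Sum>i\<in>J. \<Sum>j\<in>J. s i * s j * R i j) - b * b / R k k"
      using False unfolding c_def by (simp add: field_simps)
    also have "b * b / R k k = (\<Sum>i\<in>J. \<Sum>j\<in>J. s i * s j * (R i k * R j k / R k k))"
      unfolding b_def sum_product sum_divide_distrib by (simp add: mult_ac)
    also have "(\<Sum>i\<in>J. \<Sum>j\<in>J. s i * s j * R i j) - \<dots> = (\<Sum>i\<in>J. \<Sum>j\<in>J. s i * s j * schur_step k R i j)"
      unfolding schur_step_def by (simp add: sum_subtractf[symmetric] right_diff_distrib)
    finally show ?thesis unfolding sub2 .
  qed
  then show ?thesis unfolding psd_kernel_def schur_step_def using Rs by (simp add: mult.commute)
qed

primrec schur_seq :: "(nat \<Rightarrow> nat \<Rightarrow> real) \<Rightarrow> nat \<Rightarrow> nat \<Rightarrow> nat \<Rightarrow> real" where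
  "schur_seq R 0 = R"
| "schur_seq R (Suc k) = schur_step k (schur_seq R k)"

text \<open>Products of entries telescope along the Schur complements:
  \<open>a i k * a j k = Q k i j - Q (Suc k) i j\<close>. Once \<open>i\<close> has served as a
  pivot its whole row vanishes, so the remainder is 0 for \<open>i < n\<close> and the factor is
  lower triangular.\<close>

theorem cholesky_decomposition:
  assumes R: "psd_kernel R"
  obtains a :: "nat \<Rightarrow> nat \<Rightarrow> real" where "\<And>i k. i < k \<Longrightarrow> a i k = 0"
    and "\<And>i j n. i < n \<Longrightarrow> (\<Sum>k<n. a i k * a j k) = R i j"
proof -
  define Q where "Q = schur_seq R"
  have Q0: "Q 0 = R" and QS: "Q (Suc k) i j = Q k i j - Q k i k * Q k j k / Q k k k" for k i j
    by (simp_all add: Q_def schur_step_def)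
  have psd: "psd_kernel (Q k)" for k
    unfolding Q_def by (induction k) (simp_all add: R psd_kernel_schur_step)
  have diag0: "Q k i i = 0" if "i < k" for i k
    using that
  proof (induction k)
    case (Suc k)
    show ?case
    proof (cases "i = k")
      case True
      then show ?thesis by (simp add: QS)
    next
      case False
      then have "Q k i i = 0" using Suc by simp
      moreover have "0 \<le> Q k i k * Q k i k / Q k k k" using psd_kernel_diag[OF psd] by simp
      moreover have "0 \<le> Q (Suc k) i i" by (rule psd_kernel_diag[OF psd])
      ultimately show ?thesis by (simp add: QS)
    qed
  qed simp
  have zero: "Q k i j = 0" if "i < k" for i j k
    using psd_kernel_zero[OF psd diag0[OF that], of j] psd_kernel_sym[OF psd] by metis
  define a where "a i k = Q k i k / sqrt (Q k k k)" for i k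
  have aa: "a i k * a j k = Q k i j - Q (Suc k) i j" for i j k
    using psd_kernel_diag[OF psd, of k k] by (simp add: a_def QS)
  have "(\<Sum>k<n. a i k * a j k) = R i j - Q n i j" for i j n
    by (induction n) (simp_all add: Q0 aa)
  then show ?thesis
    by (intro that[of a]) (simp_all add: a_def zero)
qed

section \<open>White noise and Gaussian sequences with prescribed covariance\<close>

abbreviation white_noise :: "(nat \<Rightarrow> real) measure" where
  "white_noise \<equiv> \<Pi>\<^sub>M _\<in>UNIV. std_normal_distribution"

lemma prob_space_white_noise: "prob_space white_noise"
  using real_dist_normal_dist by (intro prob_space_PiM) (simp add: real_distribution_def)

lemma distr_white_noise_coordinate: "distr white_noise borel (\<lambda>g. g k) = std_normal_distribution"
proof -
  have "distr white_noise std_normal_distribution (\<lambda>g. g k) = std_normal_distribution"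
    using real_dist_normal_dist by (intro distr_PiM_component) (auto simp: real_distribution_def)
  then show ?thesis by (simp cong: distr_cong)
qed

lemma indep_vars_white_noise: "prob_space.indep_vars white_noise (\<lambda>_. borel) (\<lambda>k g. g k) UNIV"
proof -
  interpret prob_space white_noise by (rule prob_space_white_noise)
  show ?thesis
  proof (subst indep_vars_iff_distr_eq_PiM)
    have "distr white_noise (Pi\<^sub>M UNIV (\<lambda>_. borel)) (\<lambda>x. \<lambda>i\<in>UNIV. x i) = distr white_noise white_noise (\<lambda>x. x)"
      by (intro distr_cong sets_PiM_cong) auto
    also have "\<dots> = white_noise" by (rule distr_id)
    finally show "distr white_noise (Pi\<^sub>M UNIV (\<lambda>_. borel)) (\<lambda>x. \<lambda>i\<in>UNIV. x i)
        = (\<Pi>\<^sub>M i\<in>UNIV. distr white_noise borel (\<lambda>g. g i))"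
      by (simp only: distr_white_noise_coordinate)
  qed auto
qed

text \<open>Each \<open>\<xi> i\<close> combines finitely many independent standard normals with a
  Cholesky row as coefficients. For a linear combination of the \<open>\<xi> j\<close> the squared
  coefficients add up to the quadratic form of \<open>R\<close>.\<close>

theorem gaussian_sequence_exists:
  assumes R: "psd_kernel R"
  obtains \<xi> :: "nat \<Rightarrow> (nat \<Rightarrow> real) \<Rightarrow> real" where "\<And>i. \<xi> i \<in> borel_measurable white_noise"
    and "\<And>J t s. finite J \<Longrightarrow> char (distr white_noise borel (\<lambda>g. \<Sum>j\<in>J. t j * \<xi> j g)) s
        = exp (- (s\<^sup>2 * (\<Sum>i\<in>J. \<Sum>j\<in>J. t i * t j * R i j) / 2))"
proof -
  interpret prob_space white_noise by (rule prob_space_white_noise)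
  obtain a where a0: "\<And>i k. i < k \<Longrightarrow> a i k = 0"
    and a: "\<And>i j n. i < n \<Longrightarrow> (\<Sum>k<n. a i k * a j k) = R i j"
    by (rule cholesky_decomposition[OF R]) (rule that; assumption)
  define \<xi> where "\<xi> i g = (\<Sum>k\<le>i. a i k * g k)" for i and g :: "nat \<Rightarrow> real"
  have coord[measurable]: "(\<lambda>g. g k) \<in> borel_measurable white_noise" for k
    by measurable
  show ?thesis
  proof (rule that[of \<xi>])
    show "\<xi> i \<in> borel_measurable white_noise" for i unfolding \<xi>_def by measurable
    fix J :: "nat set" and t :: "nat \<Rightarrow> real" and s :: real assume J: "finite J"
    \<comment> \<open>One cut-off serves all indices in \<open>J\<close>: the rows vanish beyond the
      diagonal, so longer sums change nothing. For empty \<open>J\<close> the claim is vacuous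
      whatever \<open>Max\<close> returns.\<close>
    have N: "j < Suc (Max J)" if "j \<in> J" for j using J that by (simp add: less_Suc_eq_le)
    define N where "N = Suc (Max J)"
    note N = N[folded N_def]
    define c where "c k = (\<Sum>j\<in>J. t j * a j k)" for k
    have \<xi>N: "\<xi> j g = (\<Sum>k<N. a j k * g k)" if "j \<in> J" for j g
      unfolding \<xi>_def using N[OF that] a0 by (intro sum.mono_neutral_left) auto
    have lin: "(\<Sum>j\<in>J. t j * \<xi> j g) = (\<Sum>k<N. c k * g k)" for g
    proof -
      have "(\<Sum>j\<in>J. t j * \<xi> j g) = (\<Sum>j\<in>J. \<Sum>k<N. t j * a j k * g k)"
        by (rule sum.cong) (simp_all add: \<xi>N sum_distrib_left mult.assoc)
      also have "\<dots> = (\<Sum>k<N. \<Sum>j\<in>J. t j * a j k * g k)" by (rule sum.swap)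
      finally show ?thesis by (simp add: c_def sum_distrib_right)
    qed
    have csq: "(\<Sum>k<N. (c k)\<^sup>2) = (\<Sum>i\<in>J. \<Sum>j\<in>J. t i * t j * R i j)"
    proof -
      have "(\<Sum>k<N. (c k)\<^sup>2) = (\<Sum>k<N. \<Sum>i\<in>J. \<Sum>j\<in>J. t i * t j * (a i k * a j k))"
        unfolding c_def power2_eq_square sum_product by (simp add: mult_ac)
      also have "\<dots> = (\<Sum>i\<in>J. \<Sum>j\<in>J. \<Sum>k<N. t i * t j * (a i k * a j k))"
        by (subst sum.swap) (intro sum.cong refl sum.swap)
      also have "\<dots> = (\<Sum>i\<in>J. \<Sum>j\<in>J. t i * t j * R i j)"
        by (intro sum.cong refl) (simp add: sum_distrib_left[symmetric] a N)
      finally show ?thesis .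
    qed
    have ind: "indep_vars (\<lambda>_. borel) (\<lambda>k g. c k * g k) {..<N}"
      by (rule indep_vars_compose2[OF indep_vars_subset[OF indep_vars_white_noise]]) auto
    have chark: "char (distr white_noise borel (\<lambda>g. c k * g k)) s = exp (- ((c k * s)\<^sup>2 / 2))" for k
    proof -
      have "distr white_noise borel (\<lambda>g. c k * g k)
          = distr (distr white_noise borel (\<lambda>g. g k)) borel (\<lambda>x. c k * x)"
        by (subst distr_distr) (auto simp: comp_def)
      also have "\<dots> = distr std_normal_distribution borel (\<lambda>x. c k * x)"
        by (simp only: distr_white_noise_coordinate)
      finally have "distr white_noise borel (\<lambda>g. c k * g k) = distr std_normal_distribution borel (\<lambda>x. c k * x)" .
      then have "char (distr white_noise borel (\<lambda>g. c k * g k)) s = char std_normal_distribution (c k * s)"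
        unfolding char_def by (simp add: integral_distr mult_ac)
      then show ?thesis by (simp add: char_std_normal_distribution)
    qed
    have "char (distr white_noise borel (\<lambda>g. \<Sum>j\<in>J. t j * \<xi> j g)) s
        = (\<Prod>k<N. char (distr white_noise borel (\<lambda>g. c k * g k)) s)"
      unfolding lin by (rule char_distr_sum[OF ind])
    also have "\<dots> = (\<Prod>k<N. complex_of_real (exp (- ((c k * s)\<^sup>2 / 2))))" by (simp only: chark)
    also have "\<dots> = complex_of_real (exp (\<Sum>k<N. - ((c k * s)\<^sup>2 / 2)))"
      by (simp only: exp_sum[OF finite_lessThan] of_real_prod)
    also have "(\<Sum>k<N. - ((c k * s)\<^sup>2 / 2)) = - (s\<^sup>2 * (\<Sum>k<N. (c k)\<^sup>2) / 2)"
      by (simp add: sum_negf power_mult_distrib sum_distrib_left sum_divide_distrib mult.commute)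
    finally show "char (distr white_noise borel (\<lambda>g. \<Sum>j\<in>J. t j * \<xi> j g)) s
        = exp (- (s\<^sup>2 * (\<Sum>i\<in>J. \<Sum>j\<in>J. t i * t j * R i j) / 2))"
      unfolding csq by simp
  qed
qed

section \<open>Finite-dimensional convergence from characteristic functions\<close>

inductive trig_polynomial :: "nat set \<Rightarrow> ((nat \<Rightarrow> real) \<Rightarrow> real) \<Rightarrow> bool" for J where
  trig_cos: "trig_polynomial J (\<lambda>u. a * cos ((\<Sum>j\<in>J. t j * u j) + c))"
| trig_add: "trig_polynomial J f \<Longrightarrow> trig_polynomial J g \<Longrightarrow> trig_polynomial J (\<lambda>u. f u + g u)"

lemma trig_const: "trig_polynomial J (\<lambda>_. a)"
  using trig_cos[of J a "\<lambda>_. 0" 0] by simp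

text \<open>The free phase in the generator makes cosines enough: a sine is a cosine shifted by
  \<open>- (pi / 2)\<close>. Sines are what is later substituted into coordinate
  polynomials.\<close>

lemma trig_sin:
  assumes "finite J" "j \<in> J"
  shows "trig_polynomial J (\<lambda>u. sin (a * u j))"
proof -
  have "(\<Sum>i\<in>J. (if i = j then a else 0) * u i) = a * u j" for u :: "nat \<Rightarrow> real"
    using assms by (simp add: if_distrib[of "\<lambda>x. x * _"] cong: if_cong)
  then show ?thesis
    using trig_cos[of J 1 "\<lambda>i. if i = j then a else 0" "- (pi / 2)"] by (simp add: cos_diff)
qed

text \<open>The product-to-sum formula turns a product of two generators into two generators whose
  frequencies and phases are the sums and the differences.\<close>

lemma trig_mult:
  assumes f: "trig_polynomial J f" and g: "trig_polynomial J g"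
  shows "trig_polynomial J (\<lambda>u. f u * g u)"
  using f
proof (induction f)
  case (trig_cos a t c)
  show ?case using g
  proof (induction g)
    case (trig_cos b s d)
    have "a * cos ((\<Sum>j\<in>J. t j * u j) + c) * (b * cos ((\<Sum>j\<in>J. s j * u j) + d))
       = (a * b / 2) * cos ((\<Sum>j\<in>J. (t j + s j) * u j) + (c + d))
         + (a * b / 2) * cos ((\<Sum>j\<in>J. (t j - s j) * u j) + (c - d))" for u
    proof -
      have "(\<Sum>j\<in>J. (t j + s j) * u j) + (c + d) = ((\<Sum>j\<in>J. t j * u j) + c) + ((\<Sum>j\<in>J. s j * u j) + d)"
        "(\<Sum>j\<in>J. (t j - s j) * u j) + (c - d) = ((\<Sum>j\<in>J. t j * u j) + c) - ((\<Sum>j\<in>J. s j * u j) + d)"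
        by (simp_all add: algebra_simps sum.distrib sum_subtractf)
      then show ?thesis by (simp only: cos_add[of "_ + c"] cos_diff[of "_ + c"]) (simp add: algebra_simps)
    qed
    then show ?case by (simp only: trig_polynomial.intros)
  next
    case (trig_add f g)
    then show ?case by (simp only: distrib_left trig_polynomial.trig_add)
  qed
next
  case (trig_add f g)
  then show ?case by (simp only: distrib_right trig_polynomial.trig_add)
qed

lemma trig_bounded: "trig_polynomial J f \<Longrightarrow> \<exists>B. \<forall>u. \<bar>f u\<bar> \<le> B"
proof (induction rule: trig_polynomial.induct)
  case (trig_cos a t c)
  have "\<bar>a * cos x\<bar> \<le> \<bar>a\<bar>" for x by (simp add: abs_mult mult_left_le)
  then show ?case by blast
next
  case (trig_add f g)
  then show ?case by (metis abs_triangle_ineq add_mono order_trans)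
qed

lemma trig_measurable:
  assumes "trig_polynomial J f" and "\<And>j. (\<lambda>\<omega>. W \<omega> j) \<in> borel_measurable M"
  shows "(\<lambda>\<omega>. f (W \<omega>)) \<in> borel_measurable M"
  using assms(1) by induction (use assms(2) in measurable)

section \<open>Polynomial approximation on a compact cube\<close>

inductive coordinate_polynomial :: "nat set \<Rightarrow> ((nat \<Rightarrow> real) \<Rightarrow> real) \<Rightarrow> bool" for J where
  cp_const: "coordinate_polynomial J (\<lambda>_. c)"
| cp_coord: "j \<in> J \<Longrightarrow> coordinate_polynomial J (\<lambda>u. u j)"
| cp_add: "coordinate_polynomial J f \<Longrightarrow> coordinate_polynomial J g \<Longrightarrow> coordinate_polynomial J (\<lambda>u. f u + g u)"
| cp_mult: "coordinate_polynomial J f \<Longrightarrow> coordinate_polynomial J g \<Longrightarrow> coordinate_polynomial J (\<lambda>u. f u * g u)"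

lemma continuous_on_coordinate_polynomial:
  "coordinate_polynomial J f \<Longrightarrow> continuous_on S f"
proof (induction rule: coordinate_polynomial.induct)
  case (cp_coord j)
  show ?case by (rule continuous_on_subset[OF continuous_on_product_coordinates]) simp
qed (auto intro: continuous_intros)

text \<open>Coordinates outside \<open>J\<close> are pinned to 0 so that the coordinates in
  \<open>J\<close> alone separate points, as the Stone-Weierstrass theorem demands.\<close>

definition cube :: "nat set \<Rightarrow> (nat \<Rightarrow> real) set" where
  "cube J = {s. (\<forall>j\<in>J. \<bar>s j\<bar> \<le> 1) \<and> (\<forall>j. j \<notin> J \<longrightarrow> s j = 0)}"

lemma compact_cube: "compact (cube J)"
proof -
  have "cube J = (\<Pi>\<^sub>E j\<in>UNIV. if j \<in> J then {-1..1} else {0})"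
    by (auto simp: cube_def PiE_iff abs_le_iff minus_le_iff split: if_splits)
  moreover have "compactin (product_topology (\<lambda>_. euclidean) UNIV) (\<Pi>\<^sub>E j\<in>UNIV. if j \<in> J then {-1..1} else {0::real})"
    unfolding compactin_PiE by auto
  ultimately show ?thesis by (simp add: euclidean_product_topology)
qed

lemma cube_polynomial_approximation:
  assumes f: "continuous_on (cube J) f" and e: "e > 0"
  obtains p where "coordinate_polynomial J p" "\<And>s. s \<in> cube J \<Longrightarrow> \<bar>f s - p s\<bar> < e"
proof -
  interpret function_ring_on "Collect (coordinate_polynomial J)" "cube J"
  proof unfold_locales
    fix x y assume xy: "x \<in> cube J" "y \<in> cube J" "x \<noteq> y"
    then obtain j where "x j \<noteq> y j" by blast
    with xy have "j \<in> J" by (auto simp: cube_def)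
    with \<open>x j \<noteq> y j\<close> show "\<exists>f\<in>Collect (coordinate_polynomial J). f x \<noteq> f y"
      by (intro bexI[of _ "\<lambda>u. u j"]) (simp_all add: cp_coord)
  next
    show "compact (cube J)" by (rule compact_cube)
  next
    fix f g assume fg: "f \<in> Collect (coordinate_polynomial J)" "g \<in> Collect (coordinate_polynomial J)"
    show "(\<lambda>x. f x + g x) \<in> Collect (coordinate_polynomial J)"
      using fg unfolding mem_Collect_eq by (rule cp_add)
    show "(\<lambda>x. f x * g x) \<in> Collect (coordinate_polynomial J)"
      using fg unfolding mem_Collect_eq by (rule cp_mult)
  next
    show "(\<lambda>_. c) \<in> Collect (coordinate_polynomial J)" for c
      unfolding mem_Collect_eq by (rule cp_const)
  next
    show "continuous_on (cube J) f" if "f \<in> Collect (coordinate_polynomial J)" for f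
      using that unfolding mem_Collect_eq by (rule continuous_on_coordinate_polynomial)
  qed
  from Stone_Weierstrass_basic[OF f e] obtain p
    where "p \<in> Collect (coordinate_polynomial J)" "\<forall>s\<in>cube J. \<bar>f s - p s\<bar> < e" by (rule bexE)
  then show ?thesis using that[of p] by simp
qed

text \<open>
  Since \<open>arcsin\<close> inverts \<open>sin\<close> on the box of side \<open>2 r\<close>, a polynomial approximation
  of \<open>F \<circ> arcsin\<close> on the cube becomes, after substituting sines, a trigonometric polynomial that is
  close to \<open>F\<close> on the box and remains bounded outside it.
\<close>

lemma trig_approximation:
  fixes F :: "(nat \<Rightarrow> real) \<Rightarrow> real"
  assumes J: "finite J" and F: "continuous_on UNIV F" and B: "\<And>u. \<bar>F u\<bar> \<le> B"
    and dep: "\<forall>u v. (\<forall>j\<in>J. u j = v j) \<longrightarrow> F u = F v"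
    and r: "r > 0" and e: "e > 0"
  obtains p where "trig_polynomial J p"
    "\<And>u. (\<forall>j\<in>J. \<bar>u j\<bar> \<le> r) \<Longrightarrow> \<bar>F u - p u\<bar> \<le> e" "\<And>u. \<bar>F u - p u\<bar> \<le> 2 * B + e"
proof -
  \<comment> \<open>The factor \<open>2 * r / pi\<close> maps the range of \<open>arcsin\<close>
    onto the interval from \<open>- r\<close> to \<open>r\<close>. Coordinates outside
    \<open>J\<close> are fed 0, which \<open>dep\<close> makes harmless.\<close>
  define f where "f s = F (\<lambda>j. 2 * r / pi * arcsin (if j \<in> J then s j else 0))" for s
  define \<sigma> where "\<sigma> u j = (if j \<in> J then sin (pi / (2 * r) * u j) else 0)" for u :: "nat \<Rightarrow> real" and j
  have "continuous_on (cube J) (\<lambda>s j. 2 * r / pi * arcsin (if j \<in> J then s j else 0))"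
  proof (rule continuous_on_coordinatewise_then_product)
    fix j
    show "continuous_on (cube J) (\<lambda>s. 2 * r / pi * arcsin (if j \<in> J then s j else 0))"
    proof (cases "j \<in> J")
      case True
      have "continuous_on (cube J) (\<lambda>s. s j)"
        by (rule continuous_on_subset[OF continuous_on_product_coordinates]) simp
      then have "continuous_on (cube J) (\<lambda>s. arcsin (s j))"
        by (rule continuous_on_arcsin) (use True in \<open>auto simp: cube_def abs_le_iff minus_le_iff\<close>)
      then show ?thesis using True by (simp only: if_True continuous_on_mult_left)
    qed simp
  qed
  then have "continuous_on (cube J) f"
    unfolding f_def by (rule continuous_on_compose2[OF F]) simp
  then obtain q where q: "coordinate_polynomial J q" "\<And>s. s \<in> cube J \<Longrightarrow> \<bar>f s - q s\<bar> < e"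
    using cube_polynomial_approximation e by blast
  have \<sigma>: "\<sigma> u \<in> cube J" for u by (auto simp: \<sigma>_def cube_def)
  have f\<sigma>: "f (\<sigma> u) = F u" if u: "\<forall>j\<in>J. \<bar>u j\<bar> \<le> r" for u
    unfolding f_def
  proof (intro dep[rule_format])
    fix j assume j: "j \<in> J"
    have b: "\<bar>pi / (2 * r) * u j\<bar> \<le> pi / 2"
    proof -
      have "\<bar>pi / (2 * r) * u j\<bar> = pi / (2 * r) * \<bar>u j\<bar>" using r by (simp add: abs_mult)
      also have "\<dots> \<le> pi / (2 * r) * r" using u j r by (intro mult_left_mono) auto
      finally show ?thesis using r by simp
    qed
    then have "arcsin (sin (pi / (2 * r) * u j)) = pi / (2 * r) * u j"
      by (intro arcsin_sin) (simp_all only: abs_le_iff, linarith+)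
    then show "2 * r / pi * arcsin (if j \<in> J then \<sigma> u j else 0) = u j"
      using j r by (simp add: \<sigma>_def)
  qed
  have trig: "trig_polynomial J (\<lambda>u. q (\<sigma> u))"
    using q(1)
  proof induction
    case (cp_coord j)
    then show ?case using trig_sin[OF J cp_coord, of "pi / (2 * r)"] by (simp only: \<sigma>_def if_True)
  qed (auto intro: trig_const trig_add trig_mult)
  show ?thesis
  proof (rule that[OF trig])
    show "\<bar>F u - q (\<sigma> u)\<bar> \<le> e" if "\<forall>j\<in>J. \<bar>u j\<bar> \<le> r" for u
      using q(2)[OF \<sigma>, of u] f\<sigma>[OF that] by simp
    \<comment> \<open>Outside the box \<open>F u\<close> and \<open>f (\<sigma> u)\<close> are
      unrelated, but both are values of \<open>F\<close> and hence bounded by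
      \<open>B\<close>.\<close>
    show "\<bar>F u - q (\<sigma> u)\<bar> \<le> 2 * B + e" for u
    proof -
      have "\<bar>f (\<sigma> u)\<bar> \<le> B" unfolding f_def by (rule B)
      then show ?thesis using q(2)[OF \<sigma>, of u] B[of u] by linarith
    qed
  qed
qed

lemma borel_measurable_continuous_coordinates:
  fixes F :: "(nat \<Rightarrow> real) \<Rightarrow> real"
  assumes F: "continuous_on UNIV F" and W: "\<And>j. (\<lambda>\<omega>. W \<omega> j) \<in> borel_measurable M"
  shows "(\<lambda>\<omega>. F (W \<omega>)) \<in> borel_measurable M"
  by (rule measurable_compose[OF measurable_coordinatewise_then_product[of "\<lambda>\<omega>. W \<omega>" M, OF W]
      borel_measurable_continuous_onI[OF F]])

text \<open>Expectations of trigonometric polynomials converge by the cosine hypothesis. Tightness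
  confines all the laws to one box up to mass \<open>e\<close>; there such a polynomial is close to
  \<open>F\<close>, and outside the bound \<open>2 * B + e\<close> is paid only on that
  mass.\<close>

theorem finite_dimensional_convergence:
  fixes F :: "(nat \<Rightarrow> real) \<Rightarrow> real" and W :: "nat \<Rightarrow> 'm \<Rightarrow> nat \<Rightarrow> real" and V :: "'v \<Rightarrow> nat \<Rightarrow> real"
  assumes M: "prob_space M" and N: "prob_space N" and J: "finite J"
    and W: "\<And>n j. (\<lambda>\<omega>. W n \<omega> j) \<in> borel_measurable M" and V: "\<And>j. (\<lambda>\<omega>. V \<omega> j) \<in> borel_measurable N"
    and cos: "\<And>t c. (\<lambda>n. \<integral>\<omega>. cos ((\<Sum>j\<in>J. t j * W n \<omega> j) + c) \<partial>M)
        \<longlonglongrightarrow> (\<integral>\<omega>. cos ((\<Sum>j\<in>J. t j * V \<omega> j) + c) \<partial>N)"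
    and tight: "\<And>e. e > 0 \<Longrightarrow> \<exists>r. \<forall>n. measure M {\<omega> \<in> space M. \<exists>j\<in>J. r < \<bar>W n \<omega> j\<bar>} \<le> e"
    and F: "continuous_on UNIV F" and B: "\<And>u. \<bar>F u\<bar> \<le> B"
    and dep: "\<forall>u v. (\<forall>j\<in>J. u j = v j) \<longrightarrow> F u = F v"
  shows "(\<lambda>n. \<integral>\<omega>. F (W n \<omega>) \<partial>M) \<longlonglongrightarrow> (\<integral>\<omega>. F (V \<omega>) \<partial>N)"
proof -
  interpret M: prob_space M by (rule M)
  interpret N: prob_space N by (rule N)
  note [measurable] = W V
  have B0: "0 \<le> B" using B[of undefined] abs_ge_zero order_trans by blast
  \<comment> \<open>For a single law no uniformity is at stake, and continuity from above provides
    the box.\<close>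
  have tightV: "\<exists>r. measure N {\<omega> \<in> space N. \<exists>j\<in>J. r < \<bar>V \<omega> j\<bar>} \<le> e" if e: "e > 0" for e
  proof -
    define A where "A m = {\<omega> \<in> space N. \<exists>j\<in>J. real m < \<bar>V \<omega> j\<bar>}" for m
    have A: "A m \<in> sets N" for m unfolding A_def using J by measurable
    have "(\<lambda>m. measure N (A m)) \<longlonglongrightarrow> measure N (\<Inter>m. A m)"
      by (rule N.finite_Lim_measure_decseq) (use A in \<open>force simp: A_def decseq_def\<close>)+
    moreover have "(\<Inter>m. A m) = {}"
    proof -
      have "\<exists>m. \<omega> \<notin> A m" for \<omega>
      proof -
        obtain m where m: "(\<Sum>j\<in>J. \<bar>V \<omega> j\<bar>) \<le> real m" using real_arch_simple by blast
        have "\<bar>V \<omega> j\<bar> \<le> real m" if "j \<in> J" for j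
          using member_le_sum[OF that, of "\<lambda>j. \<bar>V \<omega> j\<bar>"] J m by auto
        then show ?thesis by (intro exI[of _ m]) (auto simp: A_def not_less)
      qed
      then show ?thesis by blast
    qed
    ultimately have "(\<lambda>m. measure N (A m)) \<longlonglongrightarrow> 0" by simp
    then have "\<forall>\<^sub>F m in sequentially. measure N (A m) < e" using e by (rule order_tendstoD)
    then obtain m where "measure N (A m) < e" by (meson eventually_sequentially order_refl)
    then show ?thesis unfolding A_def by (intro exI[of _ "real m"]) simp
  qed
  have trig: "(\<lambda>n. \<integral>\<omega>. p (W n \<omega>) \<partial>M) \<longlonglongrightarrow> (\<integral>\<omega>. p (V \<omega>) \<partial>N)" if "trig_polynomial J p" for p
    using that
  proof induction
    case (trig_cos a t c)
    show ?case using tendsto_mult_left[OF cos[of t c], of a] by simp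
  next
    case (trig_add f g)
    have intM: "integrable M (\<lambda>\<omega>. h (W n \<omega>))" and intN: "integrable N (\<lambda>\<omega>. h (V \<omega>))"
      if h: "trig_polynomial J h" for h n
    proof -
      obtain C where C: "\<And>u. \<bar>h u\<bar> \<le> C" using trig_bounded[OF h] by blast
      show "integrable M (\<lambda>\<omega>. h (W n \<omega>))"
        by (rule M.integrable_const_bound[of _ C]) (use C trig_measurable[OF h W] in auto)
      show "integrable N (\<lambda>\<omega>. h (V \<omega>))"
        by (rule N.integrable_const_bound[of _ C]) (use C trig_measurable[OF h V] in auto)
    qed
    show ?case
      using tendsto_add[OF trig_add.IH] trig_add.hyps by (simp add: intM intN)
  qed
  show ?thesis
  proof (rule tendstoI)
    fix \<epsilon> :: real assume \<epsilon>: "\<epsilon> > 0"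
    \<comment> \<open>The three errors add up to \<open>3 * e + 4 * B * e\<close>, which stays below
      \<open>6 * (B + 1) * e = \<epsilon>\<close>.\<close>
    define e where "e = \<epsilon> / (6 * (B + 1))"
    have e: "e > 0" using \<epsilon> B0 by (simp add: e_def)
    obtain r1 where r1: "\<And>n. measure M {\<omega> \<in> space M. \<exists>j\<in>J. r1 < \<bar>W n \<omega> j\<bar>} \<le> e"
      using tight[OF e] by blast
    obtain r2 where r2: "measure N {\<omega> \<in> space N. \<exists>j\<in>J. r2 < \<bar>V \<omega> j\<bar>} \<le> e"
      using tightV[OF e] by blast
    define r where "r = max 1 (max r1 r2)"
    have r: "r > 0" by (simp add: r_def)
    obtain p where p: "trig_polynomial J p"
      "\<And>u. (\<forall>j\<in>J. \<bar>u j\<bar> \<le> r) \<Longrightarrow> \<bar>F u - p u\<bar> \<le> e" "\<And>u. \<bar>F u - p u\<bar> \<le> 2 * B + e"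
      by (rule trig_approximation[OF J F B dep r e]) (rule that; assumption)
    have close: "\<bar>(\<integral>\<omega>. F (U \<omega>) \<partial>P) - (\<integral>\<omega>. p (U \<omega>) \<partial>P)\<bar> \<le> e + 2 * B * e"
      if P: "prob_space P" and U: "\<And>j. (\<lambda>\<omega>. U \<omega> j) \<in> borel_measurable P"
        and tail: "measure P {\<omega> \<in> space P. \<exists>j\<in>J. r' < \<bar>U \<omega> j\<bar>} \<le> e" and r': "r' \<le> r"
      for P and U :: "'x \<Rightarrow> nat \<Rightarrow> real" and r'
    proof -
      interpret P: prob_space P by (rule P)
      define A where "A = {\<omega> \<in> space P. \<exists>j\<in>J. r' < \<bar>U \<omega> j\<bar>}"
      have A: "A \<in> sets P" unfolding A_def using J U by measurable
      have iA: "integrable P (\<lambda>\<omega>. 2 * B * indicat_real A \<omega>)"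
        by (intro Bochner_Integration.integrable_mult_right integrable_real_indicator A)
           (simp add: P.emeasure_eq_measure)
      have iF: "integrable P (\<lambda>\<omega>. F (U \<omega>))"
        by (rule P.integrable_const_bound[of _ B])
           (use B borel_measurable_continuous_coordinates[OF F U] in auto)
      obtain C where C: "\<And>u. \<bar>p u\<bar> \<le> C" using trig_bounded[OF p(1)] by blast
      have ip: "integrable P (\<lambda>\<omega>. p (U \<omega>))"
        by (rule P.integrable_const_bound[of _ C]) (use C trig_measurable[OF p(1) U] in auto)
      have "norm (\<integral>\<omega>. F (U \<omega>) - p (U \<omega>) \<partial>P) \<le> (\<integral>\<omega>. e + 2 * B * indicator A \<omega> \<partial>P)"
      proof (rule norm_integral_le_integral)
        show "integrable P (\<lambda>\<omega>. F (U \<omega>) - p (U \<omega>))" using iF ip by simp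
        show "integrable P (\<lambda>\<omega>. e + 2 * B * indicator A \<omega>)" using iA by simp
        fix \<omega> assume \<omega>: "\<omega> \<in> space P"
        show "norm (F (U \<omega>) - p (U \<omega>)) \<le> e + 2 * B * indicator A \<omega>"
        proof (cases "\<omega> \<in> A")
          case True then show ?thesis using p(3)[of "U \<omega>"] by simp
        next
          case False
          then have "\<forall>j\<in>J. \<bar>U \<omega> j\<bar> \<le> r" using \<omega> r' by (force simp: A_def not_less)
          then show ?thesis using p(2)[of "U \<omega>"] False by simp
        qed
      qed
      also have "\<dots> = e + 2 * B * measure P A"
        using iA A P.prob_space by simp
      also have "\<dots> \<le> e + 2 * B * e"
        using tail B0 by (intro add_left_mono mult_left_mono) (auto simp: A_def)
      finally show ?thesis using iF ip by simp
    qed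
    have 1: "\<bar>(\<integral>\<omega>. F (W n \<omega>) \<partial>M) - (\<integral>\<omega>. p (W n \<omega>) \<partial>M)\<bar> \<le> e + 2 * B * e" for n
      by (rule close[OF M W r1]) (simp add: r_def)
    have 2: "\<bar>(\<integral>\<omega>. F (V \<omega>) \<partial>N) - (\<integral>\<omega>. p (V \<omega>) \<partial>N)\<bar> \<le> e + 2 * B * e"
      by (rule close[OF N V r2]) (simp add: r_def)
    have 3: "2 * (e + 2 * B * e) + e < \<epsilon>"
    proof -
      have "6 * (B + 1) * e = \<epsilon>" using B0 by (simp add: e_def)
      moreover have "0 \<le> B * e" using e B0 by simp
      ultimately show ?thesis using e by (simp add: algebra_simps)
    qed
    from tendstoD[OF trig[OF p(1)] e]
    show "\<forall>\<^sub>F n in sequentially. dist (\<integral>\<omega>. F (W n \<omega>) \<partial>M) (\<integral>\<omega>. F (V \<omega>) \<partial>N) < \<epsilon>"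
    proof eventually_elim
      case (elim n)
      have *: "\<bar>a - d\<bar> < \<epsilon>" if "\<bar>a - b\<bar> \<le> x" "\<bar>b - c\<bar> < e" "\<bar>d - c\<bar> \<le> x" "2 * x + e < \<epsilon>"
        for a b c d x :: real
        using that by linarith
      show ?case unfolding dist_real_def
        by (rule *[OF 1 elim[unfolded dist_real_def] 2 3])
    qed
  qed
qed

section \<open>The central limit theorem for finitely many bounded functionals\<close>

text \<open>A positive variance is reached by scaling the standard normal law by
  \<open>sqrt v\<close>; variance 0 is the point mass at 0, whose characteristic function is
  constantly 1.\<close>

lemma char_real_gaussian:
  assumes v: "0 \<le> v"
  shows "real_distribution (real_gaussian 0 v)"
    and "char (real_gaussian 0 v) s = exp (- (s\<^sup>2 * v / 2))"
proof -
  have "real_distribution (real_gaussian 0 v) \<and> char (real_gaussian 0 v) s = exp (- (s\<^sup>2 * v / 2))"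
  proof (cases "v = 0")
    case True
    have "real_distribution (return borel (0::real))"
      by (auto simp: real_distribution_def real_distribution_axioms_def intro!: prob_space_return)
    then show ?thesis using True
      by (simp add: real_gaussian_def char_def integral_return)
  next
    case False
    then have pos: "0 < sqrt v" using v by simp
    interpret S: prob_space std_normal_distribution
      using real_dist_normal_dist by (simp add: real_distribution_def)
    have "distributed std_normal_distribution lborel (\<lambda>x. x) std_normal_density"
      by (simp add: distributed_def distr_id2)
    from S.normal_density_affine[OF this, of "sqrt v" 0]
    have "distributed std_normal_distribution lborel (\<lambda>x. sqrt v * x) (normal_density 0 (sqrt v))"
      using pos by simp
    then have "distr std_normal_distribution lborel (\<lambda>x. sqrt v * x) = density lborel (normal_density 0 (sqrt v))"
      by (simp add: distributed_def)
    moreover have "distr std_normal_distribution lborel (\<lambda>x. sqrt v * x) = distr std_normal_distribution borel (\<lambda>x. sqrt v * x)"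
      by (rule distr_cong) auto
    ultimately have eq: "real_gaussian 0 v = distr std_normal_distribution borel (\<lambda>x. sqrt v * x)"
      using False by (simp add: real_gaussian_def)
    have "char (real_gaussian 0 v) s = char std_normal_distribution (s * sqrt v)"
      unfolding eq char_def by (simp add: integral_distr mult_ac)
    also have "\<dots> = exp (- (s\<^sup>2 * v / 2))"
      using v by (simp add: char_std_normal_distribution power_mult_distrib)
    finally show ?thesis unfolding eq by (auto intro!: S.real_distribution_distr)
  qed
  then show "real_distribution (real_gaussian 0 v)"
    and "char (real_gaussian 0 v) s = exp (- (s\<^sup>2 * v / 2))" by blast+
qed

lemma char_distr_eq:
  assumes "Y \<in> borel_measurable M"
  shows "char (distr M borel Y) s = (CLINT \<omega>|M. iexp (s * Y \<omega>))"
  unfolding char_def using assms by (subst integral_distr) auto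

text \<open>Cosines with a phase are real parts of rotated complex exponentials. Frequency 1 is
  enough because the coefficients of a linear combination already sit in \<open>Y\<close>.\<close>

lemma (in prob_space) expectation_cos_shift:
  assumes Y: "Y \<in> borel_measurable M"
  shows "expectation (\<lambda>\<omega>. cos (Y \<omega> + c)) = Re (cis c * char (distr M borel Y) 1)"
proof -
  have int: "integrable M (\<lambda>\<omega>. iexp (1 * Y \<omega>))"
    by (rule integrable_const_bound[of _ 1]) (use Y in auto)
  have "Re (cis c * char (distr M borel Y) 1) = Re (CLINT \<omega>|M. cis c * iexp (1 * Y \<omega>))"
    unfolding char_distr_eq[OF Y] by simp
  also have "\<dots> = expectation (\<lambda>\<omega>. Re (cis c * iexp (1 * Y \<omega>)))"
    by (rule integral_Re[symmetric]) (rule integrable_mult_right[OF int])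
  also have "\<dots> = expectation (\<lambda>\<omega>. cos (Y \<omega> + c))"
    by (simp only: cis_conv_exp[symmetric] cis_mult mult_1 cis.sel add.commute)
  finally show ?thesis by simp
qed

section \<open>Limits of bounded centred functions of the sample\<close>

context iid_sample
begin

text \<open>The classical theorem normalises by the standard deviation, so variance 0 is treated
  apart: the summands then vanish almost surely and every characteristic function is 1.\<close>

lemma bounded_clt_char:
  fixes \<eta> :: "'a \<Rightarrow> real"
  assumes \<eta>[measurable]: "\<eta> \<in> borel_measurable borel" and B: "\<And>y. \<bar>\<eta> y\<bar> \<le> B" and mean: "(\<integral>y. \<eta> y \<partial>\<mu>) = 0"
  shows "(\<lambda>n. char (distr M borel (\<lambda>\<omega>. (\<Sum>i<n. \<eta> (X i \<omega>)) / sqrt (real n))) s)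
    \<longlonglongrightarrow> exp (- (s\<^sup>2 * (\<integral>y. (\<eta> y)\<^sup>2 \<partial>\<mu>) / 2))"
proof -
  define v where "v = (\<integral>y. (\<eta> y)\<^sup>2 \<partial>\<mu>)"
  have B2: "(\<eta> y)\<^sup>2 \<le> B\<^sup>2" for y using B[of y] by (metis abs_ge_zero power2_abs power_mono)
  have \<eta>': "\<eta> \<in> borel_measurable \<mu>" using \<eta> by (simp cong: measurable_cong_sets)
  have int2: "integrable \<mu> (\<lambda>y. (\<eta> y)\<^sup>2)"
    by (rule law.integrable_const_bound[of _ "B\<^sup>2"]) (use B2 \<eta>' in auto)
  have v0: "0 \<le> v" unfolding v_def by simp
  define S where "S n \<omega> = (\<Sum>i<n. \<eta> (X i \<omega>))" for n \<omega>
  have S[measurable]: "S n \<in> borel_measurable M" for n unfolding S_def by measurable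
  have "(\<lambda>n. char (distr M borel (\<lambda>\<omega>. S n \<omega> / sqrt (real n))) s) \<longlonglongrightarrow> exp (- (s\<^sup>2 * v / 2))"
  proof (cases "v = 0")
    case True
    have "AE y in \<mu>. (\<eta> y)\<^sup>2 = 0"
      using integral_nonneg_eq_0_iff_AE[OF int2] True by (simp add: v_def)
    then have "AE y in \<mu>. \<eta> y = 0" by simp
    then have "AE y in distr M borel (X i). \<eta> y = 0" for i unfolding distr_X .
    then have "AE \<omega> in M. \<eta> (X i \<omega>) = 0" for i by (subst (asm) AE_distr_iff) auto
    then have "AE \<omega> in M. \<forall>i. \<eta> (X i \<omega>) = 0" by (simp add: AE_all_countable)
    then have AE0: "AE \<omega> in M. S n \<omega> / sqrt (real n) = 0" for n
      by eventually_elim (simp add: S_def)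
    have AE1: "AE \<omega> in M. iexp (s * (S n \<omega> / sqrt (real n))) = 1" for n
      by (rule eventually_mono[OF AE0[of n]]) (simp only: mult_zero_right of_real_0 exp_zero)
    have "char (distr M borel (\<lambda>\<omega>. S n \<omega> / sqrt (real n))) s = (CLINT \<omega>|M. 1)" for n
    proof -
      have "char (distr M borel (\<lambda>\<omega>. S n \<omega> / sqrt (real n))) s = (CLINT \<omega>|M. iexp (s * (S n \<omega> / sqrt (real n))))"
        by (rule char_distr_eq) simp
      also have "\<dots> = (CLINT \<omega>|M. 1)"
        by (rule integral_cong_AE[OF _ _ AE1]) measurable
      finally show ?thesis .
    qed
    then show ?thesis using True by (simp add: prob_space)
  next
    case False
    with v0 have v: "v > 0" by simp
    define \<sigma> where "\<sigma> = sqrt v"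
    have \<sigma>: "\<sigma> > 0" "\<sigma>\<^sup>2 = v" using v by (simp_all add: \<sigma>_def)
    have "weak_conv_m (\<lambda>n. distr M borel (\<lambda>\<omega>. (\<Sum>i<n. \<eta> (X i \<omega>)) / sqrt (real n * \<sigma>\<^sup>2))) std_normal_distribution"
    proof (rule central_limit_theorem_zero_mean)
      show "indep_vars (\<lambda>i. borel) (\<lambda>i \<omega>. \<eta> (X i \<omega>)) UNIV" by (rule indep_vars_comp[OF \<eta>])
      show mean0: "expectation (\<lambda>\<omega>. \<eta> (X n \<omega>)) = 0" for n using integral_X[OF \<eta>] mean by simp
      show "integrable M (\<lambda>\<omega>. (\<eta> (X n \<omega>))\<^sup>2)" for n
        by (rule integrable_const_bound[of _ "B\<^sup>2"]) (use B2 in auto)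
      have "expectation (\<lambda>\<omega>. (\<eta> (X n \<omega>))\<^sup>2) = v" for n
        unfolding v_def by (rule integral_X) simp
      then show "variance (\<lambda>\<omega>. \<eta> (X n \<omega>)) = \<sigma>\<^sup>2" for n unfolding mean0 \<sigma> by simp
      show "distr M borel (\<lambda>\<omega>. \<eta> (X n \<omega>)) = distr \<mu> borel \<eta>" for n
        unfolding distr_X[of n, symmetric] by (subst distr_distr) (auto simp: comp_def)
    qed (rule \<sigma>)
    \<comment> \<open>Evaluation at \<open>s * \<sigma>\<close> undoes the division by the standard
      deviation.\<close>
    then have "(\<lambda>n. char (distr M borel (\<lambda>\<omega>. S n \<omega> / sqrt (real n * \<sigma>\<^sup>2))) (s * \<sigma>))
        \<longlonglongrightarrow> char std_normal_distribution (s * \<sigma>)"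
      unfolding S_def by (intro levy_continuity1 real_dist_normal_dist real_distribution_distr) auto
    moreover have "char (distr M borel (\<lambda>\<omega>. S n \<omega> / sqrt (real n * \<sigma>\<^sup>2))) (s * \<sigma>)
        = char (distr M borel (\<lambda>\<omega>. S n \<omega> / sqrt (real n))) s" for n
    proof -
      have "s * \<sigma> * (S n \<omega> / sqrt (real n * \<sigma>\<^sup>2)) = s * (S n \<omega> / sqrt (real n))" for \<omega>
        using \<sigma>(1) by (simp add: real_sqrt_mult)
      then show ?thesis by (simp add: char_distr_eq)
    qed
    moreover have "char std_normal_distribution (s * \<sigma>) = exp (- (s\<^sup>2 * v / 2))"
      by (simp add: char_std_normal_distribution power_mult_distrib \<sigma>)
    ultimately show ?thesis by simp
  qed
  then show ?thesis by (simp add: S_def v_def)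
qed

definition normalized_sum :: "(nat \<Rightarrow> 'a \<Rightarrow> real) \<Rightarrow> nat \<Rightarrow> 'w \<Rightarrow> nat \<Rightarrow> real" where
  "normalized_sum \<phi> n \<omega> j = (\<Sum>i<n. \<phi> j (X i \<omega>)) / sqrt (real n)"

context
  fixes \<phi> :: "nat \<Rightarrow> 'a \<Rightarrow> real"
  assumes \<phi>: "\<And>j. \<phi> j \<in> borel_measurable borel" and \<phi>1: "\<And>j y. \<bar>\<phi> j y\<bar> \<le> 1"
    and mean: "\<And>j. (\<integral>y. \<phi> j y \<partial>\<mu>) = 0"
begin

lemma measurable_law: "\<phi> j \<in> borel_measurable \<mu>"
  using \<phi> by (simp cong: measurable_cong_sets)

lemma integrable_product: "integrable \<mu> (\<lambda>y. \<phi> i y * \<phi> j y)"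
proof (rule law.integrable_const_bound[of _ 1])
  show "AE y in \<mu>. norm (\<phi> i y * \<phi> j y) \<le> 1"
    using \<phi>1 by (auto simp: abs_mult intro!: mult_le_one)
qed (use measurable_law in auto)

lemma integrable_phi: "integrable \<mu> (\<phi> j)"
  by (rule law.integrable_const_bound[of _ 1]) (use \<phi>1 measurable_law in auto)

lemma integral_square_sum:
  assumes "finite J"
  shows "(\<integral>y. (\<Sum>j\<in>J. t j * \<phi> j y)\<^sup>2 \<partial>\<mu>) = (\<Sum>i\<in>J. \<Sum>j\<in>J. t i * t j * (\<integral>y. \<phi> i y * \<phi> j y \<partial>\<mu>))"
proof -
  have "(\<Sum>j\<in>J. t j * \<phi> j y)\<^sup>2 = (\<Sum>i\<in>J. \<Sum>j\<in>J. t i * t j * (\<phi> i y * \<phi> j y))" for y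
    unfolding power2_eq_square sum_product by (simp add: mult_ac)
  then show ?thesis
    by (simp add: Bochner_Integration.integral_sum integrable_product)
qed

lemma psd_covariance: "psd_kernel (\<lambda>i j. \<integral>y. \<phi> i y * \<phi> j y \<partial>\<mu>)"
  unfolding psd_kernel_def
proof (intro conjI allI impI)
  show "(\<integral>y. \<phi> i y * \<phi> j y \<partial>\<mu>) = (\<integral>y. \<phi> j y * \<phi> i y \<partial>\<mu>)" for i j by (simp add: mult.commute)
  show "0 \<le> (\<Sum>i\<in>I. \<Sum>j\<in>I. t i * t j * (\<integral>y. \<phi> i y * \<phi> j y \<partial>\<mu>))" if "finite I" for I t
    unfolding integral_square_sum[OF that, symmetric] by simp
qed

lemma normalized_sum_measurable: "(\<lambda>\<omega>. normalized_sum \<phi> n \<omega> j) \<in> borel_measurable M"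
  unfolding normalized_sum_def using \<phi> by measurable

text \<open>Hoeffding's bound at deviation \<open>r * sqrt n\<close> does not involve
  \<open>n\<close>, and a union bound over the finite set \<open>J\<close> completes the tail
  estimate.\<close>

lemma normalized_sum_tight:
  assumes J: "finite J" and e: "e > 0"
  shows "\<exists>r. \<forall>n. measure M {\<omega> \<in> space M. \<exists>j\<in>J. r < \<bar>normalized_sum \<phi> n \<omega> j\<bar>} \<le> e"
proof -
  have "((\<lambda>r::real. real (card J) * (2 * exp (- (r\<^sup>2 / 2)))) \<longlongrightarrow> 0) at_top"
    by real_asymp
  then have "\<forall>\<^sub>F r in at_top. real (card J) * (2 * exp (- (r\<^sup>2 / 2))) < e \<and> r > 0"
    using e by (intro eventually_conj order_tendstoD(2) eventually_gt_at_top)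
  then obtain r where r: "real (card J) * (2 * exp (- (r\<^sup>2 / 2))) < e" "r > (0::real)"
    by (metis (mono_tags, lifting) eventually_happens trivial_limit_at_top_linorder)
  have "measure M {\<omega> \<in> space M. \<exists>j\<in>J. r < \<bar>normalized_sum \<phi> n \<omega> j\<bar>} \<le> e" for n
  proof (cases "n = 0")
    case True
    then show ?thesis using r e by (simp add: normalized_sum_def)
  next
    case False
    note [measurable] = normalized_sum_measurable
    define A where "A j = {\<omega> \<in> space M. r < \<bar>normalized_sum \<phi> n \<omega> j\<bar>}" for j
    have A: "A j \<in> events" for j unfolding A_def by measurable
    have "measure M (A j) \<le> 2 * exp (- (r\<^sup>2 / 2))" for j
    proof -
      have sq: "sqrt (real n) > 0" using False by simp
      have "measure M (A j) \<le> prob {\<omega> \<in> space M. r * sqrt (real n) \<le> \<bar>(\<Sum>i<n. \<phi> j (X i \<omega>)) - real n * (\<integral>y. \<phi> j y \<partial>\<mu>)\<bar>}"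
      proof (rule finite_measure_mono)
        show "A j \<subseteq> {\<omega> \<in> space M. r * sqrt (real n) \<le> \<bar>(\<Sum>i<n. \<phi> j (X i \<omega>)) - real n * (\<integral>y. \<phi> j y \<partial>\<mu>)\<bar>}"
          using sq by (auto simp: A_def normalized_sum_def mean abs_divide pos_less_divide_eq)
        show "{\<omega> \<in> space M. r * sqrt (real n) \<le> \<bar>(\<Sum>i<n. \<phi> j (X i \<omega>)) - real n * (\<integral>y. \<phi> j y \<partial>\<mu>)\<bar>} \<in> events"
          using \<phi> by measurable
      qed
      also have "\<dots> \<le> 2 * exp (- ((r * sqrt (real n))\<^sup>2 / (2 * real n * 1\<^sup>2)))"
        by (rule sample_Hoeffding[OF \<phi> _ \<phi>1]) (use False r in auto)
      also have "(r * sqrt (real n))\<^sup>2 / (2 * real n * 1\<^sup>2) = r\<^sup>2 / 2"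
        using False by (simp add: power_mult_distrib)
      finally show ?thesis .
    qed
    then have "(\<Sum>j\<in>J. measure M (A j)) \<le> real (card J) * (2 * exp (- (r\<^sup>2 / 2)))"
      by (rule sum_bounded_above)
    moreover have "measure M (\<Union>j\<in>J. A j) \<le> (\<Sum>j\<in>J. measure M (A j))"
      by (rule finite_measure_subadditive_finite[OF J]) (use A in auto)
    moreover have "{\<omega> \<in> space M. \<exists>j\<in>J. r < \<bar>normalized_sum \<phi> n \<omega> j\<bar>} = (\<Union>j\<in>J. A j)"
      by (auto simp: A_def)
    ultimately show ?thesis using r by simp
  qed
  then show ?thesis by blast
qed

text \<open>This is the Cramer-Wold device: a linear combination of normalised sums is the
  normalised sum of one bounded centred function \<open>\<eta>\<close>, so the one-dimensional
  theorem identifies its limit with the law of the same combination of the Gaussian sequence. One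
  sequence \<open>\<xi>\<close> serves every finite \<open>J\<close> at once.\<close>

theorem normalized_sum_fd_convergence:
  obtains \<xi> :: "nat \<Rightarrow> (nat \<Rightarrow> real) \<Rightarrow> real" where "\<And>j. \<xi> j \<in> borel_measurable white_noise"
    and "\<And>J t s. finite J \<Longrightarrow> char (distr white_noise borel (\<lambda>g. \<Sum>j\<in>J. t j * \<xi> j g)) s
        = exp (- (s\<^sup>2 * (\<integral>y. (\<Sum>j\<in>J. t j * \<phi> j y)\<^sup>2 \<partial>\<mu>) / 2))"
    and "\<And>J (F :: (nat \<Rightarrow> real) \<Rightarrow> real) B. finite J \<Longrightarrow> continuous_on UNIV F \<Longrightarrow> \<forall>u. \<bar>F u\<bar> \<le> B \<Longrightarrow>
      \<forall>u v. (\<forall>j\<in>J. u j = v j) \<longrightarrow> F u = F v \<Longrightarrow>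
      (\<lambda>n. \<integral>\<omega>. F (normalized_sum \<phi> n \<omega>) \<partial>M) \<longlonglongrightarrow> (\<integral>g. F (\<lambda>j. \<xi> j g) \<partial>white_noise)"
proof -
  interpret N: prob_space white_noise by (rule prob_space_white_noise)
  obtain \<xi> where \<xi>[measurable]: "\<And>j. \<xi> j \<in> borel_measurable white_noise"
    and ch: "\<And>J t s. finite J \<Longrightarrow> char (distr white_noise borel (\<lambda>g. \<Sum>j\<in>J. t j * \<xi> j g)) s
        = exp (- (s\<^sup>2 * (\<Sum>i\<in>J. \<Sum>j\<in>J. t i * t j * (\<integral>y. \<phi> i y * \<phi> j y \<partial>\<mu>)) / 2))"
    by (rule gaussian_sequence_exists[OF psd_covariance]) (rule that; assumption)
  have ch': "char (distr white_noise borel (\<lambda>g. \<Sum>j\<in>J. t j * \<xi> j g)) s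
        = exp (- (s\<^sup>2 * (\<integral>y. (\<Sum>j\<in>J. t j * \<phi> j y)\<^sup>2 \<partial>\<mu>) / 2))" if "finite J" for J t s
    using ch[OF that] integral_square_sum[OF that] by simp
  show ?thesis
  proof (rule that[OF \<xi> ch'])
    fix J :: "nat set" and F :: "(nat \<Rightarrow> real) \<Rightarrow> real" and B
    assume J: "finite J" and F: "continuous_on UNIV F" "\<forall>u. \<bar>F u\<bar> \<le> B"
      and dep: "\<forall>u v. (\<forall>j\<in>J. u j = v j) \<longrightarrow> F u = F v"
    have cosc: "(\<lambda>n. \<integral>\<omega>. cos ((\<Sum>j\<in>J. t j * normalized_sum \<phi> n \<omega> j) + c) \<partial>M)
          \<longlonglongrightarrow> (\<integral>g. cos ((\<Sum>j\<in>J. t j * \<xi> j g) + c) \<partial>white_noise)" for t c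
    proof -
      define \<eta> where "\<eta> y = (\<Sum>j\<in>J. t j * \<phi> j y)" for y
      have \<eta>m: "\<eta> \<in> borel_measurable borel" unfolding \<eta>_def using \<phi> by measurable
      have lin: "(\<Sum>j\<in>J. t j * normalized_sum \<phi> n \<omega> j) = (\<Sum>i<n. \<eta> (X i \<omega>)) / sqrt (real n)" for n \<omega>
      proof -
        have "(\<Sum>i<n. \<eta> (X i \<omega>)) = (\<Sum>j\<in>J. t j * (\<Sum>i<n. \<phi> j (X i \<omega>)))"
          unfolding \<eta>_def by (subst sum.swap) (simp add: sum_distrib_left)
        then show ?thesis
          unfolding normalized_sum_def times_divide_eq_right sum_divide_distrib[symmetric] by simp
      qed
      have \<eta>b: "\<bar>\<eta> y\<bar> \<le> (\<Sum>j\<in>J. \<bar>t j\<bar>)" for y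
      proof -
        have "\<bar>\<eta> y\<bar> \<le> (\<Sum>j\<in>J. \<bar>t j * \<phi> j y\<bar>)" unfolding \<eta>_def by (rule sum_abs)
        also have "\<dots> \<le> (\<Sum>j\<in>J. \<bar>t j\<bar>)"
          using \<phi>1 by (intro sum_mono) (simp add: abs_mult mult_left_le)
        finally show ?thesis .
      qed
      have \<eta>0: "(\<integral>y. \<eta> y \<partial>\<mu>) = 0" unfolding \<eta>_def by (simp add: integrable_phi mean)
      have "(\<lambda>n. char (distr M borel (\<lambda>\<omega>. (\<Sum>i<n. \<eta> (X i \<omega>)) / sqrt (real n))) 1)
          \<longlonglongrightarrow> char (distr white_noise borel (\<lambda>g. \<Sum>j\<in>J. t j * \<xi> j g)) 1"
        unfolding ch'[OF J] \<eta>_def[symmetric] by (rule bounded_clt_char[OF \<eta>m \<eta>b \<eta>0])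
      then have "(\<lambda>n. Re (cis c * char (distr M borel (\<lambda>\<omega>. (\<Sum>i<n. \<eta> (X i \<omega>)) / sqrt (real n))) 1))
          \<longlonglongrightarrow> Re (cis c * char (distr white_noise borel (\<lambda>g. \<Sum>j\<in>J. t j * \<xi> j g)) 1)"
        by (intro tendsto_Re tendsto_mult tendsto_const)
      then show ?thesis
        unfolding lin using \<eta>m
        by (subst expectation_cos_shift N.expectation_cos_shift, measurable)+
    qed
    show "(\<lambda>n. \<integral>\<omega>. F (normalized_sum \<phi> n \<omega>) \<partial>M) \<longlonglongrightarrow> (\<integral>g. F (\<lambda>j. \<xi> j g) \<partial>white_noise)"
      by (rule finite_dimensional_convergence[where V = "\<lambda>g j. \<xi> j g", OF prob_space_axioms prob_space_white_noise J
          normalized_sum_measurable \<xi> cosc normalized_sum_tight[OF J] F(1) F(2)[rule_format] dep])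
  qed
qed

end

end

section \<open>The type 2 inequality for samples\<close>

lemma sum_blinfun_measurable:
  fixes f :: "'i \<Rightarrow> 'm \<Rightarrow> 'b::real_normed_vector \<Rightarrow>\<^sub>L real"
  assumes sep: "separable_space (euclidean :: ('b \<Rightarrow>\<^sub>L real) topology)"
    and f: "\<And>i. i \<in> I \<Longrightarrow> f i \<in> borel_measurable M"
  shows "(\<lambda>\<omega>. \<Sum>i\<in>I. f i \<omega>) \<in> borel_measurable M"
  unfolding borel_measurable_blinfun_iff[OF sep] blinfun.sum_left
  using f by (intro allI borel_measurable_sum borel_measurable_blinfun_apply) auto

lemma scaleR_blinfun_measurable:
  fixes f :: "'m \<Rightarrow> 'b::real_normed_vector \<Rightarrow>\<^sub>L real"
  assumes sep: "separable_space (euclidean :: ('b \<Rightarrow>\<^sub>L real) topology)"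
    and c: "c \<in> borel_measurable M" and f: "f \<in> borel_measurable M"
  shows "(\<lambda>\<omega>. c \<omega> *\<^sub>R f \<omega>) \<in> borel_measurable M"
  unfolding borel_measurable_blinfun_iff[OF sep] blinfun.scaleR_left
  using c borel_measurable_blinfun_apply[OF f] by simp

lemma diff_blinfun_measurable:
  fixes f g :: "'m \<Rightarrow> 'b::real_normed_vector \<Rightarrow>\<^sub>L real"
  assumes sep: "separable_space (euclidean :: ('b \<Rightarrow>\<^sub>L real) topology)"
    and f: "f \<in> borel_measurable M" and g: "g \<in> borel_measurable M"
  shows "(\<lambda>\<omega>. f \<omega> - g \<omega>) \<in> borel_measurable M"
  unfolding borel_measurable_blinfun_iff[OF sep] blinfun.diff_left
  using borel_measurable_blinfun_apply[OF f] borel_measurable_blinfun_apply[OF g] by simp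

lemma norm_measurable:
  fixes f :: "'m \<Rightarrow> 'b::real_normed_vector"
  assumes "f \<in> borel_measurable M"
  shows "(\<lambda>\<omega>. norm (f \<omega>)) \<in> borel_measurable M"
  using assms by (rule measurable_compose) (auto intro!: borel_measurable_continuous_onI continuous_intros)

text \<open>The type 2 inequality with its constant exposed, so that one \<open>\<gamma>\<close> can
  be shared by all sample sizes and all approximants.\<close>

definition type_2_const :: "'b::real_normed_vector itself \<Rightarrow> real \<Rightarrow> bool" where
  "type_2_const _ \<gamma> \<longleftrightarrow> (\<forall>n\<ge>1. \<forall>(M :: (nat \<Rightarrow> 'b) measure) (U :: nat \<Rightarrow> (nat \<Rightarrow> 'b) \<Rightarrow> 'b).
        prob_space M \<longrightarrow>
        prob_space.indep_vars M (\<lambda>_. borel) U {..<n} \<longrightarrow>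
        (\<forall>i<n. has_bochner_expectation M (U i) 0) \<longrightarrow>
        (\<forall>i<n. integrable M (\<lambda>\<omega>. (norm (U i \<omega>))\<^sup>2)) \<longrightarrow>
        (LINT \<omega>|M. (norm (\<Sum>i<n. U i \<omega>))\<^sup>2) \<le> \<gamma> * (\<Sum>i<n. LINT \<omega>|M. (norm (U i \<omega>))\<^sup>2))"

lemma type_2_space_iff: "type_2_space TYPE('b::real_normed_vector) \<longleftrightarrow> (\<exists>\<gamma>>0. type_2_const TYPE('b) \<gamma>)"
  unfolding type_2_space_def type_2_const_def ..

text \<open>Type 2 speaks of variables on sequences of dual elements, whereas the sample lives on an
  arbitrary space. The joint law of the \<open>g (X i)\<close> is carried to sequences, where the
  coordinates keep their distribution and independence.\<close>

lemma (in iid_sample) type_2_sample_sum: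
  fixes g :: "'a \<Rightarrow> 'b::real_normed_vector \<Rightarrow>\<^sub>L real"
  assumes type2: "type_2_const TYPE('b \<Rightarrow>\<^sub>L real) \<gamma>"
    and sep: "separable_space (euclidean :: ('b \<Rightarrow>\<^sub>L real) topology)"
    and g: "g \<in> borel_measurable borel" and B: "\<And>y. norm (g y) \<le> B"
    and mean: "\<And>h. (\<integral>y. blinfun_apply (g y) h \<partial>\<mu>) = 0" and n: "n \<ge> 1"
  shows "(\<integral>\<omega>. (norm (\<Sum>i<n. g (X i \<omega>)))\<^sup>2 \<partial>M) \<le> \<gamma> * (real n * (\<integral>y. (norm (g y))\<^sup>2 \<partial>\<mu>))"
proof -
  define Z where "Z i \<omega> = g (X i \<omega>)" for i \<omega>
  have Z[measurable]: "Z i \<in> borel_measurable M" for i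
    unfolding Z_def by (rule measurable_compose[OF X_measurable g])
  have B0: "0 \<le> B" using B[of undefined] norm_ge_zero order_trans by blast
  define R where "R \<omega> i = Z i \<omega>" for \<omega> i
  have R[measurable]: "R \<in> measurable M (\<Pi>\<^sub>M _\<in>UNIV. borel)"
    unfolding R_def by (rule measurable_PiM_single') auto
  define P where "P = distr M (\<Pi>\<^sub>M _\<in>UNIV. borel) R"
  interpret P: prob_space P unfolding P_def by (rule prob_space_distr) simp
  \<comment> \<open>The coordinates are unbounded off the range of the sample. Truncation at
    \<open>B\<close> bounds them everywhere and leaves the sampled values unchanged.\<close>
  define \<tau> where "\<tau> y = (if norm y \<le> B then y else 0)" for y :: "'b \<Rightarrow>\<^sub>L real"
  have \<tau>m: "\<tau> \<in> borel_measurable borel"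
  proof -
    have "{y :: 'b \<Rightarrow>\<^sub>L real. norm y \<le> B} \<in> sets borel"
      by (intro borel_closed closed_Collect_le continuous_intros)
    then show ?thesis unfolding \<tau>_def by (intro measurable_If) auto
  qed
  have \<tau>B: "norm (\<tau> y) \<le> B" for y using B0 by (simp add: \<tau>_def)
  have \<tau>Z: "\<tau> (Z i \<omega>) = Z i \<omega>" for i \<omega> using B by (simp add: \<tau>_def Z_def)
  define U where "U i u = \<tau> (u i)" for i :: nat and u :: "nat \<Rightarrow> 'b \<Rightarrow>\<^sub>L real"
  have setsP[measurable_cong]: "sets P = sets (\<Pi>\<^sub>M _\<in>UNIV. borel)" by (simp add: P_def)
  have U: "U i \<in> borel_measurable P" for i
    unfolding U_def by (rule measurable_compose[OF _ \<tau>m]) measurable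
  have UR: "U i (R \<omega>) = Z i \<omega>" for i \<omega> by (simp add: U_def R_def \<tau>Z)
  have intP: "(\<integral>u. F u \<partial>P) = (\<integral>\<omega>. F (R \<omega>) \<partial>M)" if "F \<in> borel_measurable P" for F :: "_ \<Rightarrow> real"
    unfolding P_def by (rule integral_distr) (use that setsP in \<open>simp_all cong: measurable_cong_sets\<close>)
  have distrU: "distr P borel (U i) = distr M borel (Z i)" for i
    unfolding P_def
    by (subst distr_distr) (use U[of i] setsP in \<open>simp_all add: comp_def UR cong: measurable_cong_sets\<close>)
  have ne: "{..<n} \<noteq> {}" using n by (auto simp: lessThan_empty_iff)
  have indU: "P.indep_vars (\<lambda>_. borel) U {..<n}"
  proof (subst P.indep_vars_iff_distr_eq_PiM'[OF ne U])
    have mU: "(\<lambda>u. \<lambda>i\<in>{..<n}. U i u) \<in> measurable (\<Pi>\<^sub>M _\<in>UNIV. borel) (\<Pi>\<^sub>M i\<in>{..<n}. borel)"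
      by (rule measurable_restrict) (use U setsP in \<open>simp cong: measurable_cong_sets\<close>)
    have "distr P (\<Pi>\<^sub>M i\<in>{..<n}. borel) (\<lambda>u. \<lambda>i\<in>{..<n}. U i u)
        = distr M (\<Pi>\<^sub>M i\<in>{..<n}. borel) (\<lambda>\<omega>. \<lambda>i\<in>{..<n}. Z i \<omega>)"
      unfolding P_def by (subst distr_distr[OF mU R]) (simp add: comp_def UR)
    also have "\<dots> = (\<Pi>\<^sub>M i\<in>{..<n}. distr M borel (Z i))"
      by (rule indep_vars_iff_distr_eq_PiM'[OF ne Z, THEN iffD1])
        (use indep_vars_comp[OF g] in \<open>simp add: Z_def[abs_def]\<close>)
    finally show "distr P (\<Pi>\<^sub>M i\<in>{..<n}. borel) (\<lambda>u. \<lambda>i\<in>{..<n}. U i u) = (\<Pi>\<^sub>M i\<in>{..<n}. distr P borel (U i))"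
      unfolding distrU .
  qed
  have EU: "has_bochner_expectation P (U i) 0" for i
  proof (subst P.has_bochner_expectation_iff[OF sep U])
    show "norm (U i u) \<le> B" for u unfolding U_def by (rule \<tau>B)
    show "\<forall>h. blinfun_apply 0 h = (\<integral>u. blinfun_apply (U i u) h \<partial>P)"
    proof
      fix h
      have "(\<integral>u. blinfun_apply (U i u) h \<partial>P) = (\<integral>\<omega>. blinfun_apply (g (X i \<omega>)) h \<partial>M)"
        by (subst intP) (use borel_measurable_blinfun_apply[OF U] in \<open>simp_all add: UR Z_def\<close>)
      also have "\<dots> = (\<integral>y. blinfun_apply (g y) h \<partial>\<mu>)"
        by (rule integral_X) (rule borel_measurable_blinfun_apply[OF g])
      finally show "blinfun_apply 0 h = (\<integral>u. blinfun_apply (U i u) h \<partial>P)" by (simp add: mean)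
    qed
  qed
  have intU: "integrable P (\<lambda>u. (norm (U i u))\<^sup>2)" for i
  proof (rule P.integrable_const_bound[of _ "B\<^sup>2"])
    show "(\<lambda>u. (norm (U i u))\<^sup>2) \<in> borel_measurable P" using norm_measurable[OF U] by simp
    show "AE u in P. norm ((norm (U i u))\<^sup>2) \<le> B\<^sup>2"
      using \<tau>B by (auto simp: U_def intro!: power_mono)
  qed
  have "(\<integral>u. (norm (\<Sum>i<n. U i u))\<^sup>2 \<partial>P) \<le> \<gamma> * (\<Sum>i<n. \<integral>u. (norm (U i u))\<^sup>2 \<partial>P)"
    using type2 n P.prob_space_axioms indU EU intU unfolding type_2_const_def by blast
  moreover have "(\<integral>u. (norm (\<Sum>i<n. U i u))\<^sup>2 \<partial>P) = (\<integral>\<omega>. (norm (\<Sum>i<n. g (X i \<omega>)))\<^sup>2 \<partial>M)"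
  proof (subst intP)
    show "(\<lambda>u. (norm (\<Sum>i<n. U i u))\<^sup>2) \<in> borel_measurable P"
      using norm_measurable[OF sum_blinfun_measurable[OF sep, of "{..<n}" U P]] U by simp
  qed (simp add: UR Z_def)
  moreover have "(\<integral>u. (norm (U i u))\<^sup>2 \<partial>P) = (\<integral>y. (norm (g y))\<^sup>2 \<partial>\<mu>)" for i
  proof -
    have "(\<integral>u. (norm (U i u))\<^sup>2 \<partial>P) = (\<integral>\<omega>. (norm (g (X i \<omega>)))\<^sup>2 \<partial>M)"
      by (subst intP) (use norm_measurable[OF U] in \<open>simp_all add: UR Z_def\<close>)
    also have "\<dots> = (\<integral>y. (norm (g y))\<^sup>2 \<partial>\<mu>)"
      by (rule integral_X) (use norm_measurable[OF g] in simp)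
    finally show ?thesis .
  qed
  ultimately show ?thesis by simp
qed

section \<open>The central limit theorem in type 2 duals\<close>

text \<open>Centring each indicator at its probability shifts the simple function by its own mean
  \<open>z\<close>. As \<open>f\<close> has mean zero, \<open>z\<close> is itself an approximation
  error and therefore small.\<close>

lemma (in prob_space) centered_simple_approximation:
  fixes f :: "'a \<Rightarrow> 'b::real_normed_vector \<Rightarrow>\<^sub>L real"
  assumes sep: "separable_space (euclidean :: ('b \<Rightarrow>\<^sub>L real) topology)"
    and f: "f \<in> borel_measurable M" and B: "\<And>\<omega>. norm (f \<omega>) \<le> B"
    and mean: "\<And>h. (\<integral>\<omega>. blinfun_apply (f \<omega>) h \<partial>M) = 0" and e: "e > 0"
  shows "\<exists>n \<phi> y. (\<forall>k. \<phi> k \<in> borel_measurable M \<and> (\<forall>\<omega>. \<bar>\<phi> k \<omega>\<bar> \<le> 1) \<and> (\<integral>\<omega>. \<phi> k \<omega> \<partial>M) = (0::real))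
     \<and> (\<integral>\<omega>. (norm (f \<omega> - (\<Sum>k<n::nat. \<phi> k \<omega> *\<^sub>R y k)))\<^sup>2 \<partial>M) \<le> e"
proof -
  have B0: "0 \<le> B" using B[of undefined] norm_ge_zero order_trans by blast
  \<comment> \<open>\<open>D\<close> collects the squares of the error \<open>(2 + B) * d\<close>
    everywhere and of the extra \<open>B\<close> on \<open>bad\<close>, doubled by
    \<open>(a + b)^2 \<le> 2 * a^2 + 2 * b^2\<close>; the bound \<open>d \<le> 1\<close> lets
    \<open>d^2\<close> be replaced by \<open>d\<close>.\<close>
  define D where "D = 2 * (2 + B)\<^sup>2 + 2 * B\<^sup>2"
  have D: "D > 0" using B0 by (simp add: D_def add_pos_nonneg)
  define d where "d = min 1 (e / D)"
  have d: "d > 0" "d \<le> 1" "D * d \<le> e"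
  proof -
    show "d > 0" "d \<le> 1" using e D by (auto simp: d_def)
    have "d \<le> e / D" by (simp add: d_def)
    then show "D * d \<le> e" using D by (simp add: pos_le_divide_eq mult.commute)
  qed
  obtain n A y bad where A: "\<And>k. A k \<in> events" and bad: "bad \<in> events" "prob bad \<le> d"
    and s: "\<And>x. x \<in> space M \<Longrightarrow>
        norm (f x - (\<Sum>k<n::nat. indicator (A k) x *\<^sub>R y k)) \<le> d + B * indicator bad x"
    by (rule dual_simple_approximation[OF sep f B d(1)]) (rule that; assumption)
  define z where "z = (\<Sum>k<n. prob (A k) *\<^sub>R y k)"
  have z: "norm z \<le> d + B * d"
    using simple_expectation_close[OF integrable_blinfun_apply[OF sep f B] _ A bad B0 less_imp_le[OF d(1)] s, of 0]
    by (simp add: z_def mean)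
  define \<phi> where "\<phi> k x = indicator (A k) x - prob (A k)" for k x
  have \<phi>m: "\<phi> k \<in> borel_measurable M" for k unfolding \<phi>_def using A by simp
  define r where "r x = f x - (\<Sum>k<n. \<phi> k x *\<^sub>R y k)" for x
  have r: "r x = (f x - (\<Sum>k<n. indicator (A k) x *\<^sub>R y k)) + z" for x
    by (simp add: r_def \<phi>_def z_def scaleR_diff_left sum_subtractf del: sum_indicator_scaleR)
  have rm: "r \<in> borel_measurable M"
    unfolding r_def by (intro diff_blinfun_measurable[OF sep f] sum_blinfun_measurable[OF sep]
        scaleR_blinfun_measurable[OF sep \<phi>m]) simp
  have bound: "(norm (r x))\<^sup>2 \<le> 2 * ((2 + B) * d)\<^sup>2 + 2 * B\<^sup>2 * indicator bad x" if "x \<in> space M" for x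
  proof -
    have "norm (r x) \<le> (d + B * indicator bad x) + (d + B * d)"
      unfolding r using norm_triangle_mono[OF s[OF that] z] .
    also have "\<dots> = (2 + B) * d + B * indicator bad x" by (simp add: algebra_simps)
    finally have "(norm (r x))\<^sup>2 \<le> ((2 + B) * d + B * indicator bad x)\<^sup>2" by (intro power_mono) auto
    also have "\<dots> \<le> 2 * ((2 + B) * d)\<^sup>2 + 2 * (B * indicator bad x)\<^sup>2"
      using sum_squares_bound[of "(2 + B) * d" "B * indicator bad x"] by (simp add: power2_sum)
    also have "(B * indicator bad x)\<^sup>2 = B\<^sup>2 * indicator bad x" by (simp add: indicator_def)
    finally show ?thesis by (simp add: mult.assoc)
  qed
  have int_bad: "integrable M (indicat_real bad)"
    using bad by (intro integrable_real_indicator) (simp_all add: emeasure_eq_measure)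
  have "(\<integral>x. (norm (r x))\<^sup>2 \<partial>M) \<le> (\<integral>x. 2 * ((2 + B) * d)\<^sup>2 + 2 * B\<^sup>2 * indicator bad x \<partial>M)"
  proof (rule Bochner_Integration.integral_mono[OF _ _ bound])
    show i: "integrable M (\<lambda>x. 2 * ((2 + B) * d)\<^sup>2 + 2 * B\<^sup>2 * indicator bad x)" using int_bad by simp
    show "integrable M (\<lambda>x. (norm (r x))\<^sup>2)"
      by (rule Bochner_Integration.integrable_bound[OF i])
        (use norm_measurable[OF rm] bound in \<open>auto intro!: AE_I2\<close>)
  qed
  also have "\<dots> = 2 * ((2 + B) * d)\<^sup>2 + 2 * B\<^sup>2 * prob bad"
    using int_bad bad(1) prob_space by (subst Bochner_Integration.integral_add) auto
  also have "\<dots> \<le> D * d"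
  proof -
    have "d\<^sup>2 \<le> d" using d by (simp add: power2_eq_square mult_left_le)
    then have 1: "2 * (2 + B)\<^sup>2 * d\<^sup>2 \<le> 2 * (2 + B)\<^sup>2 * d" by (intro mult_left_mono) auto
    have 2: "2 * B\<^sup>2 * prob bad \<le> 2 * B\<^sup>2 * d" using bad(2) by (intro mult_left_mono) auto
    have "D * d = 2 * (2 + B)\<^sup>2 * d + 2 * B\<^sup>2 * d" unfolding D_def by (rule distrib_right)
    moreover have "2 * ((2 + B) * d)\<^sup>2 = 2 * (2 + B)\<^sup>2 * d\<^sup>2"
      by (simp only: power_mult_distrib mult.assoc)
    ultimately show ?thesis using add_mono[OF 1 2] by simp
  qed
  also have "\<dots> \<le> e" by (rule d)
  finally have main: "(\<integral>x. (norm (f x - (\<Sum>k<n. \<phi> k x *\<^sub>R y k)))\<^sup>2 \<partial>M) \<le> e" by (simp add: r_def)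
  have "\<bar>\<phi> k x\<bar> \<le> 1" for k x
  proof -
    have p: "0 \<le> prob (A k)" "prob (A k) \<le> 1" by simp_all
    show ?thesis
    proof (cases "x \<in> A k")
      case True
      then have "\<phi> k x = 1 - prob (A k)" by (simp add: \<phi>_def)
      then show ?thesis using p by linarith
    next
      case False
      then have "\<phi> k x = - prob (A k)" by (simp add: \<phi>_def)
      then show ?thesis using p by linarith
    qed
  qed
  moreover have "(\<integral>x. \<phi> k x \<partial>M) = 0" for k
    unfolding \<phi>_def using A[of k] prob_space by (subst Bochner_Integration.integral_diff)
      (auto intro!: integrable_real_indicator simp: emeasure_eq_measure)
  ultimately show ?thesis using main \<phi>m by (intro exI[of _ n] exI[of _ \<phi>] exI[of _ y]) auto
qed

text \<open>The arithmetic-geometric mean inequality with a free weight. With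
  \<open>a = 2 ^ m\<close>, a second moment of order \<open>(1 / 4) ^ m\<close> yields a first
  moment of order \<open>(1 / 2) ^ m\<close>.\<close>

lemma le_weighted_square:
  fixes a d :: real
  assumes "0 < a" "0 \<le> d"
  shows "d \<le> a * d\<^sup>2 + 1 / a"
proof -
  have "0 \<le> (a * d - 1)\<^sup>2 / a" using assms by simp
  also have "\<dots> = a * d\<^sup>2 + 1 / a - 2 * d"
    using assms by (simp add: field_simps power2_eq_square)
  finally show ?thesis using assms by linarith
qed

text \<open>The truncated increments have summable expectations, so their sum is almost surely
  finite. A summable sequence is eventually below 1, where truncation is inactive, and completeness
  of the dual gives the limit. Truncation is there because the increments are accessible only
  through bounded test functions.\<close>

lemma (in prob_space) almost_sure_limit:
  fixes Y :: "nat \<Rightarrow> 'a \<Rightarrow> 'b::real_normed_vector \<Rightarrow>\<^sub>L real"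
  assumes sep: "separable_space (euclidean :: ('b \<Rightarrow>\<^sub>L real) topology)"
    and Y: "\<And>m. Y m \<in> borel_measurable M" and c: "0 \<le> c"
    and bound: "\<And>m. (\<integral>\<omega>. min 1 ((norm (Y (Suc m) \<omega> - Y m \<omega>))\<^sup>2) \<partial>M) \<le> c * (1 / 4) ^ m"
  obtains V where "V \<in> borel_measurable M" "AE \<omega> in M. (\<lambda>m. Y m \<omega>) \<longlonglongrightarrow> V \<omega>"
proof -
  define N where "N m \<omega> = norm (Y (Suc m) \<omega> - Y m \<omega>)" for m \<omega>
  define D where "D m \<omega> = min 1 (N m \<omega>)" for m \<omega>
  have N[measurable]: "N m \<in> borel_measurable M" for m
    unfolding N_def by (rule norm_measurable[OF diff_blinfun_measurable[OF sep Y Y]])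
  have D[measurable]: "D m \<in> borel_measurable M" for m unfolding D_def by measurable
  have N0: "0 \<le> N m \<omega>" for m \<omega> by (simp add: N_def)
  have D01: "0 \<le> D m \<omega>" "D m \<omega> \<le> 1" for m \<omega> using N0 by (simp_all add: D_def)
  have D2: "(D m \<omega>)\<^sup>2 = min 1 ((norm (Y (Suc m) \<omega> - Y m \<omega>))\<^sup>2)" for m \<omega>
  proof (cases "N m \<omega> \<le> 1")
    case True
    then have "(N m \<omega>)\<^sup>2 \<le> 1" using N0 by (simp add: power_le_one)
    then show ?thesis using True by (simp add: D_def N_def)
  next
    case False
    then have "1 \<le> (N m \<omega>)\<^sup>2" by (simp add: one_le_power)
    then show ?thesis using False by (simp add: D_def N_def)
  qed
  have intD2: "integrable M (\<lambda>\<omega>. (D m \<omega>)\<^sup>2)" for m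
    by (rule integrable_const_bound[of _ 1]) (use D01 in \<open>auto simp: power_le_one\<close>)
  have ED: "(\<integral>\<omega>. D m \<omega> \<partial>M) \<le> (c + 1) * (1 / 2) ^ m" for m
  proof -
    have "(\<integral>\<omega>. D m \<omega> \<partial>M) \<le> (\<integral>\<omega>. 2 ^ m * (D m \<omega>)\<^sup>2 + (1 / 2) ^ m \<partial>M)"
    proof (rule Bochner_Integration.integral_mono)
      show "integrable M (D m)"
        by (rule integrable_const_bound[of _ 1]) (use D01 in auto)
      show "integrable M (\<lambda>\<omega>. 2 ^ m * (D m \<omega>)\<^sup>2 + (1 / 2) ^ m)" using intD2 by simp
      fix \<omega>
      show "D m \<omega> \<le> 2 ^ m * (D m \<omega>)\<^sup>2 + (1 / 2) ^ m"
        using le_weighted_square[of "2 ^ m" "D m \<omega>"] D01(1)[of m \<omega>] by (simp add: power_one_over)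
    qed
    also have "\<dots> = 2 ^ m * (\<integral>\<omega>. (D m \<omega>)\<^sup>2 \<partial>M) + (1 / 2) ^ m" using intD2 by (simp add: prob_space)
    also have "\<dots> \<le> 2 ^ m * (c * (1 / 4) ^ m) + (1 / 2) ^ m"
      using bound[of m] unfolding D2 by simp
    also have "2 ^ m * (c * (1 / 4) ^ m) = c * (2 * (1 / 4)) ^ m"
      by (simp only: power_mult_distrib mult_ac)
    finally show ?thesis by (simp add: algebra_simps)
  qed
  define T where "T \<omega> = (\<Sum>m. ennreal (D m \<omega>))" for \<omega>
  have T[measurable]: "T \<in> borel_measurable M" unfolding T_def by measurable
  have "(\<integral>\<^sup>+\<omega>. T \<omega> \<partial>M) = (\<Sum>m. \<integral>\<^sup>+\<omega>. ennreal (D m \<omega>) \<partial>M)"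
    unfolding T_def by (rule nn_integral_suminf) measurable
  also have "\<dots> \<le> (\<Sum>m. ennreal ((c + 1) * (1 / 2) ^ m))"
  proof (rule suminf_le)
    fix m
    have "(\<integral>\<^sup>+\<omega>. ennreal (D m \<omega>) \<partial>M) = ennreal (\<integral>\<omega>. D m \<omega> \<partial>M)"
    proof (rule nn_integral_eq_integral)
      show "integrable M (D m)" by (rule integrable_const_bound[of _ 1]) (use D01 in auto)
    qed (use D01 in auto)
    then show "(\<integral>\<^sup>+\<omega>. ennreal (D m \<omega>) \<partial>M) \<le> ennreal ((c + 1) * (1 / 2) ^ m)"
      using ED by (simp add: ennreal_leI)
  qed auto
  finally have le: "(\<integral>\<^sup>+\<omega>. T \<omega> \<partial>M) \<le> (\<Sum>m. ennreal ((c + 1) * (1 / 2) ^ m))" .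
  have "(\<Sum>m. ennreal ((c + 1) * (1 / 2) ^ m)) \<noteq> top"
    using c by (intro ennreal_suminf_neq_top summable_mult summable_geometric) auto
  with le have "(\<integral>\<^sup>+\<omega>. T \<omega> \<partial>M) \<noteq> \<infinity>" by (auto simp: top_unique)
  then have AE_T: "AE \<omega> in M. T \<omega> \<noteq> \<infinity>" by (rule nn_integral_PInf_AE[OF T])
  have conv: "convergent (\<lambda>m. Y m \<omega>)" if "T \<omega> \<noteq> \<infinity>" for \<omega>
  proof -
    have sD: "summable (\<lambda>m. D m \<omega>)"
      by (rule summable_suminf_not_top) (use that D01 in \<open>auto simp: T_def\<close>)
    from order_tendstoD(2)[OF summable_LIMSEQ_zero[OF sD], of 1]
    have "\<forall>\<^sub>F m in sequentially. D m \<omega> < 1" by simp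
    then have "\<forall>\<^sub>F m in sequentially. D m \<omega> = N m \<omega>"
      by eventually_elim (auto simp: D_def min_def split: if_splits)
    then have "summable (\<lambda>m. N m \<omega>)" using sD summable_cong[of "\<lambda>m. D m \<omega>" "\<lambda>m. N m \<omega>"] by simp
    then have "summable (\<lambda>m. Y (Suc m) \<omega> - Y m \<omega>)"
      unfolding N_def by (rule summable_norm_cancel)
    then have "(\<lambda>n. \<Sum>m<n. Y (Suc m) \<omega> - Y m \<omega>) \<longlonglongrightarrow> (\<Sum>m. Y (Suc m) \<omega> - Y m \<omega>)"
      by (rule summable_LIMSEQ)
    moreover have "(\<Sum>m<n. Y (Suc m) \<omega> - Y m \<omega>) = Y n \<omega> - Y 0 \<omega>" for n
      by (induction n) simp_all
    ultimately have "(\<lambda>n. Y n \<omega> - Y 0 \<omega>) \<longlonglongrightarrow> (\<Sum>m. Y (Suc m) \<omega> - Y m \<omega>)" by simp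
    from tendsto_add[OF this tendsto_const[of "Y 0 \<omega>"]] show ?thesis
      by (auto simp: convergent_def)
  qed
  define A where "A = {\<omega> \<in> space M. T \<omega> \<noteq> \<infinity>}"
  have A[measurable]: "A \<in> events" unfolding A_def by measurable
  \<comment> \<open>Setting \<open>V\<close> to 0 off the measurable event \<open>A\<close> makes
    its evaluations limits of measurable functions at every point.\<close>
  define V where "V \<omega> = (if \<omega> \<in> A then lim (\<lambda>m. Y m \<omega>) else 0)" for \<omega>
  have lim: "(\<lambda>m. Y m \<omega>) \<longlonglongrightarrow> V \<omega>" if "\<omega> \<in> A" for \<omega>
    using conv[of \<omega>] that by (simp add: A_def V_def convergent_LIMSEQ_iff)
  show ?thesis
  proof (rule that[of V])
    show "V \<in> borel_measurable M"
      unfolding borel_measurable_blinfun_iff[OF sep]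
    proof
      fix h
      show "(\<lambda>\<omega>. blinfun_apply (V \<omega>) h) \<in> borel_measurable M"
      proof (rule borel_measurable_LIMSEQ_real)
        show "(\<lambda>\<omega>. indicator A \<omega> * blinfun_apply (Y m \<omega>) h) \<in> borel_measurable M" for m
          using borel_measurable_blinfun_apply[OF Y[of m], of h] by measurable
        show "(\<lambda>m. indicator A \<omega> * blinfun_apply (Y m \<omega>) h) \<longlonglongrightarrow> blinfun_apply (V \<omega>) h" for \<omega>
        proof (cases "\<omega> \<in> A")
          case True
          then show ?thesis using lim[OF True] by (auto intro!: tendsto_intros)
        qed (simp add: V_def)
      qed
    qed
    show "AE \<omega> in M. (\<lambda>m. Y m \<omega>) \<longlonglongrightarrow> V \<omega>"
      using AE_T AE_space by eventually_elim (auto simp: A_def intro: lim)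
  qed
qed

text \<open>The approximants of all accuracies are arranged in one sequence by the pairing function,
  \<open>J m\<close> being the block of accuracy \<open>(1 / 4) ^ m\<close>; a single Gaussian
  sequence then covers them all.\<close>

lemma (in iid_sample) centered_simple_approximations:
  fixes f :: "'a \<Rightarrow> 'b::real_normed_vector \<Rightarrow>\<^sub>L real"
  assumes sep: "separable_space (euclidean :: ('b \<Rightarrow>\<^sub>L real) topology)"
    and f: "f \<in> borel_measurable borel" and B: "\<And>x. norm (f x) \<le> B"
    and mean: "\<And>h. (\<integral>x. blinfun_apply (f x) h \<partial>\<mu>) = 0"
  obtains \<phi> :: "nat \<Rightarrow> 'a \<Rightarrow> real" and y :: "nat \<Rightarrow> 'b \<Rightarrow>\<^sub>L real" and J :: "nat \<Rightarrow> nat set"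
  where "\<And>j. \<phi> j \<in> borel_measurable borel" "\<And>j x. \<bar>\<phi> j x\<bar> \<le> 1" "\<And>j. (\<integral>x. \<phi> j x \<partial>\<mu>) = 0"
    "\<And>m. finite (J m)" "\<And>m. (\<integral>x. (norm (f x - (\<Sum>j\<in>J m. \<phi> j x *\<^sub>R y j)))\<^sup>2 \<partial>\<mu>) \<le> (1 / 4) ^ m"
proof -
  have f': "f \<in> borel_measurable \<mu>" using f by (simp cong: measurable_cong_sets)
  have "\<forall>m. \<exists>n \<phi> y. (\<forall>k. \<phi> k \<in> borel_measurable \<mu> \<and> (\<forall>x. \<bar>\<phi> k x\<bar> \<le> 1) \<and> (\<integral>x. \<phi> k x \<partial>\<mu>) = (0::real))
     \<and> (\<integral>x. (norm (f x - (\<Sum>k<n::nat. \<phi> k x *\<^sub>R y k)))\<^sup>2 \<partial>\<mu>) \<le> (1 / 4) ^ m"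
    by (intro allI law.centered_simple_approximation[OF sep f' B mean]) simp
  from choice[OF this] obtain n where "\<forall>m. \<exists>\<phi> y. (\<forall>k. \<phi> k \<in> borel_measurable \<mu> \<and> (\<forall>x. \<bar>\<phi> k x\<bar> \<le> 1) \<and> (\<integral>x. \<phi> k x \<partial>\<mu>) = (0::real))
     \<and> (\<integral>x. (norm (f x - (\<Sum>k<(n m)::nat. \<phi> k x *\<^sub>R y k)))\<^sup>2 \<partial>\<mu>) \<le> (1 / 4) ^ m" by (rule exE)
  from choice[OF this] obtain \<phi> where "\<forall>m. \<exists>y. (\<forall>k. \<phi> m k \<in> borel_measurable \<mu> \<and> (\<forall>x. \<bar>\<phi> m k x\<bar> \<le> 1) \<and> (\<integral>x. \<phi> m k x \<partial>\<mu>) = (0::real))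
     \<and> (\<integral>x. (norm (f x - (\<Sum>k<(n m)::nat. \<phi> m k x *\<^sub>R y k)))\<^sup>2 \<partial>\<mu>) \<le> (1 / 4) ^ m" by (rule exE)
  from choice[OF this] obtain y where y: "\<forall>m. (\<forall>k. \<phi> m k \<in> borel_measurable \<mu> \<and> (\<forall>x. \<bar>\<phi> m k x\<bar> \<le> 1) \<and> (\<integral>x. \<phi> m k x \<partial>\<mu>) = (0::real))
     \<and> (\<integral>x. (norm (f x - (\<Sum>k<(n m)::nat. \<phi> m k x *\<^sub>R y m k)))\<^sup>2 \<partial>\<mu>) \<le> (1 / 4) ^ m" by (rule exE)
  define \<psi> where "\<psi> j = \<phi> (fst (prod_decode j)) (snd (prod_decode j))" for j
  define w where "w j = y (fst (prod_decode j)) (snd (prod_decode j))" for j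
  define J where "J m = (\<lambda>k. prod_encode (m, k)) ` {..<n m}" for m
  have "(\<Sum>j\<in>J m. \<psi> j x *\<^sub>R w j) = (\<Sum>k<n m. \<phi> m k x *\<^sub>R y m k)" for m x
    unfolding J_def by (subst sum.reindex) (auto intro!: inj_onI simp: \<psi>_def w_def)
  then show ?thesis
    using y by (intro that[of \<psi> J w]) (auto simp: \<psi>_def J_def cong: measurable_cong_sets)
qed


lemma (in prob_space) abs_expectation_diff_le:
  fixes F G :: "'a \<Rightarrow> real"
  assumes "integrable M F" "integrable M G" "integrable M H"
    and "\<And>\<omega>. \<omega> \<in> space M \<Longrightarrow> \<bar>F \<omega> - G \<omega>\<bar> \<le> H \<omega>"
  shows "\<bar>expectation F - expectation G\<bar> \<le> expectation H"
  using norm_integral_le_integral[of M "\<lambda>\<omega>. F \<omega> - G \<omega>" H] assms by simp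

lemma lipschitz_measurable:
  fixes \<Psi> :: "'b::real_normed_vector \<Rightarrow> real"
  assumes L: "\<And>y z. \<bar>\<Psi> y - \<Psi> z\<bar> \<le> L * norm (y - z)" and f: "f \<in> borel_measurable M"
  shows "continuous_on S \<Psi>" "(\<lambda>\<omega>. \<Psi> (f \<omega>)) \<in> borel_measurable M"
proof -
  have L0: "0 \<le> \<bar>L\<bar> + 1" by simp
  have "(\<bar>L\<bar> + 1)-lipschitz_on UNIV \<Psi>"
  proof (rule lipschitz_onI)
    fix y z :: 'b
    have "L * norm (y - z) \<le> (\<bar>L\<bar> + 1) * norm (y - z)" by (rule mult_right_mono) auto
    then show "dist (\<Psi> y) (\<Psi> z) \<le> (\<bar>L\<bar> + 1) * dist y z"
      using L[of y z] by (simp add: dist_real_def dist_norm)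
  qed simp
  then have c: "continuous_on UNIV \<Psi>" by (rule lipschitz_on_continuous_on)
  then show "continuous_on S \<Psi>" by (rule continuous_on_subset) simp
  show "(\<lambda>\<omega>. \<Psi> (f \<omega>)) \<in> borel_measurable M"
    by (rule measurable_compose[OF f borel_measurable_continuous_onI[OF c]])
qed

section \<open>Norm estimates for normalised sums and the limiting Gaussian element\<close>

context iid_sample
begin

text \<open>The square of \<open>1 / sqrt n\<close> cancels the factor \<open>n\<close> produced by
  type 2, which makes the second moment bound uniform in \<open>n\<close>.\<close>

lemma type_2_normalized_sum:
  fixes g :: "'a \<Rightarrow> 'b::real_normed_vector \<Rightarrow>\<^sub>L real"
  assumes type2: "type_2_const TYPE('b \<Rightarrow>\<^sub>L real) \<gamma>"
    and sep: "separable_space (euclidean :: ('b \<Rightarrow>\<^sub>L real) topology)"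
    and g: "g \<in> borel_measurable borel" and B: "\<And>y. norm (g y) \<le> B"
    and mean: "\<And>h. (\<integral>y. blinfun_apply (g y) h \<partial>\<mu>) = 0" and n: "n \<ge> 1"
  defines "Z \<equiv> \<lambda>\<omega>. (1 / sqrt (real n)) *\<^sub>R (\<Sum>i<n. g (X i \<omega>))"
  shows "integrable M (\<lambda>\<omega>. (norm (Z \<omega>))\<^sup>2)"
    and "(\<integral>\<omega>. (norm (Z \<omega>))\<^sup>2 \<partial>M) \<le> \<gamma> * (\<integral>y. (norm (g y))\<^sup>2 \<partial>\<mu>)"
    and "Z \<in> borel_measurable M"
proof -
  have gX: "(\<lambda>\<omega>. g (X i \<omega>)) \<in> borel_measurable M" for i
    by (rule measurable_compose[OF X_measurable g])
  define Y where "Y \<omega> = (\<Sum>i<n. g (X i \<omega>))" for \<omega>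
  have Y: "Y \<in> borel_measurable M"
    unfolding Y_def by (rule sum_blinfun_measurable[OF sep gX])
  show "Z \<in> borel_measurable M"
    unfolding Z_def Y_def[symmetric] by (rule scaleR_blinfun_measurable[OF sep _ Y]) simp
  have YB: "norm (Y \<omega>) \<le> real n * B" for \<omega>
    unfolding Y_def using sum_norm_le[of "{..<n}" "\<lambda>i. g (X i \<omega>)" "\<lambda>_. B"] B by simp
  have intY: "integrable M (\<lambda>\<omega>. (norm (Y \<omega>))\<^sup>2)"
  proof (rule integrable_const_bound[of _ "(real n * B)\<^sup>2"])
    show "AE \<omega> in M. norm ((norm (Y \<omega>))\<^sup>2) \<le> (real n * B)\<^sup>2"
      using YB by (auto intro!: power_mono)
  qed (use norm_measurable[OF Y] in simp)
  have ZY: "(norm (Z \<omega>))\<^sup>2 = (norm (Y \<omega>))\<^sup>2 / real n" for \<omega>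
    unfolding Z_def Y_def[symmetric] by (simp add: power_divide)
  show "integrable M (\<lambda>\<omega>. (norm (Z \<omega>))\<^sup>2)" unfolding ZY using intY by simp
  have "(\<integral>\<omega>. (norm (Y \<omega>))\<^sup>2 \<partial>M) \<le> \<gamma> * (real n * (\<integral>y. (norm (g y))\<^sup>2 \<partial>\<mu>))"
    unfolding Y_def by (rule type_2_sample_sum[OF type2 sep g B mean n])
  then have "(\<integral>\<omega>. (norm (Y \<omega>))\<^sup>2 \<partial>M) / real n \<le> \<gamma> * (\<integral>y. (norm (g y))\<^sup>2 \<partial>\<mu>)"
    using n by (simp add: pos_divide_le_eq mult_ac)
  then show "(\<integral>\<omega>. (norm (Z \<omega>))\<^sup>2 \<partial>M) \<le> \<gamma> * (\<integral>y. (norm (g y))\<^sup>2 \<partial>\<mu>)"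
    unfolding ZY by simp
qed

text \<open>An interchange of limits in \<open>n\<close> and \<open>m\<close>: the replacement error
  \<open>ZW\<close> is of order \<open>(1 / 2) ^ m\<close> uniformly in \<open>n\<close>, the
  convergence \<open>WY\<close> is finite dimensional for each \<open>m\<close>, and
  \<open>YV'\<close> is dominated convergence on white noise. The tests are bounded Lipschitz
  functions because the replacement error is controlled through the norm.\<close>

theorem type_2_central_limit:
  fixes f :: "'a \<Rightarrow> 'b::real_normed_vector \<Rightarrow>\<^sub>L real"
  assumes sep: "separable_space (euclidean :: ('b \<Rightarrow>\<^sub>L real) topology)"
    and type2: "type_2_const TYPE('b \<Rightarrow>\<^sub>L real) \<gamma>" and \<gamma>: "0 < \<gamma>"
    and f: "f \<in> borel_measurable borel" and B: "\<And>x. norm (f x) \<le> B"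
    and mean: "\<And>h. (\<integral>x. blinfun_apply (f x) h \<partial>\<mu>) = 0"
  obtains V :: "(nat \<Rightarrow> real) \<Rightarrow> 'b \<Rightarrow>\<^sub>L real" and C where "gaussian_element white_noise V 0 C"
    and "\<And>\<Psi> L K. \<forall>y z. \<bar>\<Psi> y - \<Psi> z\<bar> \<le> L * norm (y - z) \<Longrightarrow> \<forall>y. \<bar>\<Psi> y\<bar> \<le> K \<Longrightarrow>
      (\<lambda>n. \<integral>\<omega>. \<Psi> ((1 / sqrt (real n)) *\<^sub>R (\<Sum>i<n. f (X i \<omega>))) \<partial>M) \<longlonglongrightarrow> (\<integral>g. (\<Psi> (V g) :: real) \<partial>white_noise)"
proof -
  interpret N: prob_space white_noise by (rule prob_space_white_noise)
  have B0: "0 \<le> B" using B[of undefined] norm_ge_zero order_trans by blast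
  have f': "f \<in> borel_measurable \<mu>" using f by (simp cong: measurable_cong_sets)
  obtain \<phi> :: "nat \<Rightarrow> 'a \<Rightarrow> real" and y :: "nat \<Rightarrow> 'b \<Rightarrow>\<^sub>L real" and J :: "nat \<Rightarrow> nat set"
    where \<phi>: "\<And>j. \<phi> j \<in> borel_measurable borel" and \<phi>1: "\<And>j x. \<bar>\<phi> j x\<bar> \<le> 1"
    and \<phi>0: "\<And>j. (\<integral>x. \<phi> j x \<partial>\<mu>) = 0" and J: "\<And>m. finite (J m)"
    and approx: "\<And>m. (\<integral>x. (norm (f x - (\<Sum>j\<in>J m. \<phi> j x *\<^sub>R y j)))\<^sup>2 \<partial>\<mu>) \<le> (1 / 4) ^ m"
    by (rule centered_simple_approximations[OF sep f B mean]) (rule that; assumption)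
  obtain \<xi> :: "nat \<Rightarrow> (nat \<Rightarrow> real) \<Rightarrow> real" where \<xi>[measurable]: "\<And>j. \<xi> j \<in> borel_measurable white_noise"
    and ch\<xi>: "\<And>J t s. finite J \<Longrightarrow> char (distr white_noise borel (\<lambda>g. \<Sum>j\<in>J. t j * \<xi> j g)) s
        = exp (- (s\<^sup>2 * (\<integral>y. (\<Sum>j\<in>J. t j * \<phi> j y)\<^sup>2 \<partial>\<mu>) / 2))"
    and fd: "\<And>J (F :: (nat \<Rightarrow> real) \<Rightarrow> real) B. finite J \<Longrightarrow> continuous_on UNIV F \<Longrightarrow> \<forall>u. \<bar>F u\<bar> \<le> B \<Longrightarrow>
      \<forall>u v. (\<forall>j\<in>J. u j = v j) \<longrightarrow> F u = F v \<Longrightarrow>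
      (\<lambda>n. \<integral>\<omega>. F (normalized_sum \<phi> n \<omega>) \<partial>M) \<longlonglongrightarrow> (\<integral>g. F (\<lambda>j. \<xi> j g) \<partial>white_noise)"
    by (rule normalized_sum_fd_convergence[OF \<phi> \<phi>1 \<phi>0]) (rule that; assumption)
  \<comment> \<open>The linear map \<open>\<Lambda> m\<close> assembles a dual element from the
    coordinates in block \<open>J m\<close>. Applied to the functions \<open>\<phi>\<close>, to
    their normalised sums and to the Gaussian sequence, it gives \<open>G m\<close>, the normalised
    sum of \<open>G m\<close>, and \<open>Y m\<close>.\<close>
  define \<Lambda> where "\<Lambda> m u = (\<Sum>j\<in>J m. u j *\<^sub>R y j)" for m and u :: "nat \<Rightarrow> real"
  define G where "G m x = \<Lambda> m (\<lambda>j. \<phi> j x)" for m x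
  define Y where "Y m g = \<Lambda> m (\<lambda>j. \<xi> j g)" for m g
  define Z where "Z n \<omega> = (1 / sqrt (real n)) *\<^sub>R (\<Sum>i<n. f (X i \<omega>))" for n \<omega>
  have cont\<Lambda>: "continuous_on UNIV (\<Lambda> m)" for m
    unfolding \<Lambda>_def by (intro continuous_on_sum continuous_on_scaleR continuous_on_const continuous_on_product_coordinates)
  have Gm: "G m \<in> borel_measurable borel" for m
    unfolding G_def \<Lambda>_def using \<phi>
    by (intro sum_blinfun_measurable[OF sep] scaleR_blinfun_measurable[OF sep]) auto
  have Ym: "Y m \<in> borel_measurable white_noise" for m
    unfolding Y_def \<Lambda>_def
    by (intro sum_blinfun_measurable[OF sep] scaleR_blinfun_measurable[OF sep]) auto
  have GB: "norm (G m x) \<le> (\<Sum>j\<in>J m. norm (y j))" for m x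
    unfolding G_def \<Lambda>_def
    by (rule sum_norm_le) (use \<phi>1 in \<open>simp add: mult_left_le_one_le\<close>)
  have G0: "(\<integral>x. blinfun_apply (G m x) h \<partial>\<mu>) = 0" for m h
    unfolding G_def \<Lambda>_def blinfun.sum_left blinfun.scaleR_left
    using integrable_phi[where \<phi> = \<phi>, OF \<phi> \<phi>1 \<phi>0] by (simp add: \<phi>0)
  have \<Lambda>W: "\<Lambda> m (normalized_sum \<phi> n \<omega>) = (1 / sqrt (real n)) *\<^sub>R (\<Sum>i<n. G m (X i \<omega>))" for m n \<omega>
  proof -
    have "(\<Sum>i<n. G m (X i \<omega>)) = (\<Sum>j\<in>J m. (\<Sum>i<n. \<phi> j (X i \<omega>)) *\<^sub>R y j)"
      unfolding G_def \<Lambda>_def by (subst sum.swap) (simp add: scaleR_left.sum)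
    then show ?thesis unfolding \<Lambda>_def normalized_sum_def by (simp add: scaleR_sum_right)
  qed
  have Em: "(\<integral>x. (norm (f x - G m x))\<^sup>2 \<partial>\<mu>) \<le> (1 / 4) ^ m" for m
    using approx[of m] by (simp add: G_def \<Lambda>_def)
  have sq_int: "integrable \<mu> (\<lambda>x. (norm (g x))\<^sup>2)"
    if "g \<in> borel_measurable borel" "\<And>x. norm (g x) \<le> K" for g :: "'a \<Rightarrow> 'b \<Rightarrow>\<^sub>L real" and K
  proof (rule law.integrable_const_bound[of _ "K\<^sup>2"])
    show "AE x in \<mu>. norm ((norm (g x))\<^sup>2) \<le> K\<^sup>2" using that(2) by (auto intro!: power_mono)
    show "(\<lambda>x. (norm (g x))\<^sup>2) \<in> borel_measurable \<mu>"
      using norm_measurable[OF that(1)] by (simp cong: measurable_cong_sets)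
  qed
  have fGm: "(\<lambda>x. f x - G m x) \<in> borel_measurable borel" for m by (rule diff_blinfun_measurable[OF sep f Gm])
  have fGB: "norm (f x - G m x) \<le> B + (\<Sum>j\<in>J m. norm (y j))" for m x
    using norm_triangle_ineq4[of "f x" "G m x"] B[of x] GB[of m x] by linarith
  have fG0: "(\<integral>x. blinfun_apply (f x - G m x) h \<partial>\<mu>) = 0" for m h
    using law.integrable_blinfun_apply[OF sep f' B] mean G0[of m h]
      law.integrable_blinfun_apply[OF sep _ GB[of m]] Gm[of m]
    by (simp add: blinfun.diff_left cong: measurable_cong_sets)
  \<comment> \<open>Passing through \<open>f\<close> gives
    \<open>2 * (1 / 4) ^ m + 2 * (1 / 4) ^ Suc m\<close>, rounded up.\<close>
  have GG: "(\<integral>x. (norm (G (Suc m) x - G m x))\<^sup>2 \<partial>\<mu>) \<le> 4 * (1 / 4) ^ m" for m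
  proof -
    have "(\<integral>x. (norm (G (Suc m) x - G m x))\<^sup>2 \<partial>\<mu>)
        \<le> (\<integral>x. 2 * (norm (f x - G m x))\<^sup>2 + 2 * (norm (f x - G (Suc m) x))\<^sup>2 \<partial>\<mu>)"
    proof (rule Bochner_Integration.integral_mono)
      show "integrable \<mu> (\<lambda>x. 2 * (norm (f x - G m x))\<^sup>2 + 2 * (norm (f x - G (Suc m) x))\<^sup>2)"
        using sq_int[OF fGm fGB] by simp
      show "integrable \<mu> (\<lambda>x. (norm (G (Suc m) x - G m x))\<^sup>2)"
      proof (rule sq_int[OF diff_blinfun_measurable[OF sep Gm Gm]])
        show "norm (G (Suc m) x - G m x) \<le> (\<Sum>j\<in>J (Suc m). norm (y j)) + (\<Sum>j\<in>J m. norm (y j))" for x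
          using norm_triangle_ineq4[of "G (Suc m) x" "G m x"] GB[of m x] GB[of "Suc m" x] by linarith
      qed
      fix x
      have "norm (G (Suc m) x - G m x) \<le> norm (f x - G m x) + norm (f x - G (Suc m) x)"
        using norm_triangle_ineq4[of "f x - G m x" "f x - G (Suc m) x"] by simp
      then have "(norm (G (Suc m) x - G m x))\<^sup>2 \<le> (norm (f x - G m x) + norm (f x - G (Suc m) x))\<^sup>2"
        by (rule power_mono) simp
      also have "\<dots> \<le> 2 * (norm (f x - G m x))\<^sup>2 + 2 * (norm (f x - G (Suc m) x))\<^sup>2"
        using sum_squares_bound[of "norm (f x - G m x)" "norm (f x - G (Suc m) x)"] by (simp add: power2_sum)
      finally show "(norm (G (Suc m) x - G m x))\<^sup>2
        \<le> 2 * (norm (f x - G m x))\<^sup>2 + 2 * (norm (f x - G (Suc m) x))\<^sup>2" .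
    qed
    also have "\<dots> = 2 * (\<integral>x. (norm (f x - G m x))\<^sup>2 \<partial>\<mu>) + 2 * (\<integral>x. (norm (f x - G (Suc m) x))\<^sup>2 \<partial>\<mu>)"
      using sq_int[OF fGm fGB] by simp
    also have "\<dots> \<le> 2 * (1 / 4) ^ m + 2 * (1 / 4) ^ Suc m"
      using Em[of m] Em[of "Suc m"] by linarith
    also have "\<dots> \<le> 4 * (1 / 4) ^ m" by simp
    finally show ?thesis .
  qed
  \<comment> \<open>The Gaussian increments inherit the type 2 bound from the samples: it holds for
    every \<open>n \<ge> 1\<close> and survives the limit. The minimum with 1 makes the test
    function bounded.\<close>
  have YY: "(\<integral>g. min 1 ((norm (Y (Suc m) g - Y m g))\<^sup>2) \<partial>white_noise) \<le> (4 * \<gamma>) * (1 / 4) ^ m" for m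
  proof -
    define F where "F u = min 1 ((norm (\<Lambda> (Suc m) u - \<Lambda> m u))\<^sup>2)" for u
    have "(\<lambda>n. \<integral>\<omega>. F (normalized_sum \<phi> n \<omega>) \<partial>M) \<longlonglongrightarrow> (\<integral>g. F (\<lambda>j. \<xi> j g) \<partial>white_noise)"
    proof (rule fd[of "J m \<union> J (Suc m)" F 1])
      show "finite (J m \<union> J (Suc m))" using J by simp
      show "continuous_on UNIV F" unfolding F_def
        by (intro continuous_intros cont\<Lambda>)
      show "\<forall>u. \<bar>F u\<bar> \<le> 1" by (simp add: F_def)
      show "\<forall>u v. (\<forall>j\<in>J m \<union> J (Suc m). u j = v j) \<longrightarrow> F u = F v"
      proof (intro allI impI)
        fix u v :: "nat \<Rightarrow> real" assume "\<forall>j\<in>J m \<union> J (Suc m). u j = v j"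
        then have "\<Lambda> m u = \<Lambda> m v" "\<Lambda> (Suc m) u = \<Lambda> (Suc m) v"
          unfolding \<Lambda>_def by (auto intro!: sum.cong)
        then show "F u = F v" by (simp add: F_def)
      qed
    qed
    moreover have "(\<integral>\<omega>. F (normalized_sum \<phi> n \<omega>) \<partial>M) \<le> (4 * \<gamma>) * (1 / 4) ^ m" if n: "n \<ge> 1" for n
    proof -
      define H where "H x = G (Suc m) x - G m x" for x
      have Hm: "H \<in> borel_measurable borel" unfolding H_def by (rule diff_blinfun_measurable[OF sep Gm Gm])
      have HB: "norm (H x) \<le> (\<Sum>j\<in>J (Suc m). norm (y j)) + (\<Sum>j\<in>J m. norm (y j))" for x
        using norm_triangle_ineq4[of "G (Suc m) x" "G m x"] GB[of m x] GB[of "Suc m" x] by (simp add: H_def)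
      have H0: "(\<integral>x. blinfun_apply (H x) h \<partial>\<mu>) = 0" for h
        using G0[of m h] G0[of "Suc m" h] law.integrable_blinfun_apply[OF sep _ GB] Gm
        by (simp add: H_def blinfun.diff_left cong: measurable_cong_sets)
      note t2 = type_2_normalized_sum[OF type2 sep Hm HB H0 n]
      have FH: "F (normalized_sum \<phi> n \<omega>) \<le> (norm ((1 / sqrt (real n)) *\<^sub>R (\<Sum>i<n. H (X i \<omega>))))\<^sup>2" for \<omega>
        unfolding F_def \<Lambda>W H_def by (simp add: sum_subtractf scaleR_diff_right)
      have "(\<integral>\<omega>. F (normalized_sum \<phi> n \<omega>) \<partial>M) \<le> (\<integral>\<omega>. (norm ((1 / sqrt (real n)) *\<^sub>R (\<Sum>i<n. H (X i \<omega>))))\<^sup>2 \<partial>M)"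
        by (rule integral_mono'[OF t2(1) FH]) simp
      also have "\<dots> \<le> \<gamma> * (\<integral>x. (norm (H x))\<^sup>2 \<partial>\<mu>)" by (rule t2(2))
      also have "\<dots> \<le> \<gamma> * (4 * (1 / 4) ^ m)"
        using GG[of m] \<gamma> unfolding H_def by (intro mult_left_mono) auto
      finally show ?thesis by simp
    qed
    ultimately have "(\<integral>g. F (\<lambda>j. \<xi> j g) \<partial>white_noise) \<le> (4 * \<gamma>) * (1 / 4) ^ m"
      by (intro LIMSEQ_le_const2) blast+
    then show ?thesis by (simp add: F_def Y_def)
  qed
  have \<gamma>4: "0 \<le> 4 * \<gamma>" using \<gamma> by simp
  obtain V where V: "V \<in> borel_measurable white_noise" and YV: "AE g in white_noise. (\<lambda>m. Y m g) \<longlonglongrightarrow> V g"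
    by (rule N.almost_sure_limit[OF sep Ym \<gamma>4 YY])
  have half: "(\<lambda>m. a * (1 / 2) ^ m) \<longlonglongrightarrow> 0" for a :: real
    using tendsto_mult_right_zero[OF LIMSEQ_power_zero[of "1 / 2 :: real"], of a] by simp
  have weight: "(2::real) ^ m * (1 / 4) ^ m = (1 / 2) ^ m" for m
    by (simp only: power_mult_distrib[symmetric]) simp
  have lf: "(\<lambda>x. blinfun_apply l (f x)) \<in> borel_measurable \<mu>"
    for l :: "('b \<Rightarrow>\<^sub>L real) \<Rightarrow>\<^sub>L real"
    using f' by (rule measurable_compose) (auto intro!: borel_measurable_continuous_onI continuous_intros)
  have lB: "\<bar>blinfun_apply l (f x)\<bar> \<le> norm l * B" for l x
    using abs_blinfun_apply_le[of l "f x"] mult_left_mono[OF B[of x], of "norm l"] by simp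
  have int_ll: "integrable \<mu> (\<lambda>x. blinfun_apply k (f x) * blinfun_apply l (f x))"
    for k l :: "('b \<Rightarrow>\<^sub>L real) \<Rightarrow>\<^sub>L real"
  proof (rule law.integrable_const_bound[of _ "(norm k * B) * (norm l * B)"])
    show "AE x in \<mu>. norm (blinfun_apply k (f x) * blinfun_apply l (f x)) \<le> (norm k * B) * (norm l * B)"
      using lB B0 by (intro AE_I2) (auto simp: abs_mult intro!: mult_mono)
  qed (use lf in measurable)
  \<comment> \<open>The variance of \<open>l\<close> at \<open>Y m\<close> is the second moment of
    \<open>l\<close> at \<open>G m\<close>. Mean square convergence of \<open>G m\<close> to
    \<open>f\<close> carries these variances to the limit, and dominated convergence carries the
    characteristic functions to that of \<open>l\<close> at \<open>V\<close>.\<close>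
  have chV: "char (distr white_noise borel (\<lambda>g. blinfun_apply l (V g))) s
      = exp (- (s\<^sup>2 * (\<integral>x. (blinfun_apply l (f x))\<^sup>2 \<partial>\<mu>) / 2))" for l s
  proof -
    have ml: "(\<lambda>g. blinfun_apply l (U g)) \<in> borel_measurable white_noise"
      if "U \<in> borel_measurable white_noise" for U
      using that by (rule measurable_compose) (auto intro!: borel_measurable_continuous_onI continuous_intros)
    have lim1: "(\<lambda>m. char (distr white_noise borel (\<lambda>g. blinfun_apply l (Y m g))) s)
        \<longlonglongrightarrow> char (distr white_noise borel (\<lambda>g. blinfun_apply l (V g))) s"
      unfolding char_distr_eq[OF ml[OF Ym]] char_distr_eq[OF ml[OF V]]
    proof (rule integral_dominated_convergence[where w="\<lambda>_. 1"])
      show "AE g in white_noise. (\<lambda>m. iexp (s * blinfun_apply l (Y m g))) \<longlonglongrightarrow> iexp (s * blinfun_apply l (V g))"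
        using YV by eventually_elim (intro tendsto_intros blinfun.tendsto)
    qed (use ml[OF Ym] ml[OF V] in auto)
    have eqs: "char (distr white_noise borel (\<lambda>g. blinfun_apply l (Y m g))) s
        = exp (- (s\<^sup>2 * (\<integral>x. (blinfun_apply l (G m x))\<^sup>2 \<partial>\<mu>) / 2))" for m
      using ch\<xi>[OF J[of m], of "\<lambda>j. blinfun_apply l (y j)" s]
      by (simp add: Y_def G_def \<Lambda>_def blinfun.sum_right blinfun.scaleR_right mult.commute)
    have lim2: "(\<lambda>m. complex_of_real (exp (- (s\<^sup>2 * (\<integral>x. (blinfun_apply l (G m x))\<^sup>2 \<partial>\<mu>) / 2))))
        \<longlonglongrightarrow> exp (- (s\<^sup>2 * (\<integral>x. (blinfun_apply l (f x))\<^sup>2 \<partial>\<mu>) / 2))"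
    proof -
      \<comment> \<open>Squares of evaluations differ by at most \<open>d^2 + K * d\<close> with
        \<open>K = 2 * (norm l * B)\<close>. After trading \<open>d\<close> for
        \<open>2 ^ m * d^2 + (1 / 2) ^ m\<close> the coefficients are \<open>(norm l)^2\<close>,
        \<open>K * (norm l)^2\<close> and \<open>K\<close>, with sum \<open>A\<close>.\<close>
      define A where "A = (norm l)\<^sup>2 * 1 + 2 * (norm l * B) * ((norm l)\<^sup>2 + 1)"
      have "\<bar>(\<integral>x. (blinfun_apply l (G m x))\<^sup>2 \<partial>\<mu>) - (\<integral>x. (blinfun_apply l (f x))\<^sup>2 \<partial>\<mu>)\<bar> \<le> A * (1 / 2) ^ m" for m
      proof -
        define K where "K = 2 * (norm l * B)"
        have K: "0 \<le> K" using B0 by (simp add: K_def)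
        define d where "d x = norm l * norm (f x - G m x)" for x
        have d2: "integrable \<mu> (\<lambda>x. (d x)\<^sup>2)"
          unfolding d_def power_mult_distrib using sq_int[OF fGm fGB] by simp
        have Ed2: "(\<integral>x. (d x)\<^sup>2 \<partial>\<mu>) \<le> (norm l)\<^sup>2 * (1 / 4) ^ m"
          unfolding d_def power_mult_distrib using Em[of m] by (simp add: mult_left_mono)
        have "(\<lambda>x. blinfun_apply l (G m x)) \<in> borel_measurable borel"
          using Gm[of m] by (rule measurable_compose) (auto intro!: borel_measurable_continuous_onI continuous_intros)
        then have lG: "(\<lambda>x. blinfun_apply l (G m x)) \<in> borel_measurable \<mu>"
          by (simp cong: measurable_cong_sets)
        have "\<bar>(\<integral>x. (blinfun_apply l (G m x))\<^sup>2 \<partial>\<mu>) - (\<integral>x. (blinfun_apply l (f x))\<^sup>2 \<partial>\<mu>)\<bar>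
            \<le> (\<integral>x. (1 + K * 2 ^ m) * (d x)\<^sup>2 + K * (1 / 2) ^ m \<partial>\<mu>)"
        proof (rule law.abs_expectation_diff_le)
          show "integrable \<mu> (\<lambda>x. (blinfun_apply l (f x))\<^sup>2)" using int_ll[of l l] by (simp add: power2_eq_square)
          show "integrable \<mu> (\<lambda>x. (1 + K * 2 ^ m) * (d x)\<^sup>2 + K * (1 / 2) ^ m)" using d2 by simp
          show "integrable \<mu> (\<lambda>x. (blinfun_apply l (G m x))\<^sup>2)"
          proof (rule law.integrable_const_bound[of _ "(norm l * (\<Sum>j\<in>J m. norm (y j)))\<^sup>2"])
            have "\<bar>blinfun_apply l (G m x)\<bar> \<le> norm l * (\<Sum>j\<in>J m. norm (y j))" for x
              using abs_blinfun_apply_le[of l "G m x"] mult_left_mono[OF GB[of m x], of "norm l"] by simp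
            then have "\<bar>blinfun_apply l (G m x)\<bar>\<^sup>2 \<le> (norm l * (\<Sum>j\<in>J m. norm (y j)))\<^sup>2" for x
              by (rule power_mono) simp
            then show "AE x in \<mu>. norm ((blinfun_apply l (G m x))\<^sup>2) \<le> (norm l * (\<Sum>j\<in>J m. norm (y j)))\<^sup>2" by simp
          qed (use lG in measurable)
          fix x
          define a where "a = blinfun_apply l (f x)"
          define b where "b = blinfun_apply l (G m x)"
          have ab: "\<bar>b - a\<bar> \<le> d x"
            using abs_blinfun_apply_le[of l "G m x - f x"]
            by (simp add: a_def b_def d_def blinfun.diff_right norm_minus_commute)
          have dw: "d x \<le> 2 ^ m * (d x)\<^sup>2 + (1 / 2) ^ m"
            using le_weighted_square[of "2 ^ m" "d x"] by (simp add: d_def power_one_over)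
          have "b\<^sup>2 - a\<^sup>2 = (b - a)\<^sup>2 + 2 * a * (b - a)" by (simp add: power2_eq_square algebra_simps)
          then have "\<bar>b\<^sup>2 - a\<^sup>2\<bar> \<le> \<bar>(b - a)\<^sup>2\<bar> + \<bar>2 * a * (b - a)\<bar>" by (metis abs_triangle_ineq)
          also have "\<dots> = \<bar>b - a\<bar>\<^sup>2 + 2 * \<bar>a\<bar> * \<bar>b - a\<bar>" by (simp add: abs_mult)
          also have "\<dots> \<le> (d x)\<^sup>2 + K * d x"
            unfolding K_def using ab lB[of l x] B0
            by (intro add_mono power_mono mult_mono) (auto simp: a_def)
          also have "\<dots> \<le> (d x)\<^sup>2 + K * (2 ^ m * (d x)\<^sup>2 + (1 / 2) ^ m)"
            using dw K by (intro add_left_mono mult_left_mono)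
          finally show "\<bar>(blinfun_apply l (G m x))\<^sup>2 - (blinfun_apply l (f x))\<^sup>2\<bar>
            \<le> (1 + K * 2 ^ m) * (d x)\<^sup>2 + K * (1 / 2) ^ m"
            unfolding a_def b_def by (simp add: algebra_simps)
        qed
        also have "\<dots> = (1 + K * 2 ^ m) * (\<integral>x. (d x)\<^sup>2 \<partial>\<mu>) + K * (1 / 2) ^ m"
          using d2 law.prob_space by simp
        also have "\<dots> \<le> (1 + K * 2 ^ m) * ((norm l)\<^sup>2 * (1 / 4) ^ m) + K * (1 / 2) ^ m"
          using Ed2 K by (intro add_right_mono mult_left_mono) auto
        also have "\<dots> = (norm l)\<^sup>2 * (1 / 4) ^ m + K * (norm l)\<^sup>2 * (2 ^ m * (1 / 4) ^ m) + K * (1 / 2) ^ m"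
        proof -
          have "(1 + K * p) * (q * r) + z = q * r + K * q * (p * r) + z" for p q r z :: real
            by (simp add: algebra_simps)
          then show ?thesis .
        qed
        also have "\<dots> \<le> (norm l)\<^sup>2 * (1 / 2) ^ m + K * (norm l)\<^sup>2 * (1 / 2) ^ m + K * (1 / 2) ^ m"
          unfolding weight by (intro add_right_mono mult_left_mono power_mono) auto
        also have "\<dots> = A * (1 / 2) ^ m" by (simp add: A_def K_def algebra_simps)
        finally show ?thesis .
      qed
      then have "(\<lambda>m. (\<integral>x. (blinfun_apply l (G m x))\<^sup>2 \<partial>\<mu>)) \<longlonglongrightarrow> (\<integral>x. (blinfun_apply l (f x))\<^sup>2 \<partial>\<mu>)"
        by (intro LIM_zero_cancel[OF Lim_null_comparison[OF always_eventually half[of A]]]) simp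
      then show ?thesis by (intro tendsto_intros) simp_all
    qed
    show ?thesis by (rule LIMSEQ_unique[OF lim1[unfolded eqs] lim2])
  qed
  have "\<exists>C. gaussian_element white_noise V 0 C"
  proof -
    \<comment> \<open>The covariance form of the centred variable \<open>f\<close>; being bilinear
      with bound \<open>B * B\<close>, it defines a continuous operator into the second dual of the
      dual.\<close>
    define Q where "Q k l = (\<integral>x. blinfun_apply k (f x) * blinfun_apply l (f x) \<partial>\<mu>)" for k l :: "('b \<Rightarrow>\<^sub>L real) \<Rightarrow>\<^sub>L real"
    have Qb: "\<bar>Q k l\<bar> \<le> (norm k * B) * (norm l * B)" for k l
    proof -
      have "norm (Q k l) \<le> (\<integral>x. (norm k * B) * (norm l * B) \<partial>\<mu>)"
        unfolding Q_def
      proof (rule norm_integral_le_integral[OF int_ll])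
        show "norm (blinfun_apply k (f x) * blinfun_apply l (f x)) \<le> (norm k * B) * (norm l * B)" for x
          using lB B0 by (auto simp: abs_mult intro!: mult_mono)
      qed simp
      then show ?thesis using law.prob_space by simp
    qed
    have lin: "bounded_linear (Q k)" for k
      unfolding Q_def
      by (rule bounded_linear_intro[of _ "norm k * B * B"])
        (use int_ll Qb[of k] in \<open>auto simp: blinfun.add_left blinfun.scaleR_left distrib_left mult_ac Q_def\<close>)
    define C where "C = Blinfun (\<lambda>k. Blinfun (Q k))"
    have app: "blinfun_apply (Blinfun (Q k)) l = Q k l" for k l
      using lin by (simp add: bounded_linear_Blinfun_apply)
    have "bounded_linear (\<lambda>k. Blinfun (Q k))"
    proof (rule bounded_linear_intro[of _ "B * B"])
      fix k k' :: "('b \<Rightarrow>\<^sub>L real) \<Rightarrow>\<^sub>L real" and r :: real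
      show "Blinfun (Q (k + k')) = Blinfun (Q k) + Blinfun (Q k')"
        by (rule blinfun_eqI) (simp add: app blinfun.add_left Q_def int_ll distrib_right)
      show "Blinfun (Q (r *\<^sub>R k)) = r *\<^sub>R Blinfun (Q k)"
        by (rule blinfun_eqI) (simp add: app blinfun.scaleR_left Q_def mult.assoc)
      show "norm (Blinfun (Q k)) \<le> norm k * (B * B)"
        by (rule norm_blinfun_bound) (use B0 Qb[of k] in \<open>simp_all add: app mult_ac\<close>)
    qed
    then have C: "blinfun_apply (blinfun_apply C k) l = Q k l" for k l
      unfolding C_def by (simp add: bounded_linear_Blinfun_apply app)
    have "distr white_noise borel (\<lambda>g. blinfun_apply l (V g)) = real_gaussian 0 (Q l l)" for l
    proof (rule Levy_uniqueness)
      have Ql: "Q l l = (\<integral>x. (blinfun_apply l (f x))\<^sup>2 \<partial>\<mu>)" by (simp add: Q_def power2_eq_square)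
      then have Q0: "0 \<le> Q l l" by simp
      show "real_distribution (real_gaussian 0 (Q l l))" by (rule char_real_gaussian(1)[OF Q0])
      have "(\<lambda>g. blinfun_apply l (V g)) \<in> borel_measurable white_noise"
        using V by (rule measurable_compose) (auto intro!: borel_measurable_continuous_onI continuous_intros)
      then show "real_distribution (distr white_noise borel (\<lambda>g. blinfun_apply l (V g)))"
        by (rule N.real_distribution_distr)
      show "char (distr white_noise borel (\<lambda>g. blinfun_apply l (V g))) = char (real_gaussian 0 (Q l l))"
        by (rule ext) (simp only: chV char_real_gaussian(2)[OF Q0[unfolded Ql]] Ql)
    qed
    moreover have "0 \<le> Q l l" for l by (simp add: Q_def)
    moreover have "Q k l = Q l k" for k l by (simp add: Q_def mult.commute)
    ultimately have "gaussian_element white_noise V 0 C"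
      unfolding gaussian_element_def C using V prob_space_white_noise by (simp add: blinfun.zero_right)
    then show ?thesis ..
  qed
  then obtain C where C: "gaussian_element white_noise V 0 C" ..
  show ?thesis
  proof (rule that[OF C])
    fix \<Psi> :: "('b \<Rightarrow>\<^sub>L real) \<Rightarrow> real" and L K
    assume LK: "\<forall>y z. \<bar>\<Psi> y - \<Psi> z\<bar> \<le> L * norm (y - z)" "\<forall>y. \<bar>\<Psi> y\<bar> \<le> K"
    have L: "\<bar>\<Psi> y - \<Psi> z\<bar> \<le> L * norm (y - z)" and K: "\<bar>\<Psi> y\<bar> \<le> K" for y z
      using LK by blast+
    have L': "\<bar>\<Psi> y - \<Psi> z\<bar> \<le> \<bar>L\<bar> * norm (y - z)" for y z
      using L[of y z] mult_right_mono[OF abs_ge_self[of L] norm_ge_zero[of "y - z"]] by linarith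
    \<comment> \<open>The constant comes from
      \<open>2 ^ m * (\<gamma> * (1 / 4) ^ m) + (1 / 2) ^ m\<close>; that it is free of
      \<open>n\<close> is what type 2 contributes.\<close>
    have ZW: "\<bar>(\<integral>\<omega>. \<Psi> (Z n \<omega>) \<partial>M) - (\<integral>\<omega>. \<Psi> (\<Lambda> m (normalized_sum \<phi> n \<omega>)) \<partial>M)\<bar>
        \<le> (\<bar>L\<bar> * (\<gamma> + 1)) * (1 / 2) ^ m" if n: "n \<ge> 1" for n m
    proof -
      note t2 = type_2_normalized_sum[OF type2 sep fGm fGB fG0 n, of m]
      define R where "R \<omega> = (1 / sqrt (real n)) *\<^sub>R (\<Sum>i<n. f (X i \<omega>) - G m (X i \<omega>))" for \<omega>
      have R: "integrable M (\<lambda>\<omega>. (norm (R \<omega>))\<^sup>2)" "(\<integral>\<omega>. (norm (R \<omega>))\<^sup>2 \<partial>M) \<le> \<gamma> * (1 / 4) ^ m"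
      proof -
        show "integrable M (\<lambda>\<omega>. (norm (R \<omega>))\<^sup>2)" unfolding R_def by (rule t2(1))
        have "\<gamma> * (\<integral>x. (norm (f x - G m x))\<^sup>2 \<partial>\<mu>) \<le> \<gamma> * (1 / 4) ^ m"
          using Em[of m] \<gamma> by (intro mult_left_mono) auto
        with t2(2) show "(\<integral>\<omega>. (norm (R \<omega>))\<^sup>2 \<partial>M) \<le> \<gamma> * (1 / 4) ^ m"
          unfolding R_def by (rule order_trans)
      qed
      have int\<Psi>: "integrable M (\<lambda>\<omega>. \<Psi> (U \<omega>))" if "U \<in> borel_measurable M" for U
        by (rule integrable_const_bound[of _ K]) (use K lipschitz_measurable(2)[OF L that] in auto)
      have Zm: "Z n \<in> borel_measurable M"
        unfolding Z_def by (rule type_2_normalized_sum(3)[OF type2 sep f B mean n])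
      have Wm: "(\<lambda>\<omega>. \<Lambda> m (normalized_sum \<phi> n \<omega>)) \<in> borel_measurable M"
        unfolding \<Lambda>W by (rule type_2_normalized_sum(3)[OF type2 sep Gm GB G0 n])
      have "\<bar>(\<integral>\<omega>. \<Psi> (Z n \<omega>) \<partial>M) - (\<integral>\<omega>. \<Psi> (\<Lambda> m (normalized_sum \<phi> n \<omega>)) \<partial>M)\<bar>
          \<le> (\<integral>\<omega>. \<bar>L\<bar> * (2 ^ m * (norm (R \<omega>))\<^sup>2 + (1 / 2) ^ m) \<partial>M)"
      proof (rule abs_expectation_diff_le)
        show "integrable M (\<lambda>\<omega>. \<Psi> (Z n \<omega>))" by (rule int\<Psi>[OF Zm])
        show "integrable M (\<lambda>\<omega>. \<Psi> (\<Lambda> m (normalized_sum \<phi> n \<omega>)))" by (rule int\<Psi>[OF Wm])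
        show "integrable M (\<lambda>\<omega>. \<bar>L\<bar> * (2 ^ m * (norm (R \<omega>))\<^sup>2 + (1 / 2) ^ m))" using R(1) by simp
        fix \<omega>
        have "Z n \<omega> - \<Lambda> m (normalized_sum \<phi> n \<omega>) = R \<omega>"
          unfolding Z_def \<Lambda>W R_def by (simp add: sum_subtractf scaleR_diff_right)
        then have "\<bar>\<Psi> (Z n \<omega>) - \<Psi> (\<Lambda> m (normalized_sum \<phi> n \<omega>))\<bar> \<le> \<bar>L\<bar> * norm (R \<omega>)"
          using L'[of "Z n \<omega>"] by metis
        also have "\<dots> \<le> \<bar>L\<bar> * (2 ^ m * (norm (R \<omega>))\<^sup>2 + (1 / 2) ^ m)"
          using le_weighted_square[of "2 ^ m" "norm (R \<omega>)"] by (intro mult_left_mono) (auto simp: power_one_over)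
        finally show "\<bar>\<Psi> (Z n \<omega>) - \<Psi> (\<Lambda> m (normalized_sum \<phi> n \<omega>))\<bar> \<le> \<bar>L\<bar> * (2 ^ m * (norm (R \<omega>))\<^sup>2 + (1 / 2) ^ m)" .
      qed
      also have "\<dots> = \<bar>L\<bar> * (2 ^ m * (\<integral>\<omega>. (norm (R \<omega>))\<^sup>2 \<partial>M) + (1 / 2) ^ m)"
        using R(1) prob_space by simp
      also have "\<dots> \<le> \<bar>L\<bar> * (2 ^ m * (\<gamma> * (1 / 4) ^ m) + (1 / 2) ^ m)"
        using R(2) by (intro mult_left_mono add_right_mono) auto
      also have "2 ^ m * (\<gamma> * (1 / 4) ^ m) = \<gamma> * (1 / 2) ^ m" using weight[of m] by (metis mult.left_commute)
      also have "\<bar>L\<bar> * (\<gamma> * (1 / 2) ^ m + (1 / 2) ^ m) = (\<bar>L\<bar> * (\<gamma> + 1)) * (1 / 2) ^ m"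
        by (simp add: algebra_simps)
      finally show ?thesis .
    qed
    have YV': "(\<lambda>m. \<integral>g. \<Psi> (Y m g) \<partial>white_noise) \<longlonglongrightarrow> (\<integral>g. \<Psi> (V g) \<partial>white_noise)"
    proof (rule integral_dominated_convergence[where w="\<lambda>_. K"])
      have "isCont \<Psi> z" for z
        using lipschitz_measurable(1)[OF L V, of UNIV] by (simp add: continuous_on_eq_continuous_at)
      then show "AE g in white_noise. (\<lambda>m. \<Psi> (Y m g)) \<longlonglongrightarrow> \<Psi> (V g)"
        using YV by (auto elim!: eventually_mono intro: isCont_tendsto_compose)
      show "AE g in white_noise. norm (\<Psi> (Y m g)) \<le> K" for m using K by simp
    qed (use lipschitz_measurable(2)[OF L Ym] lipschitz_measurable(2)[OF L V] in auto)
    have WY: "(\<lambda>n. \<integral>\<omega>. \<Psi> (\<Lambda> m (normalized_sum \<phi> n \<omega>)) \<partial>M) \<longlonglongrightarrow> (\<integral>g. \<Psi> (Y m g) \<partial>white_noise)" for m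
      unfolding Y_def
    proof (rule fd[OF J, of "\<lambda>u. \<Psi> (\<Lambda> m u)" K m])
      show "continuous_on UNIV (\<lambda>u. \<Psi> (\<Lambda> m u))"
        by (rule continuous_on_compose2[OF lipschitz_measurable(1)[OF L V, of UNIV] cont\<Lambda>]) simp
      show "\<forall>u. \<bar>\<Psi> (\<Lambda> m u)\<bar> \<le> K" using K by blast
      show "\<forall>u v. (\<forall>j\<in>J m. u j = v j) \<longrightarrow> \<Psi> (\<Lambda> m u) = \<Psi> (\<Lambda> m v)"
        by (auto simp: \<Lambda>_def cong: sum.cong)
    qed
    have "(\<lambda>n. \<integral>\<omega>. \<Psi> (Z n \<omega>) \<partial>M) \<longlonglongrightarrow> (\<integral>g. \<Psi> (V g) \<partial>white_noise)"
    proof (rule tendstoI)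
      fix e :: real assume e: "e > 0"
      have e3: "e / 3 > 0" using e by simp
      \<comment> \<open>The rank index \<open>m\<close> is fixed before \<open>n\<close>, as the
        uniformity of \<open>ZW\<close> in \<open>n\<close> permits.\<close>
      have "\<forall>\<^sub>F m in sequentially. dist (\<integral>g. \<Psi> (Y m g) \<partial>white_noise) (\<integral>g. \<Psi> (V g) \<partial>white_noise) < e / 3
          \<and> (\<bar>L\<bar> * (\<gamma> + 1)) * (1 / 2) ^ m < e / 3"
        using tendstoD[OF YV' e3] order_tendstoD(2)[OF half e3] by (rule eventually_conj)
      from eventually_happens'[OF sequentially_bot this] obtain m where m: "dist (\<integral>g. \<Psi> (Y m g) \<partial>white_noise) (\<integral>g. \<Psi> (V g) \<partial>white_noise) < e / 3"
          "(\<bar>L\<bar> * (\<gamma> + 1)) * (1 / 2) ^ m < e / 3"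
        by blast
      show "\<forall>\<^sub>F n in sequentially. dist (\<integral>\<omega>. \<Psi> (Z n \<omega>) \<partial>M) (\<integral>g. \<Psi> (V g) \<partial>white_noise) < e"
        using tendstoD[OF WY[of m] e3] eventually_ge_at_top[of 1]
      proof eventually_elim
        case (elim n)
        have *: "\<bar>a - d\<bar> < e" if "\<bar>a - b\<bar> \<le> x" "\<bar>b - c\<bar> < e / 3" "\<bar>c - d\<bar> < e / 3" "x < e / 3"
          for a b c d x :: real
          using that by linarith
        show ?case unfolding dist_real_def
          by (rule *[OF ZW[OF elim(2), of m] elim(1)[unfolded dist_real_def] m[unfolded dist_real_def]])
      qed
    qed
    then show "(\<lambda>n. \<integral>\<omega>. \<Psi> ((1 / sqrt (real n)) *\<^sub>R (\<Sum>i<n. f (X i \<omega>))) \<partial>M) \<longlonglongrightarrow> (\<integral>g. \<Psi> (V g) \<partial>white_noise)"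
      by (simp add: Z_def)
  qed
qed

end

section \<open>Weak convergence of the empirical spatial depth\<close>

lemma cts_step_abs_le: "a < b \<Longrightarrow> \<bar>cts_step a b x\<bar> \<le> 1"
  by (auto simp: cts_step_def divide_simps)

text \<open>The step function is an affine function of slope \<open>- 1 / (b - a)\<close> clamped to
  the unit interval, and clamping does not increase distances.\<close>

lemma cts_step_lipschitz:
  assumes "a < b"
  shows "\<bar>cts_step a b x - cts_step a b y\<bar> \<le> 1 / (b - a) * \<bar>x - y\<bar>"
proof -
  have eq: "cts_step a b z = max 0 (min 1 ((b - z) / (b - a)))" for z
    using assms by (auto simp: cts_step_def divide_simps min_def max_def)
  have "\<bar>max 0 (min 1 u) - max 0 (min 1 v)\<bar> \<le> \<bar>u - v\<bar>" for u v :: real by linarith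
  then have "\<bar>cts_step a b x - cts_step a b y\<bar> \<le> \<bar>(b - x) / (b - a) - (b - y) / (b - a)\<bar>"
    unfolding eq .
  also have "(b - x) / (b - a) - (b - y) / (b - a) = 1 / (b - a) * (y - x)"
    using assms by (simp add: diff_divide_distrib)
  also have "\<bar>1 / (b - a) * (y - x)\<bar> = 1 / (b - a) * \<bar>x - y\<bar>"
    using assms by (simp add: abs_mult abs_minus_commute)
  finally show ?thesis .
qed

lemma cts_step_measurable: "a < b \<Longrightarrow> cts_step a b \<in> borel_measurable borel"
  using cts_step_uniformly_continuous[of a b]
  by (intro borel_measurable_continuous_onI uniformly_continuous_imp_continuous)

text \<open>The step functions squeeze the indicators of half-lines. They are bounded and Lipschitz,
  hence among the tests covered by the limit theorem in the dual once composed with a Lipschitz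
  function.\<close>

lemma weak_conv_distr_if_cts_step:
  assumes M: "prob_space M" and N: "prob_space N"
    and D: "\<And>n. D n \<in> borel_measurable M" and g: "g \<in> borel_measurable N"
    and lim: "\<And>a b. a < b \<Longrightarrow> (\<lambda>n. \<integral>\<omega>. cts_step a b (D n \<omega>) \<partial>M) \<longlonglongrightarrow> (\<integral>\<omega>. cts_step a b (g \<omega>) \<partial>N)"
  shows "weak_conv_m (\<lambda>n. distr M borel (D n)) (distr N borel g)"
proof (rule integral_cts_step_conv_imp_weak_conv)
  show "real_distribution (distr M borel (D n))" for n
    using M D by (simp add: prob_space.real_distribution_distr)
  show "real_distribution (distr N borel g)"
    using N g by (simp add: prob_space.real_distribution_distr)
  show "(\<lambda>n. integral\<^sup>L (distr M borel (D n)) (cts_step a b)) \<longlonglongrightarrow> integral\<^sup>L (distr N borel g) (cts_step a b)"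
    if "a < b" for a b
    using lim[OF that] D g cts_step_measurable[OF that] by (simp add: integral_distr)
qed

text \<open>The Gaussian element is moved from its original space to its own law, where the identity
  takes its place; this gives a probability space on the dual itself.\<close>

lemma gaussian_element_distr:
  fixes V :: "'m \<Rightarrow> 'b::real_normed_vector"
  assumes "gaussian_element P V m C"
  shows "gaussian_element (distr P borel V) (\<lambda>y. y) m C"
    and "(g :: _ \<Rightarrow> real) \<in> borel_measurable borel \<Longrightarrow>
      distr (distr P borel V) borel g = distr P borel (\<lambda>\<omega>. g (V \<omega>))"
proof -
  have V: "V \<in> borel_measurable P" and P: "prob_space P"
    using assms by (auto simp: gaussian_element_def)
  have d: "distr (distr P borel V) borel g = distr P borel (\<lambda>\<omega>. g (V \<omega>))"
    if "g \<in> borel_measurable borel" for g :: "_ \<Rightarrow> real"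
    using V that by (subst distr_distr) (auto simp: comp_def)
  then show "g \<in> borel_measurable borel \<Longrightarrow>
      distr (distr P borel V) borel g = distr P borel (\<lambda>\<omega>. g (V \<omega>))" for g :: "_ \<Rightarrow> real" .
  have "distr (distr P borel V) borel (blinfun_apply l) = distr P borel (\<lambda>\<omega>. blinfun_apply l (V \<omega>))"
    for l :: "'b \<Rightarrow>\<^sub>L real"
    by (rule d) (intro borel_measurable_continuous_onI continuous_intros)
  then show "gaussian_element (distr P borel V) (\<lambda>y. y) m C"
    using assms prob_space.prob_space_distr[OF P V] by (simp add: gaussian_element_def)
qed

text \<open>Uniformity over the unit sphere is applied with \<open>t = norm h\<close> and direction
  \<open>h / norm h\<close>, which turns directional derivatives into an expansion with error
  proportional to \<open>norm h\<close>.\<close>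

lemma frechet_smooth_expansion:
  fixes S :: "'b::real_normed_vector"
  assumes "frechet_smooth_space TYPE('b)" and S: "S \<noteq> 0" and e: "e > 0"
  obtains \<delta> where "\<delta> > 0"
    "\<And>h. norm h < \<delta> \<Longrightarrow> \<bar>norm (S + h) - norm S - blinfun_apply (SGN S) h\<bar> \<le> e * norm h"
proof -
  have "uniform_limit (sphere 0 1) (\<lambda>t h. (norm (S + t *\<^sub>R h) - norm S) / t) (blinfun_apply (SGN S)) (at (0::real))"
    using assms by (simp add: frechet_smooth_space_def)
  from uniform_limitD[OF this e] obtain \<delta> where \<delta>: "\<delta> > 0"
    and close: "\<And>t u. t \<noteq> 0 \<Longrightarrow> \<bar>t\<bar> < \<delta> \<Longrightarrow> norm u = 1 \<Longrightarrow>
      dist ((norm (S + t *\<^sub>R u) - norm S) / t) (blinfun_apply (SGN S) u) < e"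
    unfolding eventually_at by (auto simp: dist_real_def)
  show ?thesis
  proof (rule that[OF \<delta>])
    fix h :: 'b assume h: "norm h < \<delta>"
    show "\<bar>norm (S + h) - norm S - blinfun_apply (SGN S) h\<bar> \<le> e * norm h"
    proof (cases "h = 0")
      case False
      define u where "u = (1 / norm h) *\<^sub>R h"
      have hu: "norm h *\<^sub>R u = h" and u: "norm u = 1" using False by (simp_all add: u_def)
      have "\<bar>(norm (S + h) - norm S) / norm h - blinfun_apply (SGN S) u\<bar> < e"
        using close[of "norm h" u] False h u hu by (simp add: dist_real_def)
      moreover have "norm (S + h) - norm S - blinfun_apply (SGN S) h
          = norm h * ((norm (S + h) - norm S) / norm h - blinfun_apply (SGN S) u)"
      proof -
        have "blinfun_apply (SGN S) h = norm h * blinfun_apply (SGN S) u"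
          by (subst hu[symmetric]) (simp add: blinfun.scaleR_right)
        moreover have "norm h * ((norm (S + h) - norm S) / norm h) = norm (S + h) - norm S"
          using False by simp
        ultimately show ?thesis by (simp only: right_diff_distrib[of "norm h" "_ / _"])
      qed
      ultimately show ?thesis using False by (simp add: abs_mult mult.commute mult_left_mono)
    qed (simp add: blinfun.zero_right)
  qed
qed

text \<open>Depth decreases with the norm, so its fluctuation is to first order
  \<open>- SGN S\<close> applied to the normalised sum, and the symmetry of the Gaussian limit
  absorbs the sign. At \<open>S = 0\<close> the fluctuation is exactly minus the norm of the
  normalised sum, and the sign stays.\<close>

theorem emp_spatial_depth_weak_convergence:
  fixes X :: "nat \<Rightarrow> 'w \<Rightarrow> 'a::real_normed_vector"
  assumes iid: "iid_sample M X \<mu>"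
    and smooth: "smooth_space TYPE('a)"
    and sep: "separable_space (euclidean :: ('a \<Rightarrow>\<^sub>L real) topology)"
    and frechet: "frechet_smooth_space TYPE('a \<Rightarrow>\<^sub>L real)"
    and type2: "type_2_space TYPE('a \<Rightarrow>\<^sub>L real)"
  obtains N :: "('a \<Rightarrow>\<^sub>L real) measure" and C where "gaussian_element N (\<lambda>y. y) 0 C"
    and "spatial_distribution \<mu> x \<noteq> 0 \<Longrightarrow> weak_conv_m
        (\<lambda>n. distr M borel (\<lambda>\<omega>. sqrt (real n) * (emp_spatial_depth X n \<omega> x - spatial_depth \<mu> x)))
        (distr N borel (blinfun_apply (SGN (spatial_distribution \<mu> x))))"
    and "spatial_distribution \<mu> x = 0 \<Longrightarrow> weak_conv_m
        (\<lambda>n. distr M borel (\<lambda>\<omega>. sqrt (real n) * (emp_spatial_depth X n \<omega> x - spatial_depth \<mu> x)))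
        (distr N borel (\<lambda>y. - norm y))"
proof -
  interpret iid_sample M X \<mu> by (rule iid)
  obtain \<gamma> where \<gamma>: "0 < \<gamma>" and t2: "type_2_const TYPE('a \<Rightarrow>\<^sub>L real) \<gamma>"
    using type2 type_2_space_iff by blast
  have gm: "(\<lambda>y. SGN (x - y)) \<in> borel_measurable borel"
    by (rule SGN_diff_borel_measurable[OF smooth sep])
  have gm': "(\<lambda>y. SGN (x - y)) \<in> borel_measurable \<mu>"
    using gm by (simp cong: measurable_cong_sets)
  define S where "S = spatial_distribution \<mu> x"
  have S: "blinfun_apply S h = (\<integral>y. blinfun_apply (SGN (x - y)) h \<partial>\<mu>)" for h
    unfolding S_def spatial_distribution_def
    by (rule law.bochner_expectation_apply[OF sep gm' norm_SGN_le[OF smooth]])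
  define f where "f y = SGN (x - y) - S" for y
  have fm: "f \<in> borel_measurable borel"
    unfolding f_def by (rule diff_blinfun_measurable[OF sep gm]) simp
  have fB: "norm (f y) \<le> 1 + norm S" for y
    using norm_triangle_ineq4[of "SGN (x - y)" S] norm_SGN_le[OF smooth, of "x - y"] by (simp add: f_def)
  have f0: "(\<integral>y. blinfun_apply (f y) h \<partial>\<mu>) = 0" for h
    using law.integrable_blinfun_apply[OF sep gm' norm_SGN_le[OF smooth]] law.prob_space
    by (simp add: f_def blinfun.diff_left S)
  obtain V :: "(nat \<Rightarrow> real) \<Rightarrow> 'a \<Rightarrow>\<^sub>L real" and C where V: "gaussian_element white_noise V 0 C"
    and clt: "\<And>\<Psi> L K. \<forall>y z. \<bar>\<Psi> y - \<Psi> z\<bar> \<le> L * norm (y - z) \<Longrightarrow> \<forall>y. \<bar>\<Psi> y\<bar> \<le> K \<Longrightarrow>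
      (\<lambda>n. \<integral>\<omega>. \<Psi> ((1 / sqrt (real n)) *\<^sub>R (\<Sum>i<n. f (X i \<omega>))) \<partial>M) \<longlonglongrightarrow> (\<integral>g. (\<Psi> (V g) :: real) \<partial>white_noise)"
    by (rule type_2_central_limit[OF sep t2 \<gamma> fm fB f0]) (rule that; assumption)
  have Vm: "V \<in> borel_measurable white_noise" using V by (simp add: gaussian_element_def)
  define Z where "Z n \<omega> = (1 / sqrt (real n)) *\<^sub>R (\<Sum>i<n. f (X i \<omega>))" for n \<omega>
  define D where "D n \<omega> = sqrt (real n) * (emp_spatial_depth X n \<omega> x - spatial_depth \<mu> x)" for n \<omega>
  have emp: "emp_spatial_distribution X n \<omega> x = S + (1 / sqrt (real n)) *\<^sub>R Z n \<omega>" if n: "n \<ge> 1" for n \<omega>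
  proof -
    have "(\<Sum>i<n. SGN (x - X i \<omega>)) = (\<Sum>i<n. f (X i \<omega>)) + real n *\<^sub>R S"
      by (simp add: f_def sum_subtractf sum_constant_scaleR del: sum_constant)
    then show ?thesis
      using n unfolding emp_spatial_distribution_def Z_def by (simp add: scaleR_add_right)
  qed
  have D: "D n \<omega> = - sqrt (real n) * (norm (S + (1 / sqrt (real n)) *\<^sub>R Z n \<omega>) - norm S)" if "n \<ge> 1" for n \<omega>
    unfolding D_def emp_spatial_depth_def spatial_depth_def emp[OF that] S_def[symmetric]
    by (simp add: algebra_simps)
  have gX: "(\<lambda>\<omega>. SGN (x - X i \<omega>)) \<in> borel_measurable M" for i
    by (rule measurable_compose[OF X_measurable gm])
  have Dm: "D n \<in> borel_measurable M" for n
  proof -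
    have "(\<lambda>\<omega>. emp_spatial_distribution X n \<omega> x) \<in> borel_measurable M"
      unfolding emp_spatial_distribution_def
      by (intro scaleR_blinfun_measurable[OF sep] sum_blinfun_measurable[OF sep] gX) simp
    from norm_measurable[OF this] show ?thesis
      unfolding D_def emp_spatial_depth_def by measurable
  qed
  define N where "N = distr white_noise borel V"
  have NG: "gaussian_element N (\<lambda>y. y) 0 C"
    unfolding N_def by (rule gaussian_element_distr[OF V])
  have zero: "weak_conv_m (\<lambda>n. distr M borel (D n)) (distr N borel (\<lambda>y. - norm y))" if S0: "S = 0"
  proof -
    have "(\<lambda>y::'a \<Rightarrow>\<^sub>L real. - norm y) \<in> borel_measurable borel"
      by (intro borel_measurable_continuous_onI continuous_intros)
    then have "distr N borel (\<lambda>y. - norm y) = distr white_noise borel (\<lambda>g. - norm (V g))"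
      unfolding N_def by (rule gaussian_element_distr(2)[OF V])
    moreover have "weak_conv_m (\<lambda>n. distr M borel (D n)) (distr white_noise borel (\<lambda>g. - norm (V g)))"
    proof (rule weak_conv_distr_if_cts_step[OF prob_space_axioms prob_space_white_noise Dm])
      show "(\<lambda>g. - norm (V g)) \<in> borel_measurable white_noise" using norm_measurable[OF Vm] by simp
      fix a b :: real assume ab: "a < b"
      \<comment> \<open>The identity includes \<open>n = 0\<close>, where both sides are 0 through
        \<open>sqrt 0 = 0\<close> and the empty sum.\<close>
      have DZ: "D n \<omega> = - norm (Z n \<omega>)" for n \<omega>
      proof (cases "n \<ge> 1")
        case True
        then show ?thesis using D[OF True] by (simp add: S0)
      next
        case False
        then have "n = 0" by simp
        then show ?thesis by (simp add: D_def Z_def)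
      qed
      show "(\<lambda>n. \<integral>\<omega>. cts_step a b (D n \<omega>) \<partial>M) \<longlonglongrightarrow> (\<integral>g. cts_step a b (- norm (V g)) \<partial>white_noise)"
        unfolding DZ Z_def
      proof (rule clt[of "\<lambda>y. cts_step a b (- norm y)" "1 / (b - a)" 1]; intro allI)
        fix y z :: "'a \<Rightarrow>\<^sub>L real"
        have "\<bar>cts_step a b (- norm y) - cts_step a b (- norm z)\<bar> \<le> 1 / (b - a) * \<bar>- norm y - - norm z\<bar>"
          by (rule cts_step_lipschitz[OF ab])
        also have "\<dots> \<le> 1 / (b - a) * norm (y - z)"
          using ab norm_triangle_ineq3[of y z] by (intro mult_left_mono) auto
        finally show "\<bar>cts_step a b (- norm y) - cts_step a b (- norm z)\<bar> \<le> 1 / (b - a) * norm (y - z)" .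
      qed (rule cts_step_abs_le[OF ab])
    qed
    ultimately show ?thesis by simp
  qed
  have nonzero: "weak_conv_m (\<lambda>n. distr M borel (D n)) (distr N borel (blinfun_apply (SGN S)))" if S0: "S \<noteq> 0"
  proof -
    define A where "A = SGN S"
    have Am: "(\<lambda>g. blinfun_apply l (V g)) \<in> borel_measurable white_noise" for l :: "('a \<Rightarrow>\<^sub>L real) \<Rightarrow>\<^sub>L real"
      using Vm by (rule measurable_compose) (auto intro!: borel_measurable_continuous_onI continuous_intros)
    \<comment> \<open>The variance is quadratic in the functional, so \<open>A\<close> and
      \<open>- A\<close> have the same centred Gaussian law under \<open>V\<close>.\<close>
    have sym: "distr white_noise borel (\<lambda>g. - blinfun_apply A (V g)) = distr white_noise borel (\<lambda>g. blinfun_apply A (V g))"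
    proof -
      have law: "distr white_noise borel (\<lambda>g. blinfun_apply l (V g)) = real_gaussian 0 (blinfun_apply (blinfun_apply C l) l)" for l
        using V by (simp add: gaussian_element_def blinfun.zero_right)
      have "distr white_noise borel (\<lambda>g. blinfun_apply (- A) (V g)) = distr white_noise borel (\<lambda>g. blinfun_apply A (V g))"
        unfolding law by (simp add: blinfun.minus_left blinfun.minus_right)
      then show ?thesis by (simp add: blinfun.minus_left)
    qed
    have "blinfun_apply A \<in> borel_measurable borel"
      by (intro borel_measurable_continuous_onI continuous_intros)
    then have dN: "distr N borel (blinfun_apply A) = distr white_noise borel (\<lambda>g. blinfun_apply A (V g))"
      unfolding N_def by (rule gaussian_element_distr(2)[OF V])
    have "weak_conv_m (\<lambda>n. distr M borel (D n)) (distr white_noise borel (\<lambda>g. - blinfun_apply A (V g)))"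
    proof (rule weak_conv_distr_if_cts_step[OF prob_space_axioms prob_space_white_noise Dm])
      show "(\<lambda>g. - blinfun_apply A (V g)) \<in> borel_measurable white_noise" using Am[of A] by simp
      fix a b :: real assume ab: "a < b"
      define \<Psi> where "\<Psi> y = cts_step a b (- blinfun_apply A y)" for y
      have \<Psi>L: "\<bar>\<Psi> y - \<Psi> z\<bar> \<le> (1 / (b - a) * norm A) * norm (y - z)" for y z
      proof -
        have "\<bar>\<Psi> y - \<Psi> z\<bar> \<le> 1 / (b - a) * \<bar>- blinfun_apply A y - - blinfun_apply A z\<bar>"
          unfolding \<Psi>_def by (rule cts_step_lipschitz[OF ab])
        also have "\<dots> \<le> 1 / (b - a) * (norm A * norm (y - z))"
          using ab abs_blinfun_apply_le[of A "y - z"]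
          by (intro mult_left_mono) (auto simp: blinfun.diff_right abs_minus_commute)
        finally show ?thesis by simp
      qed
      have \<Psi>1: "\<bar>\<Psi> y\<bar> \<le> 1" for y unfolding \<Psi>_def by (rule cts_step_abs_le[OF ab])
      have limZ: "(\<lambda>n. \<integral>\<omega>. \<Psi> (Z n \<omega>) \<partial>M) \<longlonglongrightarrow> (\<integral>g. \<Psi> (V g) \<partial>white_noise)"
        unfolding Z_def by (rule clt) (use \<Psi>L \<Psi>1 in blast)+
      \<comment> \<open>This is the type 2 bound for the second moment of \<open>Z n\<close>, the
        same for all \<open>n \<ge> 1\<close>.\<close>
      define \<sigma> where "\<sigma> = \<gamma> * (\<integral>y. (norm (f y))\<^sup>2 \<partial>\<mu>)"
      have \<sigma>: "0 \<le> \<sigma>" using \<gamma> by (simp add: \<sigma>_def)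
      have diff0: "(\<lambda>n. (\<integral>\<omega>. cts_step a b (D n \<omega>) \<partial>M) - (\<integral>\<omega>. \<Psi> (Z n \<omega>) \<partial>M)) \<longlonglongrightarrow> 0"
      proof (rule tendstoI)
        fix \<eta> :: real assume \<eta>: "\<eta> > 0"
        \<comment> \<open>Half of \<open>\<eta>\<close> pays for linearisation, whose error is
          \<open>(\<sigma> + 1) * \<epsilon> / (b - a)\<close>; the other half pays for
          \<open>h\<close> leaving the ball of radius \<open>\<delta>\<close>.\<close>
        define \<epsilon> where "\<epsilon> = \<eta> * (b - a) / (2 * (\<sigma> + 1))"
        have \<epsilon>: "\<epsilon> > 0" using \<eta> ab \<sigma> by (simp add: \<epsilon>_def)
        have \<epsilon>': "1 / (b - a) * \<epsilon> * (\<sigma> + 1) = \<eta> / 2"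
        proof -
          have "1 / d * (\<eta> * d / (2 * y)) * y = \<eta> / 2" if "d > 0" "y > 0" for d y :: real
            using that by simp
          from this[of "b - a" "\<sigma> + 1"] show ?thesis using ab \<sigma> unfolding \<epsilon>_def by simp
        qed
        obtain \<delta> where \<delta>: "\<delta> > 0"
          and expand: "\<And>h. norm h < \<delta> \<Longrightarrow> \<bar>norm (S + h) - norm S - blinfun_apply A h\<bar> \<le> \<epsilon> * norm h"
          by (rule frechet_smooth_expansion[OF frechet S0 \<epsilon>, folded A_def]) (rule that; assumption)
        have "(\<lambda>n. \<sigma> / \<delta>\<^sup>2 * (1 / real n)) \<longlonglongrightarrow> 0"
          using tendsto_mult_right_zero[OF lim_1_over_n, of "\<sigma> / \<delta>\<^sup>2"] by simp
        then have "\<forall>\<^sub>F n in sequentially. \<sigma> / \<delta>\<^sup>2 * (1 / real n) < \<eta> / 2"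
          by (rule order_tendstoD) (use \<eta> in simp)
        then show "\<forall>\<^sub>F n in sequentially. dist ((\<integral>\<omega>. cts_step a b (D n \<omega>) \<partial>M) - (\<integral>\<omega>. \<Psi> (Z n \<omega>) \<partial>M)) 0 < \<eta>"
          using eventually_ge_at_top[of 1]
        proof eventually_elim
          case (elim n)
          have sq: "sqrt (real n) > 0" using elim by simp
          note t2n = type_2_normalized_sum[OF t2 sep fm fB f0 elim(2), folded Z_def \<sigma>_def]
          have Zm: "Z n \<in> borel_measurable M" using t2n(3) by (simp add: Z_def[abs_def])
          define w where "w = 1 / (b - a) * \<epsilon>"
          have w: "0 \<le> w" using ab \<epsilon> by (simp add: w_def)
          have "\<bar>(\<integral>\<omega>. cts_step a b (D n \<omega>) \<partial>M) - (\<integral>\<omega>. \<Psi> (Z n \<omega>) \<partial>M)\<bar>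
              \<le> (\<integral>\<omega>. (w + 1 / \<delta>\<^sup>2 * (1 / real n)) * (norm (Z n \<omega>))\<^sup>2 + w \<partial>M)"
          proof (rule abs_expectation_diff_le)
            show "integrable M (\<lambda>\<omega>. cts_step a b (D n \<omega>))"
              by (rule integrable_const_bound[of _ 1])
                (use cts_step_abs_le[OF ab] measurable_compose[OF Dm cts_step_measurable[OF ab]] in auto)
            show "integrable M (\<lambda>\<omega>. \<Psi> (Z n \<omega>))"
              by (rule integrable_const_bound[of _ 1]) (use \<Psi>1 lipschitz_measurable(2)[OF \<Psi>L Zm] in auto)
            show "integrable M (\<lambda>\<omega>. (w + 1 / \<delta>\<^sup>2 * (1 / real n)) * (norm (Z n \<omega>))\<^sup>2 + w)"
              using t2n(1) by simp
            fix \<omega>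
            define h where "h = (1 / sqrt (real n)) *\<^sub>R Z n \<omega>"
            have hZ: "sqrt (real n) * norm h = norm (Z n \<omega>)" and AZ: "sqrt (real n) * blinfun_apply A h = blinfun_apply A (Z n \<omega>)"
              using sq by (simp_all add: h_def blinfun.scaleR_right)
            \<comment> \<open>Inside the ball of radius \<open>\<delta>\<close> the expansion
              applies, and the norm of \<open>Z n \<omega>\<close> is traded for its square plus 1.
              Outside, the tests differ by at most 1, which is dominated as in Chebyshev's
              inequality by the squared norm divided by \<open>\<delta>^2 * n\<close>.\<close>
            show "\<bar>cts_step a b (D n \<omega>) - \<Psi> (Z n \<omega>)\<bar> \<le> (w + 1 / \<delta>\<^sup>2 * (1 / real n)) * (norm (Z n \<omega>))\<^sup>2 + w"
            proof (cases "norm h < \<delta>")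
              case True
              have "D n \<omega> - - blinfun_apply A (Z n \<omega>) = - sqrt (real n) * (norm (S + h) - norm S - blinfun_apply A h)"
                unfolding D[OF elim(2)] h_def[symmetric] AZ[symmetric] by (simp add: algebra_simps)
              then have "\<bar>D n \<omega> - - blinfun_apply A (Z n \<omega>)\<bar> = sqrt (real n) * \<bar>norm (S + h) - norm S - blinfun_apply A h\<bar>"
                by (simp add: abs_mult)
              also have "\<dots> \<le> sqrt (real n) * (\<epsilon> * norm h)"
                by (rule mult_left_mono[OF expand[OF True]]) simp
              also have "\<dots> = \<epsilon> * norm (Z n \<omega>)" by (simp add: hZ[symmetric])
              finally have "1 / (b - a) * \<bar>D n \<omega> - - blinfun_apply A (Z n \<omega>)\<bar> \<le> 1 / (b - a) * (\<epsilon> * norm (Z n \<omega>))"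
                using ab by (intro mult_left_mono) auto
              then have "\<bar>cts_step a b (D n \<omega>) - \<Psi> (Z n \<omega>)\<bar> \<le> w * norm (Z n \<omega>)"
                using cts_step_lipschitz[OF ab, of "D n \<omega>" "- blinfun_apply A (Z n \<omega>)"]
                by (simp add: \<Psi>_def w_def)
              also have "\<dots> \<le> w * ((norm (Z n \<omega>))\<^sup>2 + 1)"
                using le_weighted_square[of 1 "norm (Z n \<omega>)"] w by (intro mult_left_mono) auto
              also have "\<dots> \<le> w * ((norm (Z n \<omega>))\<^sup>2 + 1) + 1 / \<delta>\<^sup>2 * (1 / real n) * (norm (Z n \<omega>))\<^sup>2" by simp
              finally show ?thesis by (simp add: algebra_simps)
            next
              case False
              then have "sqrt (real n) * \<delta> \<le> norm (Z n \<omega>)"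
                unfolding hZ[symmetric] by (intro mult_left_mono) simp_all
              then have "(sqrt (real n) * \<delta>)\<^sup>2 \<le> (norm (Z n \<omega>))\<^sup>2" using \<delta> by (intro power_mono) auto
              then have "1 \<le> 1 / \<delta>\<^sup>2 * (1 / real n) * (norm (Z n \<omega>))\<^sup>2"
                using \<delta> elim(2) by (simp add: power_mult_distrib field_simps)
              moreover have "\<bar>cts_step a b (D n \<omega>) - \<Psi> (Z n \<omega>)\<bar> \<le> 1"
                using ab by (auto simp: \<Psi>_def cts_step_def divide_simps)
              moreover have "0 \<le> w * (norm (Z n \<omega>))\<^sup>2 + w" using w by simp
              ultimately show ?thesis by (simp add: distrib_right)
            qed
          qed
          also have "\<dots> = (w + 1 / \<delta>\<^sup>2 * (1 / real n)) * (\<integral>\<omega>. (norm (Z n \<omega>))\<^sup>2 \<partial>M) + w"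
            using t2n(1) prob_space by simp
          also have "\<dots> \<le> (w + 1 / \<delta>\<^sup>2 * (1 / real n)) * \<sigma> + w"
            using t2n(2) w by (intro add_right_mono mult_left_mono) auto
          also have "\<dots> = w * (\<sigma> + 1) + \<sigma> / \<delta>\<^sup>2 * (1 / real n)" by (simp add: algebra_simps)
          also have "\<dots> < \<eta>" using elim(1) \<epsilon>' unfolding w_def by linarith
          finally show ?case by (simp add: dist_real_def)
        qed
      qed
      from tendsto_add[OF diff0 limZ]
      show "(\<lambda>n. \<integral>\<omega>. cts_step a b (D n \<omega>) \<partial>M) \<longlonglongrightarrow> (\<integral>g. cts_step a b (- blinfun_apply A (V g)) \<partial>white_noise)"
        by (simp add: \<Psi>_def)
    qed
    then show ?thesis unfolding sym A_def[symmetric] dN .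
  qed
  show ?thesis
    by (rule that[OF NG]) (use zero nonzero in \<open>simp_all add: S_def D_def[abs_def]\<close>)
qed

section \<open>Uniform consistency and limit laws of the empirical spatial depth\<close>

theorem theorem4p1:
  fixes \<mu> :: "'a::banach measure"
    and M :: "'w measure"
    and X :: "nat \<Rightarrow> 'w \<Rightarrow> 'a"
  assumes smooth: "smooth_space TYPE('a)"
    and mu: "prob_space \<mu>" "sets \<mu> = sets borel"
    and M: "prob_space M"
    and indep: "prob_space.indep_vars M (\<lambda>_. borel) X UNIV"
    and ident: "\<And>i. distr M borel (X i) = \<mu>"
  shows
    "(\<forall>\<rho> \<mu>1 \<mu>2 T.
        separable_space (euclidean :: ('a \<Rightarrow>\<^sub>L real) topology) \<longrightarrow>
        atomic_decomposition \<mu> \<rho> \<mu>1 \<mu>2 \<longrightarrow>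
        T \<in> borel_measurable (restrict_space borel (- {0})) \<longrightarrow>
        (\<forall>x. x \<noteq> 0 \<longrightarrow> 0 < T x) \<longrightarrow>
        (\<forall>x h. x \<noteq> 0 \<longrightarrow> x \<noteq> - h \<longrightarrow> norm (SGN (x + h) - SGN x) \<le> T x * norm h) \<longrightarrow>
        (\<rho> > 0 \<longrightarrow>
          (\<forall>C>0. (SUP x\<in>cball 0 C. \<integral>\<^sup>+y\<in>- {x}. ennreal (T (x - y)) \<partial>\<mu>1) < \<infinity>)) \<longrightarrow>
        (\<forall>K. compact K \<longrightarrow>
          (AE \<omega> in M.
            (\<lambda>n. SUP x\<in>K. ennreal \<bar>emp_spatial_depth X n \<omega> x - spatial_depth \<mu> x\<bar>)
              \<longlonglongrightarrow> 0)))
     \<and>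
     (frechet_smooth_space TYPE('a \<Rightarrow>\<^sub>L real) \<longrightarrow>
      separable_space (euclidean :: ('a \<Rightarrow>\<^sub>L real) topology) \<longrightarrow>
      type_2_space TYPE('a \<Rightarrow>\<^sub>L real) \<longrightarrow>
      (\<forall>x.
        (spatial_distribution \<mu> x \<noteq> 0 \<longrightarrow>
          (\<exists>(N :: ('a \<Rightarrow>\<^sub>L real) measure) (W :: _ \<Rightarrow> ('a \<Rightarrow>\<^sub>L real)) C.
            gaussian_element N W 0 C \<and>
            weak_conv_m
              (\<lambda>n. distr M borel
                (\<lambda>\<omega>. sqrt (real n) * (emp_spatial_depth X n \<omega> x - spatial_depth \<mu> x)))
              (distr N borel (\<lambda>\<omega>. blinfun_apply (SGN (spatial_distribution \<mu> x)) (W \<omega>))))) \<and>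
        (spatial_distribution \<mu> x = 0 \<longrightarrow>
          (\<exists>(N :: ('a \<Rightarrow>\<^sub>L real) measure) (V :: _ \<Rightarrow> ('a \<Rightarrow>\<^sub>L real)) C.
            gaussian_element N V 0 C \<and>
            weak_conv_m
              (\<lambda>n. distr M borel
                (\<lambda>\<omega>. sqrt (real n) * (emp_spatial_depth X n \<omega> x - spatial_depth \<mu> x)))
              (distr N borel (\<lambda>\<omega>. - norm (V \<omega>)))))))"
proof -
  have iid: "iid_sample M X \<mu>"
    using M indep ident by (simp add: iid_sample_def iid_sample_axioms_def)
  note uniform = emp_spatial_depth_uniform_convergence[OF iid smooth]
  note weak = emp_spatial_depth_weak_convergence[OF iid smooth]
  show ?thesis
    apply (rule conjI)
    subgoal using uniform by simp
    subgoal premises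
      apply (intro allI impI)
      subgoal premises hyps for x
        \<comment> \<open>One Gaussian law on the dual serves both cases, with the identity map as
          the random element.\<close>
        by (rule weak[OF hyps(2,1,3), of x]) (intro conjI impI exI; assumption | simp)
      done
    done
qed

end
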